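(* Let $\mathbf{X}=\{X_t\}_{t\ge0}$ be a Lévy process in $\mathbb{R}^d$ with finite variation, with Lévy measure $\nu$ and with $\gamma_0=\int_{\|y\|\le1}y\,\nu(dy)-\gamma$. Let $\Omega\subset\mathbb{R}^d$ be an open set of finite Lebesgue measure $|\Omega|$ and finite perimeter $\mathrm{Per}(\Omega)$, and let $H(t)=\int_\Omega\mathbb{P}_x(X_t\in\Omega^c)\,dx$. Then $$\lim_{t\to0^+}t^{-1}H(t)=\mathrm{Per}_{\mathbf{X}}(\Omega)+\frac{\|\gamma_0\|}{2}\,V_{\frac{\gamma_0}{\|\gamma_0\|}}(\Omega)\,\mathbf{1}_{\mathbb{R}^d\setminus\{0\}}(\gamma_0),$$ where the second summand is understood to be $0$ when $\gamma_0=0$.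
   Context: A Lévy process $\mathbf{X}=\{X_t\}_{t\ge0}$ in $\mathbb{R}^d$ is a càdlàg process with stationary independent increments; under $\mathbb{P}$ it starts at $X_0=0$, and $\mathbb{P}_x$ denotes the law of the process started at $x$. We have $\mathbb{E}e^{i\langle X_t,\xi\rangle}=e^{-t\psi(\xi)}$ with $$\psi(x)=\langle x,Ax\rangle-i\langle x,\gamma\rangle-\int_{\mathbb{R}^d}\left(e^{i\langle x,y\rangle}-1-i\langle x,y\rangle\mathbf{1}_{\{\|y\|\le1\}}\right)\nu(dy),$$ where $A$ is symmetric non-negative definite, $\gamma\in\mathbb{R}^d$, and $\nu$ is a Lévy measure ($\nu(\{0\})=0$, $\int(1\wedge\|y\|^2)\,\nu(dy)<\infty$). The process has finite variation (on every interval $(0,t)$) if and only if $A=0$ and $\int_{\|x\|\le1}\|x\|\,\nu(dx)<\infty$; then $\psi(x)=i\langle x,\gamma_0\rangle+\int_{\mathbb{R}^d}(1-e^{i\langle x,y\rangle})\,\nu(dy)$ with $\gamma_0=\int_{\|y\|\le1}y\,\nu(dy)-\gamma$. The perimeter of $\Omega$ related to $\mathbf{X}$ is $$\mathrm{Per}_{\mathbf{X}}(\Omega)=\int_\Omega\int_{\Omega^c-x}\nu(dy)\,dx.$$ The (classical) perimeter of a measurable set $\Omega\subset\mathbb{R}^d$ is $$\mathrm{Per}(\Omega)=\sup\left\{\int_{\mathbb{R}^d}\mathbf{1}_\Omega(x)\,\mathrm{div}\,\phi(x)\,dx:\ \phi\in C_c^1(\mathbb{R}^d,\mathbb{R}^d),\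 \|\phi\|_\infty\le1\right\}.$$ For $u$ in the unit sphere $\mathbb{S}^{d-1}$, $V_u(\Omega)$ (called the directional derivative of $\mathbf{1}_\Omega$ in the direction $u$) is $$V_u(\Omega)=\sup\left\{\int_{\mathbb{R}^d}\mathbf{1}_\Omega(x)\,\langle\nabla\varphi(x),u\rangle\,dx:\ \varphi\in C_c^1(\mathbb{R}^d,\mathbb{R}),\ \|\varphi\|_\infty\le1\right\}.$$ *)

theory Defs
  imports "HOL-Probability.Probability"
begin

definition cadlag :: "(real \<Rightarrow> 'b::topological_space) \<Rightarrow> bool" where
  "cadlag f \<longleftrightarrow>
     (\<forall>t\<ge>0. (f \<longlongrightarrow> f t) (at_right t)) \<and> (\<forall>t>0. \<exists>l. (f \<longlongrightarrow> l) (at_left t))"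

(* Only the variables X t with t \<ge> 0 matter. The initial condition and the path regularity are
   required almost surely. *)
locale levy_process = prob_space M
  for M :: "'w measure" and X :: "real \<Rightarrow> 'w \<Rightarrow> real ^ 'n" +
  assumes random_variables: "\<And>t. 0 \<le> t \<Longrightarrow> random_variable borel (X t)"
    and starts_at_0: "AE \<omega> in M. X 0 \<omega> = 0"
    and stationary_increments:
      "\<And>s h. 0 \<le> s \<Longrightarrow> 0 \<le> h \<Longrightarrow>
         distr M borel (\<lambda>\<omega>. X (s + h) \<omega> - X s \<omega>) = distr M borel (\<lambda>\<omega>. X h \<omega> - X 0 \<omega>)"
    and independent_increments:
      "\<And>(n::nat) s. 0 \<le> s 0 \<Longrightarrow> (\<And>i. i < n \<Longrightarrow> s i < s (Suc i)) \<Longrightarrow>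
         indep_vars (\<lambda>_. borel) (\<lambda>i \<omega>. X (s (Suc i)) \<omega> - X (s i) \<omega>) {..<n}"
    and cadlag_paths: "AE \<omega> in M. cadlag (\<lambda>t. X t \<omega>)"

definition levy_measure :: "(real ^ 'n) measure \<Rightarrow> bool" where
  "levy_measure \<nu> \<longleftrightarrow>
     sets \<nu> = sets borel \<and> emeasure \<nu> {0} = 0 \<and>
     (\<integral>\<^sup>+ y. ennreal (min 1 ((norm y)\<^sup>2)) \<partial>\<nu>) < \<infinity>"

(* Normalisation: the Gaussian part is x \<bullet> (A *v x), without the factor 1/2. *)
definition levy_exponent ::
    "real ^ 'n ^ 'n \<Rightarrow> real ^ 'n \<Rightarrow> (real ^ 'n) measure \<Rightarrow> real ^ 'n \<Rightarrow> complex" where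
  "levy_exponent A \<gamma> \<nu> x =
     of_real (x \<bullet> (A *v x)) - \<i> * of_real (x \<bullet> \<gamma>)
     - (\<integral>y. exp (\<i> * of_real (x \<bullet> y)) - 1
             - \<i> * of_real (x \<bullet> y) * indicator {y. norm y \<le> 1} y \<partial>\<nu>)"

definition has_levy_triplet ::
    "'w measure \<Rightarrow> (real \<Rightarrow> 'w \<Rightarrow> real ^ 'n) \<Rightarrow>
     real ^ 'n ^ 'n \<Rightarrow> real ^ 'n \<Rightarrow> (real ^ 'n) measure \<Rightarrow> bool" where
  "has_levy_triplet M X A \<gamma> \<nu> \<longleftrightarrow>
     transpose A = A \<and> (\<forall>x. 0 \<le> x \<bullet> (A *v x)) \<and> levy_measure \<nu> \<and>
     (\<forall>t\<ge>0. \<forall>\<xi>. (\<integral>\<omega>. exp (\<i> * of_real (X t \<omega> \<bullet> \<xi>)) \<partial>M)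
                   = exp (- (of_real t * levy_exponent A \<gamma> \<nu> \<xi>)))"

definition bounded_variation_on :: "real set \<Rightarrow> (real \<Rightarrow> 'b::real_normed_vector) \<Rightarrow> bool" where
  "bounded_variation_on S f \<longleftrightarrow>
     (\<exists>B. \<forall>(n::nat) s. (\<forall>i\<le>n. s i \<in> S) \<longrightarrow> (\<forall>i<n. s i \<le> s (Suc i)) \<longrightarrow>
        (\<Sum>i<n. norm (f (s (Suc i)) - f (s i))) \<le> B)"

(* Finite variation is a property of the paths; its description in terms of the triplet
   (A = 0 and norm integrable near 0 under the Levy measure) is a theorem, not the definition. *)
definition finite_variation_process :: "'w measure \<Rightarrow> (real \<Rightarrow> 'w \<Rightarrow> real ^ 'n) \<Rightarrow> bool" where
  "finite_variation_process M X \<longleftrightarrow>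
     (AE \<omega> in M. \<forall>t>0. bounded_variation_on {0<..<t} (\<lambda>s. X s \<omega>))"

definition levy_drift :: "real ^ 'n \<Rightarrow> (real ^ 'n) measure \<Rightarrow> real ^ 'n" where
  "levy_drift \<gamma> \<nu> = (LINT y:{y. norm y \<le> 1}|\<nu>. y) - \<gamma>"

(* The law P_x of the process started at x is the law of x + X. *)
definition heat_loss ::
    "'w measure \<Rightarrow> (real \<Rightarrow> 'w \<Rightarrow> real ^ 'n) \<Rightarrow> (real ^ 'n) set \<Rightarrow> real \<Rightarrow> real" where
  "heat_loss M X \<Omega> t = (LINT x:\<Omega>|lebesgue. \<P>(\<omega> in M. x + X t \<omega> \<in> - \<Omega>))"

definition levy_perimeter :: "(real ^ 'n) measure \<Rightarrow> (real ^ 'n) set \<Rightarrow> ennreal" where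
  "levy_perimeter \<nu> \<Omega> = (\<integral>\<^sup>+x\<in>\<Omega>. emeasure \<nu> ((\<lambda>z. z - x) ` (- \<Omega>)) \<partial>lebesgue)"

definition C1_compact_support ::
    "('a::euclidean_space \<Rightarrow> 'b::euclidean_space) \<Rightarrow> bool" where
  "C1_compact_support \<phi> \<longleftrightarrow>
     (\<exists>D. (\<forall>x. (\<phi> has_derivative blinfun_apply (D x)) (at x)) \<and> continuous_on UNIV D) \<and>
     compact (closure (support_on UNIV \<phi>))"

definition divergence :: "(real ^ 'n \<Rightarrow> real ^ 'n) \<Rightarrow> real ^ 'n \<Rightarrow> real" where
  "divergence \<phi> x = (\<Sum>i\<in>UNIV. frechet_derivative \<phi> (at x) (axis i 1) $ i)"

definition gradient :: "(real ^ 'n \<Rightarrow> real) \<Rightarrow> real ^ 'n \<Rightarrow> real ^ 'n" where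
  "gradient \<phi> x = (\<chi> i. frechet_derivative \<phi> (at x) (axis i 1))"

definition perimeter :: "(real ^ 'n) set \<Rightarrow> ereal" where
  "perimeter \<Omega> =
     (SUP \<phi>\<in>{\<phi> :: real ^ 'n \<Rightarrow> real ^ 'n. C1_compact_support \<phi> \<and> (\<forall>x. norm (\<phi> x) \<le> 1)}.
        ereal (\<integral>x. indicator \<Omega> x * divergence \<phi> x \<partial>lebesgue))"

definition directional_variation :: "real ^ 'n \<Rightarrow> (real ^ 'n) set \<Rightarrow> ereal" where
  "directional_variation u \<Omega> =
     (SUP \<phi>\<in>{\<phi> :: real ^ 'n \<Rightarrow> real. C1_compact_support \<phi> \<and> (\<forall>x. \<bar>\<phi> x\<bar> \<le> 1)}.
        ereal (\<integral>x. indicator \<Omega> x * (gradient \<phi> x \<bullet> u) \<partial>lebesgue))"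

end

theory Submission
  imports Defs
begin

text \<open>
  Let \<open>c y = |\<Omega> \<inter> (\<Omega> - y)|\<close> be the covariogram of \<open>\<Omega>\<close>. By Fubini \<open>H t = E (c 0 - c (X t))\<close> and
  \<open>Per\<^sub>X \<Omega> = \<integral> (c 0 - c y) \<nu>(dy)\<close>. Finite perimeter makes \<open>c\<close> Lipschitz, and
  \<open>2 (c 0 - c (r u)) / r\<close> tends to \<open>V\<^sub>u \<Omega>\<close> as \<open>r\<close> decreases to \<open>0\<close>. It therefore suffices to show that
  \<open>(E c (X t) - c (- t \<gamma>\<^sub>0)) / t\<close> tends to \<open>\<integral> (c y - c 0) \<nu>(dy)\<close>.

  The process \<open>Y t = X t + t \<gamma>\<^sub>0\<close> has no drift. If \<open>f\<close> is the Fourier transform of a measure with a first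
  moment, then differentiating \<open>exp (- s \<psi>)\<close> gives
  \<open>E f (Y t + b) - f b = \<integral>\<^sub>0\<^sup>t \<integral> E (f (Y s + b + y) - f (Y s + b)) \<nu>(dy) ds\<close>.
  For a bounded Lipschitz \<open>f\<close> the inner integral differs from \<open>\<integral> (f y - f 0) \<nu>(dy)\<close> by at most a multiple of
  \<open>\<integral> E min(1, |y|, |Y s + b|) \<nu>(dy)\<close>, which is small for small \<open>s\<close> and \<open>b\<close>. The bound depends on \<open>f\<close> only
  through its Lipschitz data, so it passes from the Gaussian mollifications of \<open>c\<close> to \<open>c\<close> itself.

  Finite variation of the paths enters through \<open>E exp (- S\<^sub>n) = (E exp (- |X (1/n)|))^n\<close>, where \<open>S\<^sub>n\<close> is the
  variation of a path along \<open>n\<close> equal time steps. The left side is bounded away from \<open>0\<close>, hence \<open>n E min(1, |X (1/n)|)\<close> is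
  bounded. Testing with \<open>\<Sum>k<N. (1 - cos (2^k u)) / 2^k\<close>, which is comparable to \<open>|u|\<close> on \<open>2^-N < |u| < 1\<close> and
  is a combination of characters, turns this into \<open>A = 0\<close> and \<open>\<integral> min(1, |y|) \<nu>(dy) < \<infinity>\<close>.
\<close>

section \<open>Differentiable cutoff functions\<close>

text \<open>Derivatives are \<open>blinfun\<close>-valued, so their continuity is continuity in
  operator norm, as in \<open>C1_compact_support\<close>; without a support condition the class is
  closed under the algebra that builds cutoffs.\<close>

definition C1 :: "('a::euclidean_space \<Rightarrow> real) \<Rightarrow> bool" where
  "C1 f \<longleftrightarrow> (\<exists>D. (\<forall>x. (f has_derivative blinfun_apply (D x)) (at x)) \<and> continuous_on UNIV D)"

lemma C1_const: "C1 (\<lambda>x. c)"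
  unfolding C1_def by (intro exI[of _ "\<lambda>_. 0"]) (auto simp: zero_blinfun.rep_eq)

lemma C1_add:
  assumes "C1 f" "C1 g" shows "C1 (\<lambda>x. f x + g x)"
proof -
  from assms obtain D E where
    "\<And>x. (f has_derivative blinfun_apply (D x)) (at x)" "continuous_on UNIV D"
    "\<And>x. (g has_derivative blinfun_apply (E x)) (at x)" "continuous_on UNIV E"
    unfolding C1_def by blast
  then show ?thesis
    unfolding C1_def
    by (intro exI[of _ "\<lambda>x. D x + E x"])
       (auto intro!: continuous_intros derivative_eq_intros simp: plus_blinfun.rep_eq)
qed

lemma C1_mult:
  assumes "C1 f" "C1 g" shows "C1 (\<lambda>x. f x * g x)"
proof -
  from assms obtain D E where *:
    "\<And>x. (f has_derivative blinfun_apply (D x)) (at x)" "continuous_on UNIV D"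
    "\<And>x. (g has_derivative blinfun_apply (E x)) (at x)" "continuous_on UNIV E"
    unfolding C1_def by blast
  then have "continuous_on UNIV f" "continuous_on UNIV g"
    by (auto simp: continuous_on_eq_continuous_within intro: has_derivative_continuous)
  with * show ?thesis
    unfolding C1_def
    by (intro exI[of _ "\<lambda>x. f x *\<^sub>R E x + g x *\<^sub>R D x"])
       (auto intro!: continuous_intros derivative_eq_intros
          simp: plus_blinfun.rep_eq scaleR_blinfun.rep_eq algebra_simps)
qed

lemma C1_diff:
  assumes "C1 f" "C1 g" shows "C1 (\<lambda>x. f x - g x)"
  using C1_add[OF assms(1) C1_mult[OF C1_const[of "-1"] assms(2)]] by simp

lemma C1_prod:
  assumes "finite I" "\<And>i. i \<in> I \<Longrightarrow> C1 (f i)" shows "C1 (\<lambda>x. \<Prod>i\<in>I. f i x)"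
  using assms by (induction I rule: finite_induct) (auto intro: C1_const C1_mult)

text \<open>Squaring the positive part removes its corner at 0; test functions have to be only once
  continuously differentiable, so this suffices to build cutoffs.\<close>

lemma has_real_derivative_pos_square:
  "((\<lambda>t::real. (max 0 t)\<^sup>2) has_real_derivative 2 * max 0 t) (at t)"
proof -
  consider "t > 0" | "t < 0" | "t = 0" by linarith
  then show ?thesis
  proof cases
    case 1
    have "((\<lambda>t::real. t\<^sup>2) has_real_derivative 2 * t) (at t)"
      by (auto intro!: derivative_eq_intros)
    then show ?thesis
      using 1 has_field_derivative_transform_within_open[of power2 "2 * t" t "{0<..}" "\<lambda>t. (max 0 t)\<^sup>2"]
      by simp
  next
    case 2
    have "((\<lambda>t::real. 0) has_real_derivative 0) (at t)" by simp
    then show ?thesis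
      using 2 has_field_derivative_transform_within_open[of "\<lambda>_. 0" 0 t "{..<0}" "\<lambda>t. (max 0 t)\<^sup>2"]
      by simp
  next
    case 3
    have "((\<lambda>h::real. (max 0 h)\<^sup>2 / h) \<longlongrightarrow> 0) (at 0)"
    proof (rule Lim_null_comparison)
      show "\<forall>\<^sub>F h::real in at 0. norm ((max 0 h)\<^sup>2 / h) \<le> \<bar>h\<bar>"
        by (auto simp: eventually_at_filter max_def power2_eq_square)
      show "((\<lambda>h::real. \<bar>h\<bar>) \<longlongrightarrow> 0) (at 0)"
        using tendsto_rabs_zero[OF tendsto_ident_at] .
    qed
    then show ?thesis
      using 3 by (simp add: DERIV_def)
  qed
qed

lemma C1_pos_square:
  assumes "C1 f" shows "C1 (\<lambda>x. (max 0 (f x))\<^sup>2)"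
proof -
  from assms obtain D where *:
    "\<And>x. (f has_derivative blinfun_apply (D x)) (at x)" "continuous_on UNIV D"
    unfolding C1_def by blast
  then have c: "continuous_on UNIV f"
    by (auto simp: continuous_on_eq_continuous_within intro: has_derivative_continuous)
  have "((\<lambda>x. (max 0 (f x))\<^sup>2) has_derivative blinfun_apply ((2 * max 0 (f x)) *\<^sub>R D x)) (at x)" for x
    using has_derivative_compose[OF *(1) has_real_derivative_pos_square[of "f x", unfolded has_field_derivative_def]]
    by (simp add: scaleR_blinfun.rep_eq)
  then show ?thesis
    unfolding C1_def
    by (intro exI[of _ "\<lambda>x. (2 * max 0 (f x)) *\<^sub>R D x"]) (auto intro!: continuous_intros * c)
qed

lemma C1_dist_square: "C1 (\<lambda>x. (norm (x - a))\<^sup>2)"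
proof -
  have "((\<lambda>x. (norm (x - a))\<^sup>2) has_derivative blinfun_apply (2 *\<^sub>R blinfun_inner_left (x - a))) (at x)" for x
    unfolding power2_norm_eq_inner
    by (auto intro!: derivative_eq_intros simp: scaleR_blinfun.rep_eq inner_commute)
  then show ?thesis
    unfolding C1_def
    by (intro exI[of _ "\<lambda>x. 2 *\<^sub>R blinfun_inner_left (x - a)"])
       (auto intro!: continuous_intros bounded_linear.continuous_on[OF bounded_linear_blinfun_inner_left])
qed

text \<open>A profile in the squared distance from \<open>a\<close> is pushed through the squared
  positive part twice: once to vanish beyond radius \<open>2 * r\<close>, once to saturate at 1
  within radius \<open>r\<close>.\<close>

lemma C1_bump:
  assumes "0 < r"
  obtains f :: "'a::euclidean_space \<Rightarrow> real" where "C1 f" "\<And>x. 0 \<le> f x" "\<And>x. f x \<le> 1"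
    "\<And>x. dist a x \<le> r \<Longrightarrow> f x = 1" "\<And>x. 2 * r \<le> dist a x \<Longrightarrow> f x = 0"
proof
  \<comment> \<open>The coefficients make \<open>t\<close> equal to 1 at distance \<open>r\<close>
    and to 0 at distance \<open>2 * r\<close>.\<close>
  define t :: "'a \<Rightarrow> real" where "t x = 4 / 3 - (norm (x - a))\<^sup>2 / (3 * r\<^sup>2)" for x
  define f where "f x = 1 - (max 0 (1 - (max 0 (t x))\<^sup>2))\<^sup>2" for x
  have t1: "1 \<le> t x" if "dist a x \<le> r" for x
  proof -
    have "(norm (x - a))\<^sup>2 \<le> r\<^sup>2" using that by (simp add: dist_norm norm_minus_commute power_mono)
    then show ?thesis using assms by (simp add: t_def field_simps)
  qed
  have t0: "t x \<le> 0" if "2 * r \<le> dist a x" for x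
  proof -
    have "(2 * r)\<^sup>2 \<le> (norm (x - a))\<^sup>2"
      using that assms by (intro power_mono) (auto simp: dist_norm norm_minus_commute)
    then show ?thesis using assms by (simp add: t_def field_simps)
  qed
  have "C1 (\<lambda>x. 4 / 3 - (1 / (3 * r\<^sup>2)) * (norm (x - a))\<^sup>2)"
    by (intro C1_diff C1_mult C1_const C1_dist_square)
  then have "C1 t" by (simp add: t_def[abs_def])
  then show "C1 f"
    unfolding f_def by (intro C1_diff[OF C1_const] C1_pos_square)
  show "0 \<le> f x" for x
    unfolding f_def by (simp add: power_le_one)
  show "f x \<le> 1" for x
    unfolding f_def by simp
  show "f x = 1" if "dist a x \<le> r" for x
    using t1[OF that] by (simp add: f_def)
  show "f x = 0" if "2 * r \<le> dist a x" for x
    using t0[OF that] by (simp add: f_def)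
qed

text \<open>Finitely many bumps supported in \<open>U\<close> cover \<open>K\<close>. The
  combination \<open>1 - (\<Prod>a\<in>C. 1 - b a x)\<close> acts as a differentiable union: it is 1
  as soon as one bump is 1, and 0 where all bumps vanish.\<close>

lemma C1_cutoff:
  fixes K U :: "'a::euclidean_space set"
  assumes "compact K" "open U" "K \<subseteq> U"
  obtains f where "C1 f" "\<And>x. 0 \<le> f x" "\<And>x. f x \<le> 1" "\<And>x. x \<in> K \<Longrightarrow> f x = 1"
    "\<And>x. f x \<noteq> 0 \<Longrightarrow> x \<in> U" "bounded {x. f x \<noteq> 0}"
proof -
  have "\<forall>a\<in>K. \<exists>r>0. ball a (2 * r) \<subseteq> U"
  proof
    fix a assume "a \<in> K"
    then obtain e where "e > 0" "ball a e \<subseteq> U" using assms by (meson openE subsetD)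
    then show "\<exists>r>0. ball a (2 * r) \<subseteq> U" by (intro exI[of _ "e / 2"]) auto
  qed
  then obtain r where r: "\<And>a. a \<in> K \<Longrightarrow> r a > 0" "\<And>a. a \<in> K \<Longrightarrow> ball a (2 * r a) \<subseteq> U" by metis
  obtain C where C: "C \<subseteq> K" "finite C" "K \<subseteq> (\<Union>a\<in>C. ball a (r a))"
    proof (rule compactE_image[OF assms(1), of K "\<lambda>a. ball a (r a)"])
    show "K \<subseteq> (\<Union>a\<in>K. ball a (r a))" using r(1) by force
  qed auto
  have "\<forall>a\<in>K. \<exists>f. C1 f \<and> (\<forall>x. 0 \<le> f x) \<and> (\<forall>x. f x \<le> 1) \<and> (\<forall>x. dist a x \<le> r a \<longrightarrow> f x = 1)
      \<and> (\<forall>x. 2 * r a \<le> dist a x \<longrightarrow> f x = 0)"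
    using C1_bump r(1) by metis
  from bchoice[OF this] obtain b where b': "\<forall>a\<in>K. C1 (b a) \<and> (\<forall>x. 0 \<le> b a x) \<and> (\<forall>x. b a x \<le> 1)
      \<and> (\<forall>x. dist a x \<le> r a \<longrightarrow> b a x = 1) \<and> (\<forall>x. 2 * r a \<le> dist a x \<longrightarrow> b a x = (0::real))" ..
  then have b: "\<And>a. a \<in> K \<Longrightarrow> C1 (b a)" "\<And>a x. a \<in> K \<Longrightarrow> 0 \<le> b a x"
    "\<And>a x. a \<in> K \<Longrightarrow> b a x \<le> 1" "\<And>a x. a \<in> K \<Longrightarrow> dist a x \<le> r a \<Longrightarrow> b a x = 1"
    "\<And>a x. a \<in> K \<Longrightarrow> 2 * r a \<le> dist a x \<Longrightarrow> b a x = (0::real)" by blast+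
  define f where "f x = 1 - (\<Prod>a\<in>C. 1 - b a x)" for x
  have supp: "\<exists>a\<in>C. x \<in> ball a (2 * r a)" if "f x \<noteq> 0" for x
  proof (rule ccontr)
    assume "\<not> ?thesis"
    then have "\<forall>a\<in>C. b a x = 0" using C(1) b(5) by (auto simp: not_less)
    then have "f x = 0" by (simp add: f_def)
    with that show False by simp
  qed
  show thesis
  proof
    show "C1 f" unfolding f_def using C(1) b(1) by (intro C1_diff C1_prod C1_const C) auto
    show "0 \<le> f x" for x unfolding f_def using C(1) b(2,3) by (auto intro!: prod_le_1)
    show "f x \<le> 1" for x unfolding f_def using C(1) b(3) by (auto intro!: prod_nonneg)
    show "f x = 1" if "x \<in> K" for x
    proof -
      from that C(3) obtain a where "a \<in> C" "dist a x < r a" by auto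
      then have "b a x = 1" using b(4) C(1) by auto
      then have "(\<Prod>a\<in>C. 1 - b a x) = 0"
        using \<open>a \<in> C\<close> C(2) by (intro prod_zero) auto
      then show ?thesis by (simp add: f_def)
    qed
    show "x \<in> U" if "f x \<noteq> 0" for x using supp[OF that] r(2) C(1) by blast
    have "{x. f x \<noteq> 0} \<subseteq> (\<Union>a\<in>C. ball a (2 * r a))" using supp by auto
    then show "bounded {x. f x \<noteq> 0}"
      by (rule bounded_subset[rotated]) (auto simp: C(2))
  qed
qed

section \<open>Compactly supported C1 functions and integrals over their translates\<close>

lemma C1_compact_support_iff:
  "C1_compact_support (f :: 'a::euclidean_space \<Rightarrow> real) \<longleftrightarrow> C1 f \<and> bounded {x. f x \<noteq> 0}"
  unfolding C1_compact_support_def C1_def support_on_def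
  by (auto simp: compact_closure)

lemma gradient_inner:
  fixes u :: "real ^ 'n"
  assumes "(\<phi> has_derivative D) (at x)"
  shows "gradient \<phi> x \<bullet> u = D u"
proof -
  interpret D: linear D using has_derivative_linear[OF assms] .
  have fd: "frechet_derivative \<phi> (at x) = D"
    using frechet_derivative_at[OF assms] by simp
  have "D u = D (\<Sum>i\<in>UNIV. u $ i *\<^sub>R axis i 1)"
    using basis_expansion[of u] by (simp add: scalar_mult_eq_scaleR)
  also have "\<dots> = (\<Sum>i\<in>UNIV. u $ i * D (axis i 1))"
    by (simp add: D.sum D.scaleR)
  finally show ?thesis
    by (simp add: gradient_def inner_vec_def fd mult.commute)
qed

lemma C1_translate:
  assumes "C1 f" shows "C1 (\<lambda>x. f (x + a))"
proof -
  from assms obtain D where *: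
    "\<And>x. (f has_derivative blinfun_apply (D x)) (at x)" "continuous_on UNIV D"
    unfolding C1_def by blast
  have "((\<lambda>x. f (x + a)) has_derivative blinfun_apply (D (x + a))) (at x)" for x
    by (rule has_derivative_compose[of "\<lambda>x. x + a" "\<lambda>h. h", OF _ *(1)])
       (auto intro!: derivative_eq_intros)
  moreover have "continuous_on UNIV (\<lambda>x. D (x + a))"
    by (rule continuous_on_compose2[OF *(2)]) (auto intro!: continuous_intros)
  ultimately show ?thesis
    unfolding C1_def by (intro exI[of _ "\<lambda>x. D (x + a)"]) auto
qed

lemma C1_compact_support_translate:
  fixes f :: "'a::euclidean_space \<Rightarrow> real"
  assumes "C1_compact_support f" shows "C1_compact_support (\<lambda>x. f (x + a))"
proof -
  have "{x. f (x + a) \<noteq> 0} = (\<lambda>x. x - a) ` {x. f x \<noteq> 0}"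
    by (force intro: image_eqI[of _ _ "_ + a"])
  then have "bounded {x. f (x + a) \<noteq> 0}"
    using assms bounded_translation_minus[of "{x. f x \<noteq> 0}" a] by (simp add: C1_compact_support_iff)
  with assms C1_translate[of f a] show ?thesis by (simp add: C1_compact_support_iff)
qed

text \<open>On the compact closure of the support a continuous derivative is bounded; off that
  closure the function vanishes on a neighbourhood, so the derivative is 0.\<close>

lemma C1_compact_support_derivative:
  fixes f :: "'a::euclidean_space \<Rightarrow> real"
  assumes "C1_compact_support f"
  obtains D B where "\<And>x. (f has_derivative blinfun_apply (D x)) (at x)" "continuous_on UNIV D"
    "\<And>x. norm (D x) \<le> B"
proof -
  from assms obtain D where D:
    "\<And>x. (f has_derivative blinfun_apply (D x)) (at x)" "continuous_on UNIV D"
    and K: "compact (closure {x. f x \<noteq> 0})"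
    unfolding C1_compact_support_def support_on_def by auto
  have "compact (D ` closure {x. f x \<noteq> 0})"
    using K D(2) by (intro compact_continuous_image) (auto intro: continuous_on_subset)
  then obtain B where B: "\<And>x. x \<in> closure {x. f x \<noteq> 0} \<Longrightarrow> norm (D x) \<le> B" "0 < B"
    using compact_imp_bounded bounded_pos by (metis imageI)
  have "D x = 0" if "x \<notin> closure {x. f x \<noteq> 0}" for x
  proof -
    have "((\<lambda>_. 0) has_derivative blinfun_apply (D x)) (at x)"
      by (rule has_derivative_transform_within_open[OF D(1), where s="- closure {x. f x \<noteq> 0}"])
         (use that closure_subset[of "{x. f x \<noteq> 0}"] in auto)
    then have "blinfun_apply (D x) = (\<lambda>h. 0)"
      using has_derivative_unique[OF has_derivative_const] by metis
    then show ?thesis by (intro blinfun_eqI) simp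
  qed
  then have "norm (D x) \<le> B" for x
    using B by (cases "x \<in> closure {x. f x \<noteq> 0}") auto
  with D show thesis by (rule that)
qed

lemma C1_compact_support_measurable:
  assumes "C1_compact_support (\<phi> :: 'a::euclidean_space \<Rightarrow> real)" shows "\<phi> \<in> borel_measurable borel"
proof -
  obtain D where "\<And>x. (\<phi> has_derivative blinfun_apply (D x)) (at x)"
    using C1_compact_support_derivative[OF assms] by metis
  then show ?thesis
    by (intro borel_measurable_continuous_onI)
      (auto simp: continuous_on_eq_continuous_within intro: has_derivative_continuous)
qed

lemma integrable_bounded_on_finite:
  fixes f :: "'a::euclidean_space \<Rightarrow> real"
  assumes "\<Omega> \<in> sets borel" "emeasure lborel \<Omega> < \<infinity>" "f \<in> borel_measurable borel" "\<And>x. \<bar>f x\<bar> \<le> B"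
  shows "integrable lborel (\<lambda>x. indicator \<Omega> x * f x)"
proof (rule Bochner_Integration.integrable_bound)
  show "integrable lborel (\<lambda>x. B * indicator \<Omega> x :: real)"
    using assms(1,2) by (simp add: integrable_real_indicator)
  show "AE x in lborel. norm (indicator \<Omega> x * f x) \<le> norm (B * indicator \<Omega> x)"
    using assms(4) by (auto simp: abs_mult indicator_def intro: order_trans[OF _ abs_ge_self])
qed (use assms in measurable)

text \<open>Differentiation under the integral by dominated convergence: the difference quotients
  are at most the Lipschitz constant of \<open>\<phi>\<close> times \<open>norm u\<close>, on a set
  of finite measure. The derivative is written with the gradient of the translated function, which
  is again a test function, so that a bound over all test functions applies at every
  \<open>r\<close>.\<close>

lemma has_real_derivative_integral_translate:
  fixes \<phi> :: "real ^ 'n \<Rightarrow> real"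
  assumes \<Omega>: "\<Omega> \<in> sets borel" "emeasure lborel \<Omega> < \<infinity>" and \<phi>: "C1_compact_support \<phi>"
  shows "((\<lambda>r. \<integral>x. indicator \<Omega> x * \<phi> (x + r *\<^sub>R u) \<partial>lborel) has_real_derivative
          (\<integral>x. indicator \<Omega> x * (gradient (\<lambda>x. \<phi> (x + r *\<^sub>R u)) x \<bullet> u) \<partial>lborel)) (at r)"
proof -
  obtain D B where D: "\<And>x. (\<phi> has_derivative blinfun_apply (D x)) (at x)" "continuous_on UNIV D"
    "\<And>x. norm (D x) \<le> B" using C1_compact_support_derivative[OF \<phi>] by metis
  have cont: "continuous_on UNIV \<phi>"
    by (auto simp: continuous_on_eq_continuous_within intro: has_derivative_continuous D)
  then have [measurable]: "\<phi> \<in> borel_measurable borel"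
    by (rule borel_measurable_continuous_onI)
  have lip: "\<bar>\<phi> x - \<phi> y\<bar> \<le> B * norm (x - y)" for x y
    using differentiable_bound[of UNIV \<phi> "\<lambda>x. blinfun_apply (D x)" B x y] D
    by (auto simp: norm_blinfun.rep_eq)
  have grad: "gradient (\<lambda>x. \<phi> (x + r *\<^sub>R u)) x \<bullet> u = D (x + r *\<^sub>R u) u" for x
    by (intro gradient_inner has_derivative_compose[of "\<lambda>x. x + r *\<^sub>R u" "\<lambda>h. h", OF _ D(1)])
       (auto intro!: derivative_eq_intros)
  have bnd: "\<exists>C. \<forall>x. \<bar>\<phi> x\<bar> \<le> C"
  proof -
    have K: "compact (\<phi> ` closure {x. \<phi> x \<noteq> 0})"
      using \<phi> cont by (intro compact_continuous_image)
        (auto intro: continuous_on_subset simp: C1_compact_support_def support_on_def)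
    then obtain C where "C > 0" "\<And>x. x \<in> closure {x. \<phi> x \<noteq> 0} \<Longrightarrow> norm (\<phi> x) \<le> C"
      using compact_imp_bounded bounded_pos by (metis imageI)
    then have "\<bar>\<phi> x\<bar> \<le> C" for x
      using closure_subset[of "{x. \<phi> x \<noteq> 0}"] by (cases "\<phi> x = 0") auto
    then show ?thesis by blast
  qed
  then obtain C where C: "\<And>x. \<bar>\<phi> x\<bar> \<le> C" by blast
  have int: "integrable lborel (\<lambda>x. indicator \<Omega> x * \<phi> (x + a))" for a
    by (rule integrable_bounded_on_finite[OF \<Omega>, of _ C]) (use C in auto)
  show ?thesis
    unfolding DERIV_def grad
  proof (subst tendsto_at_iff_sequentially, intro allI impI)
    fix h :: "nat \<Rightarrow> real" assume h: "\<forall>i. h i \<in> UNIV - {0}" "h \<longlonglongrightarrow> 0"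
    have "(\<lambda>i. \<integral>x. indicator \<Omega> x * ((\<phi> (x + (r + h i) *\<^sub>R u) - \<phi> (x + r *\<^sub>R u)) / h i) \<partial>lborel)
      \<longlonglongrightarrow> (\<integral>x. indicator \<Omega> x * D (x + r *\<^sub>R u) u \<partial>lborel)"
    proof (rule integral_dominated_convergence[where w="\<lambda>x. (B * norm u) * indicator \<Omega> x"])
      have "continuous_on UNIV (\<lambda>x. D (x + r *\<^sub>R u) u)"
        by (intro blinfun.continuous_on continuous_on_compose2[OF D(2)] continuous_intros) auto
      then have [measurable]: "(\<lambda>x. D (x + r *\<^sub>R u) u) \<in> borel_measurable borel"
        by (rule borel_measurable_continuous_onI)
      show "(\<lambda>x. indicator \<Omega> x * D (x + r *\<^sub>R u) u) \<in> borel_measurable lborel"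
        using \<Omega> by measurable
      show "(\<lambda>x. indicator \<Omega> x * ((\<phi> (x + (r + h i) *\<^sub>R u) - \<phi> (x + r *\<^sub>R u)) / h i)) \<in> borel_measurable lborel" for i
        using \<Omega> by measurable
      show "integrable lborel (\<lambda>x. B * norm u * indicator \<Omega> x :: real)"
        using \<Omega> by (simp add: integrable_real_indicator)
      show "AE x in lborel. norm (indicator \<Omega> x * ((\<phi> (x + (r + h i) *\<^sub>R u) - \<phi> (x + r *\<^sub>R u)) / h i)) \<le> B * norm u * indicator \<Omega> x" for i
      proof (rule AE_I2)
        fix x
        have "\<bar>\<phi> (x + (r + h i) *\<^sub>R u) - \<phi> (x + r *\<^sub>R u)\<bar> \<le> B * norm (h i *\<^sub>R u)"
          using lip[of "x + (r + h i) *\<^sub>R u" "x + r *\<^sub>R u"] by (simp add: algebra_simps)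
        then have "\<bar>\<phi> (x + (r + h i) *\<^sub>R u) - \<phi> (x + r *\<^sub>R u)\<bar> / \<bar>h i\<bar> \<le> B * norm u"
          using h(1) by (simp add: divide_le_eq mult_ac)
        then show "norm (indicator \<Omega> x * ((\<phi> (x + (r + h i) *\<^sub>R u) - \<phi> (x + r *\<^sub>R u)) / h i)) \<le> B * norm u * indicator \<Omega> x"
          by (auto simp: abs_mult indicator_def)
      qed
      show "AE x in lborel. (\<lambda>i. indicator \<Omega> x * ((\<phi> (x + (r + h i) *\<^sub>R u) - \<phi> (x + r *\<^sub>R u)) / h i))
        \<longlonglongrightarrow> indicator \<Omega> x * D (x + r *\<^sub>R u) u"
      proof (intro AE_I2 tendsto_mult tendsto_const)
        fix x
        have "((\<lambda>r. \<phi> (x + r *\<^sub>R u)) has_derivative (\<lambda>k. D (x + r *\<^sub>R u) (k *\<^sub>R u))) (at r)"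
          by (rule has_derivative_compose[OF _ D(1)]) (auto intro!: derivative_eq_intros)
        then have "((\<lambda>r. \<phi> (x + r *\<^sub>R u)) has_real_derivative D (x + r *\<^sub>R u) u) (at r)"
          by (simp add: has_field_derivative_def blinfun.scaleR_right mult_commute_abs)
        then show "(\<lambda>i. (\<phi> (x + (r + h i) *\<^sub>R u) - \<phi> (x + r *\<^sub>R u)) / h i) \<longlonglongrightarrow> D (x + r *\<^sub>R u) u"
          using h unfolding DERIV_def tendsto_at_iff_sequentially by (auto simp: o_def)
      qed
    qed
    moreover have "(\<integral>x. indicator \<Omega> x * ((\<phi> (x + (r + h i) *\<^sub>R u) - \<phi> (x + r *\<^sub>R u)) / h i) \<partial>lborel)
      = ((\<integral>x. indicator \<Omega> x * \<phi> (x + (r + h i) *\<^sub>R u) \<partial>lborel) - (\<integral>x. indicator \<Omega> x * \<phi> (x + r *\<^sub>R u) \<partial>lborel)) / h i" for i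
      by (simp add: right_diff_distrib diff_divide_distrib int flip: Bochner_Integration.integral_diff integral_divide_zero)
    ultimately show "((\<lambda>h. ((\<integral>x. indicator \<Omega> x * \<phi> (x + (r + h) *\<^sub>R u) \<partial>lborel)
          - (\<integral>x. indicator \<Omega> x * \<phi> (x + r *\<^sub>R u) \<partial>lborel)) / h) \<circ> h)
      \<longlonglongrightarrow> (\<integral>x. indicator \<Omega> x * D (x + r *\<^sub>R u) u \<partial>lborel)"
      using h(1) by (simp add: o_def)
  qed
qed

section \<open>The covariogram and directional variation\<close>

definition covariogram :: "'a::euclidean_space set \<Rightarrow> 'a \<Rightarrow> real" where
  "covariogram \<Omega> y = measure lborel {x\<in>\<Omega>. x + y \<in> \<Omega>}"

lemma measure_lborel_translate:
  fixes S :: "'a::euclidean_space set"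
  assumes [measurable]: "S \<in> sets borel"
  shows "measure lborel {x. x + a \<in> S} = measure lborel S"
    and "emeasure lborel {x. x + a \<in> S} = emeasure lborel S"
proof -
  have "emeasure lborel S = emeasure (distr lborel borel ((+) a)) S" by (simp add: lborel_distr_plus)
  also have "\<dots> = emeasure lborel {x. x + a \<in> S}"
    by (subst emeasure_distr) (auto simp: vimage_def add.commute)
  finally show "emeasure lborel {x. x + a \<in> S} = emeasure lborel S" ..
  then show "measure lborel {x. x + a \<in> S} = measure lborel S" by (simp add: measure_def)
qed

context
  fixes \<Omega> :: "'a::euclidean_space set"
  assumes \<Omega>[measurable]: "\<Omega> \<in> sets borel" and fin: "emeasure lborel \<Omega> < \<infinity>"
begin

lemma finite_translates:
  "emeasure lborel {x. x + a \<in> \<Omega> \<and> P x} \<noteq> \<infinity>" "emeasure lborel {x. P x \<and> x + a \<in> \<Omega>} \<noteq> \<infinity>"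
  "emeasure lborel {x\<in>\<Omega>. P x} \<noteq> \<infinity>"
proof -
  show *: "emeasure lborel {x. x + a \<in> \<Omega> \<and> P x} \<noteq> \<infinity>" for a P
  proof -
    have "emeasure lborel {x. x + a \<in> \<Omega> \<and> P x} \<le> emeasure lborel {x. x + a \<in> \<Omega>}"
      by (rule emeasure_mono) auto
    also have "\<dots> < \<infinity>" using fin by (simp add: measure_lborel_translate)
    finally show ?thesis by simp
  qed
  from *[of a P] *[of 0 P]
  show "emeasure lborel {x. P x \<and> x + a \<in> \<Omega>} \<noteq> \<infinity>" "emeasure lborel {x\<in>\<Omega>. P x} \<noteq> \<infinity>"
    by (simp_all add: conj_commute)
qed

text \<open>Translation by \<open>y\<close> exchanges the two membership conditions.\<close>

lemma covariogram_minus: "covariogram \<Omega> (- y) = covariogram \<Omega> y"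
proof -
  have "covariogram \<Omega> y = measure lborel {x. x + y \<in> {x\<in>\<Omega>. x + - y \<in> \<Omega>}}"
    unfolding covariogram_def by (rule arg_cong[where f="measure lborel"]) auto
  also have "\<dots> = covariogram \<Omega> (- y)"
    unfolding covariogram_def by (rule measure_lborel_translate) measurable
  finally show ?thesis ..
qed

lemma measure_leaving: "measure lborel {x\<in>\<Omega>. x + y \<notin> \<Omega>} = covariogram \<Omega> 0 - covariogram \<Omega> y"
proof -
  have "measure lborel ({x\<in>\<Omega>. x + 0 \<in> \<Omega>} - {x\<in>\<Omega>. x + y \<in> \<Omega>}) = covariogram \<Omega> 0 - covariogram \<Omega> y"
    unfolding covariogram_def by (rule measure_Diff) (use fin in auto)
  also have "{x\<in>\<Omega>. x + 0 \<in> \<Omega>} - {x\<in>\<Omega>. x + y \<in> \<Omega>} = {x\<in>\<Omega>. x + y \<notin> \<Omega>}" by auto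
  finally show ?thesis .
qed

text \<open>Points entering under \<open>y\<close> become, after translation by \<open>y\<close>,
  points leaving under \<open>- y\<close>, and the covariogram is even. Both sets therefore have
  equal measure, which is the origin of the factors 2 below.\<close>

lemma measure_entering: "measure lborel {x. x \<notin> \<Omega> \<and> x + y \<in> \<Omega>} = covariogram \<Omega> 0 - covariogram \<Omega> y"
proof -
  have "measure lborel {x. x \<notin> \<Omega> \<and> x + y \<in> \<Omega>} = measure lborel {x. x + y \<in> {x\<in>\<Omega>. x + - y \<notin> \<Omega>}}"
    by (rule arg_cong[where f="measure lborel"]) auto
  also have "\<dots> = measure lborel {x\<in>\<Omega>. x + - y \<notin> \<Omega>}" by (rule measure_lborel_translate) measurable
  finally show ?thesis unfolding measure_leaving covariogram_minus .
qed

lemma covariogram_bounds: "0 \<le> covariogram \<Omega> y" "covariogram \<Omega> y \<le> covariogram \<Omega> 0"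
  using measure_leaving[of y] measure_nonneg[of lborel "{x\<in>\<Omega>. x + y \<notin> \<Omega>}"]
  by (auto simp: covariogram_def)

text \<open>A point counted at \<open>x\<close> but not at \<open>y\<close> becomes, after
  translation by \<open>x\<close>, a point of \<open>\<Omega>\<close> that leaves under
  \<open>y - x\<close>. Thus the drop at 0 controls the modulus of continuity everywhere.\<close>

lemma covariogram_diff_le: "\<bar>covariogram \<Omega> x - covariogram \<Omega> y\<bar> \<le> covariogram \<Omega> 0 - covariogram \<Omega> (x - y)"
proof -
  have *: "covariogram \<Omega> x - covariogram \<Omega> y \<le> covariogram \<Omega> 0 - covariogram \<Omega> (x - y)" for x y
  proof -
    have "covariogram \<Omega> x \<le> measure lborel ({z\<in>\<Omega>. z + y \<in> \<Omega>} \<union> {z. z + x \<in> \<Omega> \<and> z + y \<notin> \<Omega>})"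
      unfolding covariogram_def
    proof (rule measure_mono_fmeasurable)
      have "{z\<in>\<Omega>. z + y \<in> \<Omega>} \<in> fmeasurable lborel" "{z. z + x \<in> \<Omega> \<and> z + y \<notin> \<Omega>} \<in> fmeasurable lborel"
        using finite_translates by (auto intro!: fmeasurableI simp: less_top)
      then show "{z\<in>\<Omega>. z + y \<in> \<Omega>} \<union> {z. z + x \<in> \<Omega> \<and> z + y \<notin> \<Omega>} \<in> fmeasurable lborel"
        by (rule fmeasurable.Un)
    qed auto
    also have "\<dots> \<le> covariogram \<Omega> y + measure lborel {z. z + x \<in> \<Omega> \<and> z + y \<notin> \<Omega>}"
      unfolding covariogram_def by (rule measure_Un_le) measurable
    also have "{z. z + x \<in> \<Omega> \<and> z + y \<notin> \<Omega>} = {z. z + x \<in> {w\<in>\<Omega>. w + - (x - y) \<notin> \<Omega>}}"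
      by (auto simp: algebra_simps)
    also have "measure lborel \<dots> = measure lborel {w\<in>\<Omega>. w + - (x - y) \<notin> \<Omega>}"
      by (rule measure_lborel_translate) measurable
    finally show ?thesis unfolding measure_leaving covariogram_minus by simp
  qed
  from *[of x y] *[of y x] covariogram_minus[of "x - y"] show ?thesis by (simp add: abs_le_iff)
qed

end

text \<open>Approximates the function that is 1 on \<open>P\<close> and -1 on \<open>N\<close>:
  compact subsets exhaust both sets up to \<open>e / 4\<close>, disjoint open neighbourhoods
  separate them, and the difference of two cutoffs is the test function.\<close>

lemma C1_sign_approx:
  fixes P N :: "'a::euclidean_space set"
  assumes [measurable]: "P \<in> sets borel" "N \<in> sets borel" and disj: "P \<inter> N = {}"
    and fin: "emeasure lborel P < \<infinity>" "emeasure lborel N < \<infinity>" and "0 < e"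
  obtains \<phi> where "C1_compact_support \<phi>" "\<And>x. \<bar>\<phi> x\<bar> \<le> 1"
    "measure lborel P + measure lborel N - e \<le> (\<integral>x. (indicator P x - indicator N x) * \<phi> x \<partial>lborel)"
proof -
  have inner: "\<exists>K. compact K \<and> K \<subseteq> S \<and> measure lborel S - e / 4 < measure lborel K"
    if [measurable]: "S \<in> sets borel" and S: "emeasure lborel S < \<infinity>" for S :: "'a set"
  proof (cases "measure lborel S < e / 4")
    \<comment> \<open>Here the empty set works; in the other case the lower bound is nonnegative, as
      its comparison in \<open>ennreal\<close> requires.\<close>
    case True then show ?thesis by (intro exI[of _ "{}"]) auto
  next
    case False
    \<comment> \<open>Inner regularity is applied to a finite measure, so Lebesgue measure is first
      restricted to \<open>S\<close>.\<close>
    let ?M = "density lborel (indicator S)"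
    have eq: "emeasure ?M K = emeasure lborel K" if "K \<subseteq> S" "K \<in> sets borel" for K
      using that by (subst emeasure_density) (auto simp: nn_integral_set_ennreal[symmetric] 
          simp flip: indicator_inter_arith intro!: arg_cong2[where f=emeasure])
    have "emeasure ?M (space ?M) \<noteq> \<infinity>"
      using S by (subst emeasure_density) auto
    then have "emeasure ?M S = (SUP K \<in> {K. K \<subseteq> S \<and> compact K}. emeasure ?M K)"
      by (intro inner_regular) auto
    moreover have "ennreal (measure lborel S - e / 4) < emeasure ?M S"
      using eq[of S] S False \<open>0 < e\<close> by (simp add: emeasure_eq_ennreal_measure ennreal_lessI)
    ultimately have "ennreal (measure lborel S - e / 4) < (SUP K \<in> {K. K \<subseteq> S \<and> compact K}. emeasure ?M K)"
      by simp
    then obtain K where K: "K \<subseteq> S" "compact K" "ennreal (measure lborel S - e / 4) < emeasure ?M K"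
      by (auto simp: less_SUP_iff)
    then have "ennreal (measure lborel S - e / 4) < emeasure lborel K"
      using eq[of K] borel_compact[of K] by simp
    moreover have "emeasure lborel K < \<infinity>" using K emeasure_compact_finite by blast
    ultimately have "measure lborel S - e / 4 < measure lborel K"
      using False by (simp add: emeasure_eq_ennreal_measure less_top ennreal_less_iff)
    then show ?thesis using K by auto
  qed
  obtain K where K: "compact K" "K \<subseteq> P" "measure lborel P - e / 4 < measure lborel K"
    using inner[of P] fin by auto
  obtain L where L: "compact L" "L \<subseteq> N" "measure lborel N - e / 4 < measure lborel L"
    using inner[of N] fin by auto
  have "closed L" "K \<inter> L = {}" using K L disj by (auto intro: compact_imp_closed)
  then obtain U W where UW: "open U" "open W" "K \<subseteq> U" "L \<subseteq> W" "U \<inter> W = {}"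
    using separation_normal_compact[OF K(1)] by metis
  obtain f where f: "C1 f" "\<And>x. 0 \<le> f x" "\<And>x. f x \<le> 1" "\<And>x. x \<in> K \<Longrightarrow> f x = 1"
    "\<And>x. f x \<noteq> 0 \<Longrightarrow> x \<in> U" "bounded {x. f x \<noteq> 0}" using C1_cutoff[OF K(1) UW(1,3)] by metis
  obtain g where g: "C1 g" "\<And>x. 0 \<le> g x" "\<And>x. g x \<le> 1" "\<And>x. x \<in> L \<Longrightarrow> g x = 1"
    "\<And>x. g x \<noteq> 0 \<Longrightarrow> x \<in> W" "bounded {x. g x \<noteq> 0}" using C1_cutoff[OF L(1) UW(2,4)] by metis
  define \<phi> where "\<phi> x = f x - g x" for x
  have [measurable]: "K \<in> sets borel" using K by (simp add: borel_compact)
  have [measurable]: "L \<in> sets borel" using L by (simp add: borel_compact)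
  have \<phi>: "C1_compact_support \<phi>"
    unfolding C1_compact_support_iff
  proof
    show "C1 \<phi>" unfolding \<phi>_def by (intro C1_diff f g)
    have "{x. \<phi> x \<noteq> 0} \<subseteq> {x. f x \<noteq> 0} \<union> {x. g x \<noteq> 0}" by (auto simp: \<phi>_def)
    then show "bounded {x. \<phi> x \<noteq> 0}" using f(6) g(6) bounded_Un bounded_subset by blast
  qed
  have le1: "\<bar>\<phi> x\<bar> \<le> 1" for x using f(2,3)[of x] g(2,3)[of x] by (auto simp: \<phi>_def)
  note [measurable] = C1_compact_support_measurable[OF \<phi>]
  have KL: "measure lborel K \<le> measure lborel P" "measure lborel L \<le> measure lborel N"
    using K L fin by (auto intro!: measure_mono_fmeasurable fmeasurableI)
  have int: "integrable lborel (\<lambda>x. indicator S x * \<phi> x)" "integrable lborel (indicator S :: _ \<Rightarrow> real)"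
    if "S \<in> sets borel" "emeasure lborel S < \<infinity>" for S
    using that le1 by (auto intro: integrable_bounded_on_finite[where B=1] integrable_real_indicator)
  have fKL: "emeasure lborel K < \<infinity>" "emeasure lborel L < \<infinity>"
    using K L emeasure_compact_finite by blast+
  \<comment> \<open>On \<open>P\<close> the function \<open>\<phi>\<close> is 1 at points of
    \<open>K\<close> and at least -1 elsewhere, hence at least
    \<open>2 * indicator K x - indicator P x\<close>; symmetrically for \<open>L\<close> and
    \<open>N\<close>. Each set loses at most twice \<open>e / 4\<close>.\<close>
  have "measure lborel P + measure lborel N - e \<le> 2 * measure lborel K - measure lborel P + (2 * measure lborel L - measure lborel N)"
    using K(3) L(3) by simp
  also have "\<dots> = (\<integral>x. (2 * indicator K x - indicator P x) + (2 * indicator L x - indicator N x) \<partial>lborel)"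
    using fin fKL int(2) by (subst Bochner_Integration.integral_add) auto
  also have "\<dots> \<le> (\<integral>x. (indicator P x - indicator N x) * \<phi> x \<partial>lborel)"
  proof (rule integral_mono)
    show "integrable lborel (\<lambda>x. (2 * indicator K x - indicator P x) + (2 * indicator L x - indicator N x) :: real)"
      using fin fKL int(2) by (intro Bochner_Integration.integrable_add Bochner_Integration.integrable_diff integrable_mult_right) auto
    show "integrable lborel (\<lambda>x. (indicator P x - indicator N x) * \<phi> x)"
      using int(1)[of P] int(1)[of N] fin by (simp add: left_diff_distrib)
    fix x
    show "(2 * indicator K x - indicator P x) + (2 * indicator L x - indicator N x) \<le> (indicator P x - indicator N x) * \<phi> x"
      using K(2) L(2) disj le1[of x] f(4,5)[of x] g(4,5)[of x] UW
      by (auto simp: indicator_def \<phi>_def split: if_splits)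
  qed
  finally show thesis using that[OF \<phi> le1] by blast
qed

section \<open>Translates of the set against test functions\<close>

context
  fixes \<Omega> :: "(real ^ 'n) set"
  assumes \<Omega>[measurable]: "\<Omega> \<in> sets borel" and fin: "emeasure lborel \<Omega> < \<infinity>"
begin

text \<open>The translation is moved from \<open>\<phi>\<close> to \<open>\<Omega>\<close>. The
  difference of the two indicators is 1 on the points of \<open>\<Omega> + y\<close> outside
  \<open>\<Omega>\<close> and -1 on the points of \<open>\<Omega>\<close> outside
  \<open>\<Omega> + y\<close>.\<close>

lemma integral_translate_diff:
  fixes \<phi> :: "real ^ 'n \<Rightarrow> real"
  assumes [measurable]: "\<phi> \<in> borel_measurable borel" and \<phi>: "\<And>x. \<bar>\<phi> x\<bar> \<le> 1"
  shows "(\<integral>x. indicator \<Omega> x * \<phi> (x + y) \<partial>lborel) - (\<integral>x. indicator \<Omega> x * \<phi> x \<partial>lborel) =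
    (\<integral>x. (indicator {x. x \<notin> \<Omega> \<and> x + - y \<in> \<Omega>} x - indicator {x\<in>\<Omega>. x + - y \<notin> \<Omega>} x) * \<phi> x \<partial>lborel)"
proof -
  let ?P = "{x. x \<notin> \<Omega> \<and> x + - y \<in> \<Omega>}" and ?N = "{x\<in>\<Omega>. x + - y \<notin> \<Omega>}"
  have fin': "emeasure lborel {x. x + a \<in> \<Omega>} < \<infinity>" for a using fin by (simp add: measure_lborel_translate)
  have "(\<integral>x. indicator \<Omega> x * \<phi> (x + y) \<partial>lborel) =
      (\<integral>x. indicator \<Omega> x * \<phi> (x + y) \<partial>distr lborel borel ((+) (- y)))" by (simp add: lborel_distr_plus)
  also have "\<dots> = (\<integral>x. indicator {x. x + - y \<in> \<Omega>} x * \<phi> x \<partial>lborel)"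
    by (subst integral_distr) (auto intro!: Bochner_Integration.integral_cong simp: indicator_def)
  finally have "(\<integral>x. indicator \<Omega> x * \<phi> (x + y) \<partial>lborel) - (\<integral>x. indicator \<Omega> x * \<phi> x \<partial>lborel) =
      (\<integral>x. indicator {x. x + - y \<in> \<Omega>} x * \<phi> x - indicator \<Omega> x * \<phi> x \<partial>lborel)"
    using integrable_bounded_on_finite[of \<Omega> \<phi> 1] integrable_bounded_on_finite[of "{x. x + - y \<in> \<Omega>}" \<phi> 1]
      fin fin'[of "- y"] \<phi> by (subst Bochner_Integration.integral_diff) auto
  also have "\<dots> = (\<integral>x. (indicator ?P x - indicator ?N x) * \<phi> x \<partial>lborel)"
    by (intro Bochner_Integration.integral_cong) (auto simp: indicator_def)
  finally show ?thesis .
qed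

text \<open>The integral is at most the measure of the symmetric difference of
  \<open>\<Omega>\<close> and \<open>\<Omega> + y\<close>, whose two halves have equal
  measure.\<close>

lemma integral_translate_diff_le:
  fixes \<phi> :: "real ^ 'n \<Rightarrow> real"
  assumes [measurable]: "\<phi> \<in> borel_measurable borel" and \<phi>: "\<And>x. \<bar>\<phi> x\<bar> \<le> 1"
  shows "(\<integral>x. indicator \<Omega> x * \<phi> (x + y) \<partial>lborel) - (\<integral>x. indicator \<Omega> x * \<phi> x \<partial>lborel)
    \<le> 2 * (covariogram \<Omega> 0 - covariogram \<Omega> y)"
proof -
  let ?P = "{x. x \<notin> \<Omega> \<and> x + - y \<in> \<Omega>}" and ?N = "{x\<in>\<Omega>. x + - y \<notin> \<Omega>}"
  have f: "emeasure lborel ?P < \<infinity>" "emeasure lborel ?N < \<infinity>"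
    using finite_translates(2)[OF \<Omega> fin, where P="\<lambda>x. x \<notin> \<Omega>" and a="- y"]
      finite_translates(3)[OF \<Omega> fin, where P="\<lambda>x. x + - y \<notin> \<Omega>"]
    by (simp_all only: less_top infinity_ennreal_def)
  have i: "integrable lborel (indicator ?P :: _ \<Rightarrow> real)" "integrable lborel (indicator ?N :: _ \<Rightarrow> real)"
    using f by (auto intro!: integrable_real_indicator)
  have "(\<integral>x. (indicator ?P x - indicator ?N x) * \<phi> x \<partial>lborel) \<le> (\<integral>x. indicator ?P x + indicator ?N x \<partial>lborel)"
  proof (rule integral_mono)
    show "integrable lborel (\<lambda>x. indicator ?P x + indicator ?N x :: real)" by (intro Bochner_Integration.integrable_add i)
    show "integrable lborel (\<lambda>x. (indicator ?P x - indicator ?N x) * \<phi> x)"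
      using integrable_bounded_on_finite[of ?P \<phi> 1] integrable_bounded_on_finite[of ?N \<phi> 1] f \<phi>
      by (simp add: left_diff_distrib)
    show "(indicator ?P x - indicator ?N x) * \<phi> x \<le> indicator ?P x + indicator ?N x" for x
      using \<phi>[of x] by (auto simp: indicator_def)
  qed
  also have "\<dots> = measure lborel ?P + measure lborel ?N"
    using i by (subst Bochner_Integration.integral_add) auto
  also have "\<dots> = 2 * (covariogram \<Omega> 0 - covariogram \<Omega> y)"
    unfolding measure_leaving[OF \<Omega> fin] measure_entering[OF \<Omega> fin] covariogram_minus[OF \<Omega> fin] by simp
  finally show ?thesis by (simp add: integral_translate_diff[OF assms])
qed

text \<open>With \<open>\<phi>\<close> close to the sign function of the symmetric difference of
  \<open>\<Omega>\<close> and its translate, the increment of \<open>?F\<close> from 0 to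
  \<open>r\<close> is almost twice the drop of the covariogram, and the mean value theorem bounds it
  by \<open>r * V\<close>. The bound \<open>V\<close> is kept abstract so that both the directional
  variation and the perimeter can be inserted.\<close>

lemma covariogram_directional_le:
  assumes V: "\<And>\<phi>. C1_compact_support \<phi> \<Longrightarrow> (\<And>x. \<bar>\<phi> x\<bar> \<le> 1) \<Longrightarrow>
      (\<integral>x. indicator \<Omega> x * (gradient \<phi> x \<bullet> u) \<partial>lborel) \<le> V"
    and r: "0 \<le> r"
  shows "2 * (covariogram \<Omega> 0 - covariogram \<Omega> (r *\<^sub>R u)) \<le> r * V"
proof (rule field_le_epsilon)
  fix e :: real assume "0 < e"
  let ?y = "r *\<^sub>R u"
  let ?P = "{x. x \<notin> \<Omega> \<and> x + - ?y \<in> \<Omega>}" and ?N = "{x\<in>\<Omega>. x + - ?y \<notin> \<Omega>}"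
  have f: "emeasure lborel ?P < \<infinity>" "emeasure lborel ?N < \<infinity>"
    using finite_translates(2)[OF \<Omega> fin, where P="\<lambda>x. x \<notin> \<Omega>" and a="- ?y"]
      finite_translates(3)[OF \<Omega> fin, where P="\<lambda>x. x + - ?y \<notin> \<Omega>"]
    by (simp_all only: less_top infinity_ennreal_def)
  obtain \<phi> where \<phi>: "C1_compact_support \<phi>" "\<And>x. \<bar>\<phi> x\<bar> \<le> 1"
    "measure lborel ?P + measure lborel ?N - e \<le> (\<integral>x. (indicator ?P x - indicator ?N x) * \<phi> x \<partial>lborel)"
    using C1_sign_approx[of ?P ?N, OF _ _ _ f \<open>0 < e\<close>] by (auto simp: disjoint_iff)
  let ?F = "\<lambda>r. \<integral>x. indicator \<Omega> x * \<phi> (x + r *\<^sub>R u) \<partial>lborel"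
  have D: "(?F has_real_derivative (\<integral>x. indicator \<Omega> x * (gradient (\<lambda>x. \<phi> (x + s *\<^sub>R u)) x \<bullet> u) \<partial>lborel)) (at s)" for s
    by (rule has_real_derivative_integral_translate[OF \<Omega> fin \<phi>(1)])
  have "?F r - ?F 0 \<le> r * V"
  proof (cases "r = 0")
    case False
    then have "0 < r" using r by simp
    from MVT2[OF this, of ?F, OF D] obtain z where
      "?F r - ?F 0 = r * (\<integral>x. indicator \<Omega> x * (gradient (\<lambda>x. \<phi> (x + z *\<^sub>R u)) x \<bullet> u) \<partial>lborel)" by auto
    moreover have "(\<integral>x. indicator \<Omega> x * (gradient (\<lambda>x. \<phi> (x + z *\<^sub>R u)) x \<bullet> u) \<partial>lborel) \<le> V"
      by (rule V) (use \<phi> C1_compact_support_translate in auto)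
    ultimately show ?thesis using r by (simp add: mult_left_mono)
  qed simp
  moreover have "?F r - ?F 0 = (\<integral>x. (indicator ?P x - indicator ?N x) * \<phi> x \<partial>lborel)"
    using integral_translate_diff[OF C1_compact_support_measurable[OF \<phi>(1)] \<phi>(2), of ?y] by simp
  ultimately show "2 * (covariogram \<Omega> 0 - covariogram \<Omega> ?y) \<le> r * V + e"
    using \<phi>(3) unfolding measure_leaving[OF \<Omega> fin] measure_entering[OF \<Omega> fin] covariogram_minus[OF \<Omega> fin]
    by simp
qed

text \<open>The integrands are Borel, because the derivative of \<open>\<phi>\<close> along
  \<open>u\<close> is continuous; hence the completion may be dropped.\<close>

lemma directional_variation_eq:
  "directional_variation u \<Omega> =
     (SUP \<phi>\<in>{\<phi>. C1_compact_support \<phi> \<and> (\<forall>x. \<bar>\<phi> x\<bar> \<le> 1)}.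
        ereal (\<integral>x. indicator \<Omega> x * (gradient \<phi> x \<bullet> u) \<partial>lborel))"
  unfolding directional_variation_def
proof (intro SUP_cong refl)
  fix \<phi> :: "real ^ 'n \<Rightarrow> real" assume "\<phi> \<in> {\<phi>. C1_compact_support \<phi> \<and> (\<forall>x. \<bar>\<phi> x\<bar> \<le> 1)}"
  then have cs: "C1_compact_support \<phi>" by simp
  obtain D where D: "\<And>x. (\<phi> has_derivative blinfun_apply (D x)) (at x)" "continuous_on UNIV D"
    using C1_compact_support_derivative[OF cs] by metis
  have "continuous_on UNIV (\<lambda>x. D x u)"
    by (intro blinfun.continuous_on D continuous_intros)
  then have "(\<lambda>x. D x u) \<in> borel_measurable borel" by (rule borel_measurable_continuous_onI)
  moreover have "(\<lambda>x. gradient \<phi> x \<bullet> u) = (\<lambda>x. D x u)" using gradient_inner[OF D(1)] by auto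
  ultimately have [measurable]: "(\<lambda>x. gradient \<phi> x \<bullet> u) \<in> borel_measurable borel" by simp
  show "ereal (\<integral>x. indicator \<Omega> x * (gradient \<phi> x \<bullet> u) \<partial>lebesgue) = ereal (\<integral>x. indicator \<Omega> x * (gradient \<phi> x \<bullet> u) \<partial>lborel)"
    by (subst integral_completion) auto
qed

text \<open>Upper bound: \<open>covariogram_directional_le\<close> holds for every positive
  \<open>r\<close>. Lower bound: for a nearly optimal test function \<open>?F\<close> has derivative
  above \<open>2 * a\<close> at 0, and its difference quotients bound the quotient of the
  covariogram from below.\<close>

lemma covariogram_directional_limit:
  assumes V: "directional_variation u \<Omega> = ereal V"
  shows "((\<lambda>r. (covariogram \<Omega> 0 - covariogram \<Omega> (r *\<^sub>R u)) / r) \<longlongrightarrow> V / 2) (at_right 0)"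
proof (rule order_tendstoI)
  have le: "(\<integral>x. indicator \<Omega> x * (gradient \<phi> x \<bullet> u) \<partial>lborel) \<le> V"
    if "C1_compact_support \<phi>" "\<And>x. \<bar>\<phi> x\<bar> \<le> 1" for \<phi>
  proof -
    have "ereal (\<integral>x. indicator \<Omega> x * (gradient \<phi> x \<bullet> u) \<partial>lborel) \<le> ereal V"
      unfolding V[symmetric] directional_variation_eq by (rule SUP_upper) (use that in auto)
    then show ?thesis by simp
  qed
  fix a assume "V / 2 < a"
  then show "\<forall>\<^sub>F r in at_right 0. (covariogram \<Omega> 0 - covariogram \<Omega> (r *\<^sub>R u)) / r < a"
    unfolding eventually_at_right_field
  proof (intro exI[of _ 1] conjI allI impI)
    fix r :: real assume "0 < r"
    then have "2 * (covariogram \<Omega> 0 - covariogram \<Omega> (r *\<^sub>R u)) \<le> r * V"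
      by (intro covariogram_directional_le[of u V r, OF le]) auto
    also have "\<dots> < r * (2 * a)"
      using \<open>V / 2 < a\<close> \<open>0 < r\<close> by (intro mult_strict_left_mono) auto
    finally show "(covariogram \<Omega> 0 - covariogram \<Omega> (r *\<^sub>R u)) / r < a"
      using \<open>0 < r\<close> by (simp add: divide_less_eq mult_ac)
  qed simp
next
  fix a assume "a < V / 2"
  then have "ereal (2 * a) < directional_variation u \<Omega>" unfolding V by simp
  then obtain \<phi> where \<phi>: "C1_compact_support \<phi>" "\<And>x. \<bar>\<phi> x\<bar> \<le> 1"
    "2 * a < (\<integral>x. indicator \<Omega> x * (gradient \<phi> x \<bullet> u) \<partial>lborel)"
    unfolding directional_variation_eq less_SUP_iff by auto
  let ?F = "\<lambda>r. \<integral>x. indicator \<Omega> x * \<phi> (x + r *\<^sub>R u) \<partial>lborel"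
  have "(?F has_real_derivative (\<integral>x. indicator \<Omega> x * (gradient \<phi> x \<bullet> u) \<partial>lborel)) (at 0)"
    using has_real_derivative_integral_translate[OF \<Omega> fin \<phi>(1), of u 0] by simp
  then have "((\<lambda>h. (?F h - ?F 0) / h) \<longlongrightarrow> (\<integral>x. indicator \<Omega> x * (gradient \<phi> x \<bullet> u) \<partial>lborel)) (at_right 0)"
    unfolding DERIV_def by (auto intro: tendsto_mono[OF at_le])
  then have "\<forall>\<^sub>F h in at_right 0. 2 * a < (?F h - ?F 0) / h"
    using \<phi>(3) by (rule order_tendstoD)
  moreover have "\<forall>\<^sub>F h::real in at_right 0. 0 < h" by (simp add: eventually_at_filter)
  ultimately show "\<forall>\<^sub>F r in at_right 0. a < (covariogram \<Omega> 0 - covariogram \<Omega> (r *\<^sub>R u)) / r"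
  proof eventually_elim
    case (elim h)
    have "?F h - ?F 0 \<le> 2 * (covariogram \<Omega> 0 - covariogram \<Omega> (h *\<^sub>R u))"
      using integral_translate_diff_le[OF C1_compact_support_measurable[OF \<phi>(1)] \<phi>(2), of "h *\<^sub>R u"] by simp
    with elim show ?case by (simp add: less_divide_eq mult_ac)
  qed
qed

end

text \<open>A scalar test function \<open>\<phi>\<close> gives the vector field
  \<open>\<phi> x *\<^sub>R u\<close> of the same size and support, whose divergence is the
  derivative of \<open>\<phi>\<close> along \<open>u\<close>.\<close>

lemma directional_variation_le_perimeter:
  fixes u :: "real ^ 'n"
  assumes "norm u = 1" shows "directional_variation u \<Omega> \<le> perimeter \<Omega>"
  unfolding directional_variation_def
proof (rule SUP_least)
  fix \<phi> :: "real ^ 'n \<Rightarrow> real" assume *: "\<phi> \<in> {\<phi>. C1_compact_support \<phi> \<and> (\<forall>x. \<bar>\<phi> x\<bar> \<le> 1)}"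
  then have cs: "C1_compact_support \<phi>" by simp
  obtain D where D: "\<And>x. (\<phi> has_derivative blinfun_apply (D x)) (at x)" "continuous_on UNIV D"
    using C1_compact_support_derivative[OF cs] by metis
  let ?\<psi> = "\<lambda>x. \<phi> x *\<^sub>R u"
  let ?E = "\<lambda>x. blinfun_scaleR_left u o\<^sub>L D x"
  have E: "(?\<psi> has_derivative blinfun_apply (?E x)) (at x)" for x
    using has_derivative_scaleR_left[OF D(1)[of x], of u] by (simp add: blinfun_compose.rep_eq o_def)
  have "u \<noteq> 0" using assms by auto
  have "C1_compact_support ?\<psi>"
    unfolding C1_compact_support_def
  proof (intro conjI exI[of _ ?E] allI E)
    show "continuous_on UNIV ?E" by (intro continuous_intros D)
    have "support_on UNIV ?\<psi> = support_on UNIV \<phi>" using \<open>u \<noteq> 0\<close> by (auto simp: support_on_def)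
    then show "compact (closure (support_on UNIV ?\<psi>))" using * by (simp add: C1_compact_support_def)
  qed
  moreover have "\<forall>x. norm (?\<psi> x) \<le> 1" using * assms by auto
  moreover have "divergence ?\<psi> x = gradient \<phi> x \<bullet> u" for x
    using frechet_derivative_at[OF E[of x], symmetric] frechet_derivative_at[OF D(1)[of x], symmetric]
    by (simp add: divergence_def gradient_def inner_vec_def)
  ultimately show "ereal (\<integral>x. indicator \<Omega> x * (gradient \<phi> x \<bullet> u) \<partial>lebesgue) \<le> perimeter \<Omega>"
    unfolding perimeter_def by (intro SUP_upper2[of ?\<psi>]) auto
qed

section \<open>Gaussian measures\<close>

lemma
  fixes f :: "'a::euclidean_space \<Rightarrow> real \<Rightarrow> 'b::{real_normed_field,banach,second_countable_topology}"
  assumes f: "\<And>b. b \<in> Basis \<Longrightarrow> integrable lborel (f b)"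
  shows integrable_lborel_prod: "integrable lborel (\<lambda>x. \<Prod>b\<in>Basis. f b (x \<bullet> b))"
    and integral_lborel_prod:
      "(\<integral>x. (\<Prod>b\<in>Basis. f b (x \<bullet> b)) \<partial>lborel) = (\<Prod>b\<in>Basis. \<integral>x. f b x \<partial>lborel)"
proof -
  interpret product_sigma_finite "\<lambda>_::'a. lborel :: real measure" by standard
  have [measurable]: "b \<in> Basis \<Longrightarrow> f b \<in> borel_measurable borel" for b
    using f[THEN borel_measurable_integrable] by simp
  have eq: "(\<Prod>b\<in>Basis. f b ((\<Sum>c\<in>Basis. g c *\<^sub>R c) \<bullet> b)) = (\<Prod>b\<in>Basis. f b (g b))" for g :: "'a \<Rightarrow> real"
    by (intro prod.cong refl) (simp add: inner_sum_left inner_Basis if_distrib cong: if_cong)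
  show "integrable lborel (\<lambda>x. \<Prod>b\<in>Basis. f b (x \<bullet> b))"
    unfolding lborel_eq[where 'a='a]
    by (subst integrable_distr_eq) (auto simp: eq intro!: product_integrable_prod f)
  show "(\<integral>x. (\<Prod>b\<in>Basis. f b (x \<bullet> b)) \<partial>lborel) = (\<Prod>b\<in>Basis. \<integral>x. f b x \<partial>lborel)"
    unfolding lborel_eq[where 'a='a]
    by (subst integral_distr) (auto simp: eq intro!: product_integral_prod f)
qed

text \<open>Kept as a product over coordinates so that total mass, moments and characteristic
  function reduce to one dimension; \<open>gauss_density_eq\<close> is the radial form.\<close>

definition gauss_density :: "'a::euclidean_space \<Rightarrow> real" where
  "gauss_density x = (\<Prod>b\<in>Basis. std_normal_density (x \<bullet> b))"

definition gauss_measure :: "'a::euclidean_space measure" where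
  "gauss_measure = density lborel (\<lambda>x. ennreal (gauss_density x))"

lemma gauss_density_eq:
  "gauss_density (x :: 'a::euclidean_space) = (1 / sqrt (2 * pi)) ^ DIM('a) * exp (- (norm x)\<^sup>2 / 2)"
proof -
  have "(norm x)\<^sup>2 = (\<Sum>b\<in>Basis. (x \<bullet> b)\<^sup>2)"
    unfolding power2_norm_eq_inner by (subst euclidean_inner) (simp add: power2_eq_square)
  then have "exp (- (norm x)\<^sup>2 / 2) = (\<Prod>b\<in>Basis. exp (- (x \<bullet> b)\<^sup>2 / 2))"
    by (simp add: exp_sum[symmetric] sum_negf sum_divide_distrib)
  then show ?thesis
    by (simp add: gauss_density_def std_normal_density_def prod.distrib prod_dividef power_one_over)
qed

lemma gauss_density_nonneg: "0 \<le> gauss_density x"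
  by (simp add: gauss_density_eq)

lemma gauss_density_measurable[measurable]: "gauss_density \<in> borel_measurable borel"
  unfolding gauss_density_def by measurable

lemma sets_gauss_measure[simp, measurable_cong]: "sets gauss_measure = sets borel"
  by (simp add: gauss_measure_def)

lemma space_gauss_measure[simp]: "space gauss_measure = UNIV"
  by (simp add: gauss_measure_def)

lemma integral_gauss_measure:
  fixes f :: "'a::euclidean_space \<Rightarrow> 'b::{banach,second_countable_topology}"
  assumes "f \<in> borel_measurable borel"
  shows "(\<integral>x. f x \<partial>gauss_measure) = (\<integral>x. gauss_density x *\<^sub>R f x \<partial>lborel)"
  unfolding gauss_measure_def using assms by (intro integral_density) (auto simp: gauss_density_nonneg)

lemma integrable_gauss_measure:
  fixes f :: "'a::euclidean_space \<Rightarrow> 'b::{banach,second_countable_topology}"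
  assumes "f \<in> borel_measurable borel"
  shows "integrable gauss_measure f \<longleftrightarrow> integrable lborel (\<lambda>x. gauss_density x *\<^sub>R f x)"
  unfolding gauss_measure_def using assms by (intro integrable_density) (auto simp: gauss_density_nonneg)

lemma integrable_gauss_density: "integrable lborel (gauss_density :: 'a::euclidean_space \<Rightarrow> real)"
  unfolding gauss_density_def by (intro integrable_lborel_prod) (simp add: integrable_normal_density)

lemma prob_space_gauss_measure: "prob_space (gauss_measure :: 'a::euclidean_space measure)"
proof
  have "(\<integral>x. gauss_density x \<partial>(lborel :: 'a measure)) = 1"
    unfolding gauss_density_def
    by (subst integral_lborel_prod) (simp_all add: integrable_normal_density integral_normal_density)
  then show "emeasure (gauss_measure :: 'a measure) (space gauss_measure) = 1"
    using nn_integral_eq_integral[OF integrable_gauss_density[where 'a='a]]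
    by (simp add: gauss_measure_def emeasure_density gauss_density_nonneg)
qed

text \<open>The norm is at most the sum of the absolute coordinates, each with a one-dimensional
  first moment. This moment later absorbs the linear growth of \<open>psi\<close> in the
  frequency.\<close>

lemma integrable_norm_gauss_measure: "integrable (gauss_measure :: 'a::euclidean_space measure) norm"
proof -
  have "integrable lborel (\<lambda>x::'a. gauss_density x * \<bar>x \<bullet> c\<bar>)" if c: "c \<in> Basis" for c
  proof -
    have "integrable lborel (\<lambda>x::'a. \<Prod>b\<in>Basis. (if b = c then \<lambda>t. std_normal_density t * \<bar>t\<bar> else std_normal_density) (x \<bullet> b))"
      using integrable_std_normal_moment_abs[of 1]
      by (intro integrable_lborel_prod) (auto simp: integrable_normal_density)
    also have "(\<lambda>x::'a. \<Prod>b\<in>Basis. (if b = c then \<lambda>t. std_normal_density t * \<bar>t\<bar> else std_normal_density) (x \<bullet> b))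
      = (\<lambda>x. \<Prod>b\<in>Basis. std_normal_density (x \<bullet> b) * (if b = c then \<bar>x \<bullet> b\<bar> else 1))"
      by (intro ext prod.cong) auto
    also have "\<dots> = (\<lambda>x. gauss_density x * \<bar>x \<bullet> c\<bar>)"
      using c by (simp add: gauss_density_def prod.distrib prod.delta)
    finally show ?thesis .
  qed
  then have "integrable lborel (\<lambda>x::'a. \<Sum>c\<in>Basis. gauss_density x * \<bar>x \<bullet> c\<bar>)" by auto
  then have "integrable lborel (\<lambda>x::'a. gauss_density x * norm x)"
    by (rule Bochner_Integration.integrable_bound)
       (auto simp: gauss_density_nonneg abs_mult sum_nonneg sum_distrib_left[symmetric]
          intro!: mult_left_mono norm_le_l1)
  then show ?thesis by (subst integrable_gauss_measure) auto
qed

text \<open>Up to a constant the Gaussian density is its own Fourier transform. This takes the place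
  of Fourier inversion: values of the density become averages of characters.\<close>

lemma char_gauss_measure:
  "(\<integral>\<xi>. iexp (y \<bullet> \<xi>) \<partial>gauss_measure) = complex_of_real (exp (- (norm (y::'a::euclidean_space))\<^sup>2 / 2))"
proof -
  have meas: "(\<lambda>t. iexp (s * t)) \<in> borel_measurable borel" for s
    by (intro borel_measurable_continuous_onI continuous_intros)
  have int: "integrable lborel (\<lambda>t. std_normal_density t *\<^sub>R iexp (s * t))" for s
    by (rule Bochner_Integration.integrable_bound[OF integrable_normal_density[of 1 0]])
       (use meas in \<open>auto simp: normal_density_nonneg\<close>)
  have ch: "(\<integral>t. std_normal_density t *\<^sub>R iexp (s * t) \<partial>lborel) = complex_of_real (exp (- s\<^sup>2 / 2))" for s
    using char_std_normal_distribution meas[of s]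
    by (simp add: char_def fun_eq_iff integral_density normal_density_nonneg)
  have prodeq: "gauss_density \<xi> *\<^sub>R iexp (y \<bullet> \<xi>) =
      (\<Prod>b\<in>Basis. std_normal_density (\<xi> \<bullet> b) *\<^sub>R iexp ((y \<bullet> b) * (\<xi> \<bullet> b)))" for \<xi>
  proof -
    have "y \<bullet> \<xi> = (\<Sum>b\<in>Basis. (y \<bullet> b) * (\<xi> \<bullet> b))" by (rule euclidean_inner)
    then have "iexp (y \<bullet> \<xi>) = (\<Prod>b\<in>Basis. iexp ((y \<bullet> b) * (\<xi> \<bullet> b)))"
      by (simp add: exp_sum[symmetric] sum_distrib_left)
    then show ?thesis by (simp add: gauss_density_def scaleR_conv_of_real prod.distrib)
  qed
  have "(\<integral>\<xi>. iexp (y \<bullet> \<xi>) \<partial>gauss_measure) = (\<integral>\<xi>. gauss_density \<xi> *\<^sub>R iexp (y \<bullet> \<xi>) \<partial>lborel)"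
    by (intro integral_gauss_measure borel_measurable_continuous_onI continuous_intros)
  also have "\<dots> = (\<Prod>b\<in>Basis. complex_of_real (exp (- (y \<bullet> b)\<^sup>2 / 2)))"
    unfolding prodeq by (subst integral_lborel_prod) (use int ch in simp_all)
  also have "\<dots> = complex_of_real (exp (- (norm y)\<^sup>2 / 2))"
  proof -
    have "(norm y)\<^sup>2 = (\<Sum>b\<in>Basis. (y \<bullet> b)\<^sup>2)"
      unfolding power2_norm_eq_inner by (subst euclidean_inner) (simp add: power2_eq_square)
    then show ?thesis by (simp add: exp_sum[symmetric] sum_negf sum_divide_distrib flip: of_real_prod)
  qed
  finally show ?thesis .
qed

section \<open>Pure jump families with a finite variation jump measure\<close>

lemma truncated_lipschitz:
  fixes c :: "'a::euclidean_space \<Rightarrow> 'b::real_normed_vector"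
  assumes lip: "\<And>x y. norm (c x - c y) \<le> \<kappa> * min 1 (norm (x - y))"
  shows "0 \<le> \<kappa>" and "continuous_on UNIV c"
proof -
  \<comment> \<open>For a unit vector and 0 the truncated distance is 1, which forces
    \<open>\<kappa>\<close> to be nonnegative.\<close>
  obtain y0 :: 'a where "norm y0 = 1" using vector_choose_size[of 1] by auto
  then show \<kappa>: "0 \<le> \<kappa>" using order_trans[OF norm_ge_zero lip[of y0 0]] by simp
  have "isCont c x" for x
  proof -
    have "((\<lambda>y. c y - c x) \<longlongrightarrow> 0) (at x)"
    proof (rule Lim_null_comparison)
      have "norm (c y - c x) \<le> \<kappa> * norm (y - x)" for y
        using order_trans[OF lip[of y x] mult_left_mono[of "min 1 (norm (y - x))" "norm (y - x)" \<kappa>]] \<kappa> by simp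
      then show "\<forall>\<^sub>F y in at x. norm (c y - c x) \<le> \<kappa> * norm (y - x)" by simp
      have "((\<lambda>y. \<kappa> * norm (y - x)) \<longlongrightarrow> \<kappa> * norm (x - x)) (at x)" by (intro tendsto_intros)
      then show "((\<lambda>y. \<kappa> * norm (y - x)) \<longlongrightarrow> 0) (at x)" by simp
    qed
    then show ?thesis by (simp add: isCont_def LIM_zero_iff)
  qed
  then show "continuous_on UNIV c" by (simp add: continuous_at_imp_continuous_on)
qed

text \<open>Tonelli with a product majorant; it justifies the exchanges of Bochner integrals
  below.\<close>

lemma integrable_pair_bound:
  fixes f :: "'a \<times> 'b \<Rightarrow> 'c::{banach,second_countable_topology}" and g :: "'a \<Rightarrow> real" and h :: "'b \<Rightarrow> real"
  assumes "pair_sigma_finite M1 M2" and f: "f \<in> borel_measurable (M1 \<Otimes>\<^sub>M M2)"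
    and g: "integrable M1 g" and h: "integrable M2 h"
    and le: "\<And>x y. norm (f (x, y)) \<le> g x * h y"
  shows "integrable (M1 \<Otimes>\<^sub>M M2) f"
  unfolding integrable_iff_bounded
proof
  interpret pair_sigma_finite M1 M2 by fact
  have [measurable]: "g \<in> borel_measurable M1" "h \<in> borel_measurable M2" using g h by auto
  have "(\<integral>\<^sup>+z. norm (f z) \<partial>(M1 \<Otimes>\<^sub>M M2)) \<le> (\<integral>\<^sup>+z. ennreal \<bar>g (fst z)\<bar> * ennreal \<bar>h (snd z)\<bar> \<partial>(M1 \<Otimes>\<^sub>M M2))"
  proof (rule nn_integral_mono)
    fix z
    have "norm (f z) \<le> \<bar>g (fst z)\<bar> * \<bar>h (snd z)\<bar>"
      using le[of "fst z" "snd z"] abs_ge_self[of "g (fst z) * h (snd z)"] by (simp add: abs_mult)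
    then show "ennreal (norm (f z)) \<le> ennreal \<bar>g (fst z)\<bar> * ennreal \<bar>h (snd z)\<bar>"
      by (simp flip: ennreal_mult)
  qed
  also have "\<dots> = (\<integral>\<^sup>+x. ennreal \<bar>g x\<bar> \<partial>M1) * (\<integral>\<^sup>+y. ennreal \<bar>h y\<bar> \<partial>M2)"
    by (subst M2.nn_integral_fst[symmetric]) (auto simp: nn_integral_cmult nn_integral_multc)
  also have "\<dots> < \<infinity>"
    using g h by (simp add: integrable_iff_bounded ennreal_mult_less_top)
  finally show "(\<integral>\<^sup>+z. norm (f z) \<partial>(M1 \<Otimes>\<^sub>M M2)) < \<infinity>" .
qed (rule f)

lemma iexp_diff_le: "cmod (iexp x - 1) \<le> min 2 \<bar>x\<bar>"
  using iexp_approx1[of x 0] norm_triangle_ineq4[of "iexp x" 1] by simp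

text \<open>Separates the variables: linear growth in \<open>\<xi>\<close>, to be absorbed by a
  Gaussian first moment, and the truncated norm in \<open>y\<close>, to be absorbed by
  \<open>\<nu>\<close>.\<close>

lemma iexp_inner_diff_le:
  fixes \<xi> y :: "'a::euclidean_space"
  shows "cmod (iexp (\<xi> \<bullet> y) - 1) \<le> (2 + norm \<xi>) * min 1 (norm y)"
proof -
  have "\<bar>\<xi> \<bullet> y\<bar> \<le> norm \<xi> * norm y" by (rule Cauchy_Schwarz_ineq2)
  then have "cmod (iexp (\<xi> \<bullet> y) - 1) \<le> min 2 (norm \<xi> * norm y)"
    using iexp_diff_le[of "\<xi> \<bullet> y"] by simp
  also have "\<dots> \<le> (2 + norm \<xi>) * min 1 (norm y)"
  proof (cases "norm y \<le> 1")
    case True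
    have "min 2 (norm \<xi> * norm y) \<le> norm \<xi> * norm y" by (rule min.cobounded2)
    also have "\<dots> \<le> (2 + norm \<xi>) * min 1 (norm y)" using True by (simp add: distrib_right)
    finally show ?thesis .
  next
    case False
    have "min 2 (norm \<xi> * norm y) \<le> 2 + norm \<xi>" by (rule min.coboundedI1) simp
    with False show ?thesis by simp
  qed
  finally show ?thesis .
qed

section \<open>Drift-free exponents and the evolution of expectations\<close>

locale finite_variation_levy_measure =
  fixes \<nu> :: "'a::euclidean_space measure"
  assumes sets_nu[measurable_cong, simp]: "sets \<nu> = sets borel"
    and nu_zero: "emeasure \<nu> {0} = 0"
    and integrable_min: "integrable \<nu> (\<lambda>y. min 1 (norm y))"
begin

lemma space_nu[simp]: "space \<nu> = UNIV"
  using sets_eq_imp_space_eq[OF sets_nu] by simp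

sublocale sigma_finite_measure \<nu>
proof
  \<comment> \<open>By Markov's inequality these sets have finite measure; with the null set
    \<open>{0}\<close> they cover the space.\<close>
  let ?A = "\<lambda>n::nat. {y. min 1 (norm y) \<ge> 1 / (Suc n)}"
  have fin: "emeasure \<nu> (?A n) \<noteq> \<infinity>" for n
  proof -
    have "emeasure \<nu> {y \<in> space \<nu>. min 1 (norm y) \<ge> 1 / (Suc n)} \<le> ennreal (1 / (1 / (Suc n)) * (\<integral>y. min 1 (norm y) \<partial>\<nu>))"
      by (rule integral_Markov_inequality[OF integrable_min]) auto
    then have "emeasure \<nu> (?A n) < \<infinity>" by (auto elim!: le_less_trans)
    then show ?thesis by simp
  qed
  have cover: "y \<in> {0} \<union> (\<Union>n. ?A n)" for y :: 'a
  proof (cases "y = 0")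
    case False
    then have "min 1 (norm y) > 0" by simp
    then obtain n where "1 / (Suc n) < min 1 (norm y)" using nat_approx_posE by blast
    then have "y \<in> ?A n" by auto
    then show ?thesis by blast
  qed auto
  show "\<exists>A. countable A \<and> A \<subseteq> sets \<nu> \<and> \<Union>A = space \<nu> \<and> (\<forall>a\<in>A. emeasure \<nu> a \<noteq> \<infinity>)"
    by (rule exI[of _ "insert {0} (range ?A)"]) (use fin nu_zero cover in auto)
qed

definition psi :: "'a \<Rightarrow> complex" where
  "psi \<xi> = (\<integral>y. 1 - iexp (\<xi> \<bullet> y) \<partial>\<nu>)"

definition mass :: real where "mass = (\<integral>y. min 1 (norm y) \<partial>\<nu>)"

lemma mass_nonneg: "0 \<le> mass"
  unfolding mass_def by simp

lemma iexp_inner_measurable[measurable]: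
  "(\<lambda>y. iexp (\<xi> \<bullet> y)) \<in> borel_measurable borel" for \<xi> :: 'a
  by (intro borel_measurable_continuous_onI continuous_intros)

lemma integrable_psi: "integrable \<nu> (\<lambda>y. 1 - iexp (\<xi> \<bullet> y))"
proof (rule Bochner_Integration.integrable_bound)
  show "integrable \<nu> (\<lambda>y. (2 + norm \<xi>) * min 1 (norm y))" using integrable_min by simp
  show "AE y in \<nu>. norm (1 - iexp (\<xi> \<bullet> y)) \<le> norm ((2 + norm \<xi>) * min 1 (norm y))"
    using iexp_inner_diff_le[of \<xi>] by (auto simp: norm_minus_commute)
qed measurable

lemma norm_psi_le: "cmod (psi \<xi>) \<le> (2 + norm \<xi>) * mass"
proof -
  have "cmod (psi \<xi>) \<le> (\<integral>y. cmod (1 - iexp (\<xi> \<bullet> y)) \<partial>\<nu>)" unfolding psi_def by simp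
  also have "\<dots> \<le> (\<integral>y. (2 + norm \<xi>) * min 1 (norm y) \<partial>\<nu>)"
    using integrable_psi integrable_min iexp_inner_diff_le[of \<xi>]
    by (intro integral_mono) (auto simp: norm_minus_commute)
  finally show ?thesis by (simp add: mass_def)
qed

lemma Re_psi_nonneg: "0 \<le> Re (psi \<xi>)"
  unfolding psi_def by (subst integral_Re[OF integrable_psi, symmetric]) (auto simp: Re_exp)

lemma psi_measurable[measurable]: "psi \<in> borel_measurable borel"
  unfolding psi_def
  by (rule borel_measurable_lebesgue_integral) 
     (auto simp: split_beta' intro!: borel_measurable_continuous_onI continuous_intros simp flip: borel_prod)

end

text \<open>The drift-free process enters the expansion through the characteristic functions of its
  laws at single times.\<close>

locale pure_jump_family = finite_variation_levy_measure \<nu> + prob_space M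
  for \<nu> :: "'a::euclidean_space measure" and M :: "'w measure" +
  fixes Y :: "real \<Rightarrow> 'w \<Rightarrow> 'a"
  assumes Y_measurable: "0 \<le> s \<Longrightarrow> Y s \<in> borel_measurable M"
    and char_Y: "0 \<le> s \<Longrightarrow> (\<integral>\<omega>. iexp (\<xi> \<bullet> Y s \<omega>) \<partial>M) = exp (- (of_real s * psi \<xi>))"
begin

lemma norm_exp_psi_le: "0 \<le> s \<Longrightarrow> cmod (exp (- (of_real s * psi \<xi>))) \<le> 1"
  using Re_psi_nonneg[of \<xi>] by (simp add: norm_exp)

end

text \<open>The function \<open>f\<close> below is the Fourier transform of the measure \<open>w\<close> times a Gaussian, scaled by \<open>\<tau>\<close>;
  \<open>q s\<close> is the derivative of the expectation of \<open>f (Y s + b)\<close> in \<open>s\<close>.\<close>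

locale fourier_test = pure_jump_family \<nu> M Y
  for \<nu> :: "'a::euclidean_space measure" and M :: "'w measure" and Y :: "real \<Rightarrow> 'w \<Rightarrow> 'a" +
  fixes w :: "'a \<Rightarrow> complex" and W \<tau> :: real and b :: 'a
  assumes w_measurable[measurable]: "w \<in> borel_measurable borel" and w_le: "cmod (w \<xi>) \<le> W"
begin

sublocale N: prob_space "gauss_measure :: 'a measure" by (rule prob_space_gauss_measure)
sublocale MN: pair_sigma_finite M "gauss_measure :: 'a measure" ..
sublocale nuN: pair_sigma_finite \<nu> "gauss_measure :: 'a measure" ..
sublocale lN: pair_sigma_finite "lborel :: real measure" "gauss_measure :: 'a measure" ..

lemma W_nonneg: "0 \<le> W" using w_le[of 0] norm_ge_zero order_trans by blast

definition f :: "'a \<Rightarrow> complex" where "f y = (\<integral>\<xi>. w \<xi> * iexp ((\<tau> *\<^sub>R \<xi>) \<bullet> y) \<partial>gauss_measure)"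

definition q :: "real \<Rightarrow> complex" where
  "q s = (\<integral>\<xi>. w \<xi> * iexp ((\<tau> *\<^sub>R \<xi>) \<bullet> b) * - (psi (\<tau> *\<^sub>R \<xi>) * exp (- (of_real s * psi (\<tau> *\<^sub>R \<xi>)))) \<partial>gauss_measure)"

lemma cont_iexp: "(\<lambda>z::'a \<times> 'a. iexp (fst z \<bullet> snd z)) \<in> borel_measurable (borel \<Otimes>\<^sub>M borel)"
  unfolding borel_prod by (intro borel_measurable_continuous_onI continuous_intros)

lemma iexp_measurable2[measurable (raw)]:
  assumes "g \<in> K \<rightarrow>\<^sub>M borel" "h \<in> K \<rightarrow>\<^sub>M (borel :: 'a measure)"
  shows "(\<lambda>x. iexp (g x \<bullet> h x)) \<in> borel_measurable K"
  using measurable_compose[OF measurable_Pair[OF assms] cont_iexp] by simp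

text \<open>Fubini, then the characteristic function of \<open>Y s\<close> under the Gaussian
  integral. The shift \<open>a\<close> is general because both \<open>b\<close> and
  \<open>b + y\<close> occur later.\<close>

lemma expectation_f:
  assumes s: "0 \<le> s"
  shows "(\<integral>\<omega>. f (Y s \<omega> + a) \<partial>M) =
    (\<integral>\<xi>. w \<xi> * iexp ((\<tau> *\<^sub>R \<xi>) \<bullet> a) * exp (- (of_real s * psi (\<tau> *\<^sub>R \<xi>))) \<partial>gauss_measure)"
proof -
  note [measurable] = Y_measurable[OF s]
  let ?h = "\<lambda>\<omega> \<xi>. w \<xi> * iexp ((\<tau> *\<^sub>R \<xi>) \<bullet> (Y s \<omega> + a))"
  have "integrable (M \<Otimes>\<^sub>M gauss_measure) (case_prod ?h)"
    by (rule integrable_pair_bound[where g="\<lambda>_. W" and h="\<lambda>_. 1"])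
       (auto simp: norm_mult w_le MN.pair_sigma_finite_axioms)
  from MN.Fubini_integral[OF this, symmetric]
  have "(\<integral>\<omega>. f (Y s \<omega> + a) \<partial>M) = (\<integral>\<xi>. (\<integral>\<omega>. ?h \<omega> \<xi> \<partial>M) \<partial>gauss_measure)"
    unfolding f_def by simp
  also have "\<dots> = (\<integral>\<xi>. w \<xi> * iexp ((\<tau> *\<^sub>R \<xi>) \<bullet> a) * (\<integral>\<omega>. iexp ((\<tau> *\<^sub>R \<xi>) \<bullet> Y s \<omega>) \<partial>M) \<partial>gauss_measure)"
    by (intro Bochner_Integration.integral_cong refl)
       (simp add: inner_add_right distrib_left exp_add mult_ac flip: integral_mult_right_zero)
  finally show ?thesis by (simp only: char_Y[OF s])
qed

lemma f_bound: "cmod (f y) \<le> W"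
proof -
  have "cmod (f y) \<le> (\<integral>\<xi>. cmod (w \<xi> * iexp ((\<tau> *\<^sub>R \<xi>) \<bullet> y)) \<partial>gauss_measure)"
    unfolding f_def by simp
  also have "\<dots> \<le> (\<integral>\<xi>. W \<partial>(gauss_measure :: 'a measure))"
    by (intro integral_mono N.integrable_const_bound[where B=W]) (auto simp: norm_mult w_le W_nonneg)
  finally show ?thesis using N.prob_space by simp
qed

lemma f_measurable[measurable]: "f \<in> borel_measurable borel"
  unfolding f_def by (rule N.borel_measurable_lebesgue_integral) (simp add: split_beta')

text \<open>For fixed \<open>\<xi>\<close> this is the fundamental theorem of calculus for the
  exponential of \<open>- s psi\<close>; \<open>norm_psi_le\<close> and the Gaussian first moment
  justify the exchange of integrals.\<close>

lemma q_integral_rep: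
  assumes t: "0 \<le> t"
  shows "(\<integral>s. indicator {0..t} s *\<^sub>R q s \<partial>lborel) = (\<integral>\<omega>. f (Y t \<omega> + b) \<partial>M) - f b"
    and "integrable lborel (\<lambda>s. indicator {0..t} s *\<^sub>R q s)"
proof -
  let ?e = "\<lambda>\<xi>. w \<xi> * iexp ((\<tau> *\<^sub>R \<xi>) \<bullet> b)"
  let ?h = "\<lambda>s \<xi>. indicator {0..t} s *\<^sub>R (?e \<xi> * - (psi (\<tau> *\<^sub>R \<xi>) * exp (- (of_real s * psi (\<tau> *\<^sub>R \<xi>)))))"
  have int: "integrable (lborel \<Otimes>\<^sub>M gauss_measure) (case_prod ?h)"
  proof (rule integrable_pair_bound[where g="\<lambda>s. indicator {0..t} s" and h="\<lambda>\<xi>. W * ((2 + norm (\<tau> *\<^sub>R \<xi>)) * mass)"])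
    show "integrable lborel (indicator {0..t} :: real \<Rightarrow> real)" using t by (intro integrable_real_indicator) auto
    show "integrable gauss_measure (\<lambda>\<xi>::'a. W * ((2 + norm (\<tau> *\<^sub>R \<xi>)) * mass))"
      using integrable_norm_gauss_measure[where 'a='a] by (auto simp: distrib_right)
    fix s :: real and \<xi> :: 'a
    show "norm (case_prod ?h (s, \<xi>)) \<le> indicator {0..t} s * (W * ((2 + norm (\<tau> *\<^sub>R \<xi>)) * mass))"
    proof (cases "s \<in> {0..t}")
      case True
      then have "cmod (w \<xi>) * (cmod (psi (\<tau> *\<^sub>R \<xi>)) * cmod (exp (- (of_real s * psi (\<tau> *\<^sub>R \<xi>))))) 
        \<le> W * ((2 + norm (\<tau> *\<^sub>R \<xi>)) * mass * 1)"
        using w_le[of \<xi>] norm_psi_le[of "\<tau> *\<^sub>R \<xi>"] norm_exp_psi_le[of s "\<tau> *\<^sub>R \<xi>"] W_nonneg mass_nonneg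
        by (intro mult_mono) auto
      then show ?thesis using True by (simp add: norm_mult)
    qed simp
  qed (auto simp: lN.pair_sigma_finite_axioms split_beta')
  have FTC: "(\<integral>s. ?h s \<xi> \<partial>lborel) = ?e \<xi> * exp (- (of_real t * psi (\<tau> *\<^sub>R \<xi>))) - ?e \<xi>" for \<xi>
  proof -
    let ?F = "\<lambda>s. ?e \<xi> * exp (- (of_real s * psi (\<tau> *\<^sub>R \<xi>)))"
    have "(\<integral>s. ?h s \<xi> \<partial>lborel) = ?F t - ?F 0"
      by (rule integral_FTC_Icc[OF t])
         (auto intro!: derivative_eq_intros continuous_intros has_vector_derivative_real_field simp: mult_ac)
    then show ?thesis by simp
  qed
  have "integrable lborel (\<lambda>s. \<integral>\<xi>. ?h s \<xi> \<partial>gauss_measure)"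
    using lN.integrable_fst[OF int] by simp
  then show "integrable lborel (\<lambda>s. indicator {0..t} s *\<^sub>R q s)" by (simp add: q_def)
  have "(\<integral>s. indicator {0..t} s *\<^sub>R q s \<partial>lborel) = (\<integral>\<xi>. \<integral>s. ?h s \<xi> \<partial>lborel \<partial>gauss_measure)"
    using lN.Fubini_integral[OF int] by (simp add: q_def)
  also have "\<dots> = (\<integral>\<xi>. ?e \<xi> * exp (- (of_real t * psi (\<tau> *\<^sub>R \<xi>))) \<partial>gauss_measure) - (\<integral>\<xi>. ?e \<xi> \<partial>gauss_measure)"
    unfolding FTC
  proof (intro Bochner_Integration.integral_diff N.integrable_const_bound[where B=W] AE_I2)
    fix \<xi> :: 'a
    show "cmod (?e \<xi> * exp (- (of_real t * psi (\<tau> *\<^sub>R \<xi>)))) \<le> W"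
      using mult_mono[OF w_le[of \<xi>] norm_exp_psi_le[OF t, of "\<tau> *\<^sub>R \<xi>"]] W_nonneg by (simp add: norm_mult)
    show "cmod (?e \<xi>) \<le> W" using w_le by (simp add: norm_mult)
  qed auto
  finally show "(\<integral>s. indicator {0..t} s *\<^sub>R q s \<partial>lborel) = (\<integral>\<omega>. f (Y t \<omega> + b) \<partial>M) - f b"
    by (simp only: expectation_f[OF t] f_def[of b])
qed

text \<open>With \<open>- psi\<close> written as the \<open>\<nu>\<close>-integral of
  \<open>iexp - 1\<close> and the integrals exchanged, the character of the jump \<open>y\<close>
  shifts the argument of \<open>f\<close>. So \<open>q s\<close> is the mean of the jump generator
  applied to \<open>f\<close>.\<close>

lemma q_eq:
  assumes s: "0 \<le> s"
  shows "q s = (\<integral>y. (\<integral>\<omega>. f (Y s \<omega> + (b + y)) \<partial>M) - (\<integral>\<omega>. f (Y s \<omega> + b) \<partial>M) \<partial>\<nu>)"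
    and "integrable \<nu> (\<lambda>y. (\<integral>\<omega>. f (Y s \<omega> + (b + y)) \<partial>M) - (\<integral>\<omega>. f (Y s \<omega> + b) \<partial>M))"
proof -
  let ?E = "\<lambda>\<xi>. exp (- (of_real s * psi (\<tau> *\<^sub>R \<xi>)))"
  let ?e = "\<lambda>\<xi>. w \<xi> * iexp ((\<tau> *\<^sub>R \<xi>) \<bullet> b) * ?E \<xi>"
  let ?h = "\<lambda>y \<xi>. ?e \<xi> * (iexp ((\<tau> *\<^sub>R \<xi>) \<bullet> y) - 1)"
  have e_le: "cmod (?e \<xi>) \<le> W" for \<xi>
    using mult_mono[OF w_le[of \<xi>] norm_exp_psi_le[OF s, of "\<tau> *\<^sub>R \<xi>"]] W_nonneg by (simp add: norm_mult)
  have int: "integrable (\<nu> \<Otimes>\<^sub>M gauss_measure) (case_prod ?h)"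
  proof (rule integrable_pair_bound[where g="\<lambda>y. min 1 (norm y)" and h="\<lambda>\<xi>. W * (2 + norm (\<tau> *\<^sub>R \<xi>))"])
    show "integrable gauss_measure (\<lambda>\<xi>::'a. W * (2 + norm (\<tau> *\<^sub>R \<xi>)))"
      using integrable_norm_gauss_measure[where 'a='a] by auto
    fix y \<xi> :: 'a
    have "cmod (?e \<xi>) * cmod (iexp ((\<tau> *\<^sub>R \<xi>) \<bullet> y) - 1) \<le> W * ((2 + norm (\<tau> *\<^sub>R \<xi>)) * min 1 (norm y))"
      by (intro mult_mono e_le W_nonneg order_trans[OF iexp_inner_diff_le]) auto
    then show "norm (case_prod ?h (y, \<xi>)) \<le> min 1 (norm y) * (W * (2 + norm (\<tau> *\<^sub>R \<xi>)))"
      unfolding norm_mult[symmetric] by (simp add: mult_ac)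
  qed (auto simp: nuN.pair_sigma_finite_axioms split_beta' intro: integrable_min)
  have inner: "(\<integral>\<xi>. ?h y \<xi> \<partial>gauss_measure) = (\<integral>\<omega>. f (Y s \<omega> + (b + y)) \<partial>M) - (\<integral>\<omega>. f (Y s \<omega> + b) \<partial>M)" for y
  proof -
    have "?h y \<xi> = w \<xi> * iexp ((\<tau> *\<^sub>R \<xi>) \<bullet> (b + y)) * ?E \<xi> - ?e \<xi>" for \<xi>
      by (simp add: inner_add_right distrib_left exp_add algebra_simps)
    then have "(\<integral>\<xi>. ?h y \<xi> \<partial>gauss_measure) = (\<integral>\<xi>. w \<xi> * iexp ((\<tau> *\<^sub>R \<xi>) \<bullet> (b + y)) * ?E \<xi> - ?e \<xi> \<partial>gauss_measure)"
      by simp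
    also have "\<dots> = (\<integral>\<xi>. w \<xi> * iexp ((\<tau> *\<^sub>R \<xi>) \<bullet> (b + y)) * ?E \<xi> \<partial>gauss_measure) - (\<integral>\<xi>. ?e \<xi> \<partial>gauss_measure)"
    proof (intro Bochner_Integration.integral_diff N.integrable_const_bound[where B=W] AE_I2)
      show "cmod (w \<xi> * iexp ((\<tau> *\<^sub>R \<xi>) \<bullet> (b + y)) * ?E \<xi>) \<le> W" for \<xi>
        using e_le[of \<xi>] by (simp add: norm_mult)
    qed (use e_le in auto)
    finally show ?thesis by (simp only: expectation_f[OF s])
  qed
  show "integrable \<nu> (\<lambda>y. (\<integral>\<omega>. f (Y s \<omega> + (b + y)) \<partial>M) - (\<integral>\<omega>. f (Y s \<omega> + b) \<partial>M))"
    using nuN.integrable_fst[OF int] unfolding split_conv inner .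
  have "(\<integral>y. (\<integral>\<omega>. f (Y s \<omega> + (b + y)) \<partial>M) - (\<integral>\<omega>. f (Y s \<omega> + b) \<partial>M) \<partial>\<nu>) = (\<integral>\<xi>. \<integral>y. ?h y \<xi> \<partial>\<nu> \<partial>gauss_measure)"
    using nuN.Fubini_integral[OF int] unfolding inner by simp
  also have "\<dots> = q s"
    unfolding q_def
  proof (intro Bochner_Integration.integral_cong refl)
    fix \<xi> :: 'a
    have "(\<integral>y. ?h y \<xi> \<partial>\<nu>) = ?e \<xi> * - (\<integral>y. 1 - iexp ((\<tau> *\<^sub>R \<xi>) \<bullet> y) \<partial>\<nu>)"
      by (simp flip: integral_minus integral_mult_right_zero)
    then show "(\<integral>y. ?h y \<xi> \<partial>\<nu>) = w \<xi> * iexp ((\<tau> *\<^sub>R \<xi>) \<bullet> b) * - (psi (\<tau> *\<^sub>R \<xi>) * ?E \<xi>)"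
      by (simp add: psi_def mult_ac)
  qed
  finally show "q s = (\<integral>y. (\<integral>\<omega>. f (Y s \<omega> + (b + y)) \<partial>M) - (\<integral>\<omega>. f (Y s \<omega> + b) \<partial>M) \<partial>\<nu>)" ..
qed

end

context finite_variation_levy_measure
begin

text \<open>The error term of the expansion: jumps are weighted by their size capped at
  \<open>r\<close>, so it tends to 0 with \<open>r\<close>.\<close>

definition truncated_mass :: "real \<Rightarrow> real" where
  "truncated_mass r = (\<integral>y. min 1 (min (norm y) r) \<partial>\<nu>)"

lemma integrable_truncated: "0 \<le> r \<Longrightarrow> integrable \<nu> (\<lambda>y. min 1 (min (norm y) r))"
  by (rule Bochner_Integration.integrable_bound[OF integrable_min]) auto

end

context fourier_test
begin

text \<open>The integrand is a second difference of \<open>f\<close>, in the jump \<open>y\<close>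
  and the position \<open>Y s + b\<close>, and either increment may be used to bound it. Positions
  within \<open>2 * \<delta>\<close> contribute \<open>truncated_mass (2 * \<delta>)\<close>; the
  event that \<open>Y s\<close> exceeds \<open>\<delta>\<close> contributes
  \<open>mass * \<eta>\<close>.\<close>

lemma f_expansion:
  assumes lip: "\<And>x y. cmod (f x - f y) \<le> \<kappa> * min 1 (norm (x - y))"
    and t: "0 \<le> t" and \<delta>: "norm b \<le> \<delta>" "0 < \<delta>"
    and prob: "\<And>s. s \<in> {0..t} \<Longrightarrow> prob {\<omega>\<in>space M. \<delta> < norm (Y s \<omega>)} \<le> \<eta>"
  shows "cmod ((\<integral>\<omega>. f (Y t \<omega> + b) \<partial>M) - f b - t *\<^sub>R (\<integral>y. f y - f 0 \<partial>\<nu>))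
    \<le> t * (2 * \<kappa> * (truncated_mass (2 * \<delta>) + mass * \<eta>))"
proof -
  let ?D = "\<integral>y. f y - f 0 \<partial>\<nu>"
  let ?R = "2 * \<kappa> * (truncated_mass (2 * \<delta>) + mass * \<eta>)"
  have \<kappa>: "0 \<le> \<kappa>" by (rule truncated_lipschitz(1)[OF lip])
  have intD: "integrable \<nu> (\<lambda>y. f y - f 0)"
  proof (rule Bochner_Integration.integrable_bound)
    show "integrable \<nu> (\<lambda>y. \<kappa> * min 1 (norm y))" using integrable_min by simp
    show "AE y in \<nu>. norm (f y - f 0) \<le> norm (\<kappa> * min 1 (norm y))"
      using lip[of _ 0] by (auto intro: order_trans[OF _ abs_ge_self])
  qed measurable
  have fint: "integrable M (\<lambda>\<omega>. f (Y s \<omega> + a))" if "0 \<le> s" for s a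
  proof (rule integrable_const_bound[where B=W])
    note [measurable] = Y_measurable[OF that]
    show "(\<lambda>\<omega>. f (Y s \<omega> + a)) \<in> borel_measurable M" by measurable
  qed (simp add: f_bound)
  have q_le: "cmod (q s - ?D) \<le> ?R" if s: "s \<in> {0..t}" for s
  proof -
    have s0: "0 \<le> s" using s by simp
    note [measurable] = Y_measurable[OF s0]
    let ?p = "prob {\<omega>\<in>space M. \<delta> < norm (Y s \<omega>)}"
    let ?G = "\<lambda>y. 2 * \<kappa> * (min 1 (min (norm y) (2 * \<delta>)) + min 1 (norm y) * ?p)"
    let ?d = "\<lambda>y. (\<integral>\<omega>. f (Y s \<omega> + (b + y)) \<partial>M) - (\<integral>\<omega>. f (Y s \<omega> + b) \<partial>M) - (f y - f 0)"
    have d_le: "cmod (?d y) \<le> ?G y" for y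
    proof -
      let ?\<Delta> = "\<lambda>\<omega>. f (Y s \<omega> + (b + y)) - f (Y s \<omega> + b) - (f y - f 0)"
      have int\<Delta>: "integrable M ?\<Delta>" by (intro Bochner_Integration.integrable_diff fint s0) auto
      have "?d y = (\<integral>\<omega>. ?\<Delta> \<omega> \<partial>M)"
        using fint[OF s0, of b] fint[OF s0, of "b + y"] by (simp add: prob_space)
      then have "cmod (?d y) \<le> (\<integral>\<omega>. cmod (?\<Delta> \<omega>) \<partial>M)"
        using integral_norm_bound[of M ?\<Delta>] by (simp only:)
      also have "\<dots> \<le> (\<integral>\<omega>. 2 * \<kappa> * (min 1 (min (norm y) (2 * \<delta>)) + min 1 (norm y) * indicator {\<omega>\<in>space M. \<delta> < norm (Y s \<omega>)} \<omega>) \<partial>M)"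
      proof (rule integral_mono)
        show "integrable M (\<lambda>\<omega>. cmod (?\<Delta> \<omega>))" using int\<Delta> by (rule integrable_norm)
        show "integrable M (\<lambda>\<omega>. 2 * \<kappa> * (min 1 (min (norm y) (2 * \<delta>)) + min 1 (norm y) * indicator {\<omega>\<in>space M. \<delta> < norm (Y s \<omega>)} \<omega>))"
          by (intro integrable_mult_right Bochner_Integration.integrable_add integrable_const integrable_real_indicator)
             (auto simp: emeasure_eq_measure)
        fix \<omega> assume \<omega>: "\<omega> \<in> space M"
        let ?z = "Y s \<omega> + b"
        \<comment> \<open>Grouping the four terms by the jump bounds them through
          \<open>norm y\<close>; the regrouping further below bounds them through
          \<open>norm ?z\<close>.\<close>
        have "?\<Delta> \<omega> = (f (?z + y) - f ?z) - (f y - f 0)" by (simp add: add.assoc)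
        then have "cmod (?\<Delta> \<omega>) \<le> cmod (f (?z + y) - f ?z) + cmod (f y - f 0)"
          by (rule ord_eq_le_trans[OF arg_cong[where f=cmod] norm_triangle_ineq4])
        also have "\<dots> \<le> 2 * \<kappa> * min 1 (norm y)" using lip[of "?z + y" ?z] lip[of y 0] by simp
        finally have 1: "cmod (?\<Delta> \<omega>) \<le> 2 * \<kappa> * min 1 (norm y)" .
        have "?\<Delta> \<omega> = (f (?z + y) - f y) - (f ?z - f 0)" by (simp add: add.assoc)
        then have "cmod (?\<Delta> \<omega>) \<le> cmod (f (?z + y) - f y) + cmod (f ?z - f 0)"
          by (rule ord_eq_le_trans[OF arg_cong[where f=cmod] norm_triangle_ineq4])
        also have "\<dots> \<le> 2 * \<kappa> * min 1 (norm ?z)" using lip[of "?z + y" y] lip[of ?z 0] by simp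
        finally have 2: "cmod (?\<Delta> \<omega>) \<le> 2 * \<kappa> * min 1 (norm ?z)" .
        show "cmod (?\<Delta> \<omega>) \<le> 2 * \<kappa> * (min 1 (min (norm y) (2 * \<delta>)) + min 1 (norm y) * indicator {\<omega>\<in>space M. \<delta> < norm (Y s \<omega>)} \<omega>)"
        proof (cases "\<delta> < norm (Y s \<omega>)")
          case True
          have "2 * \<kappa> * min 1 (norm y) \<le> 2 * \<kappa> * (min 1 (min (norm y) (2 * \<delta>)) + min 1 (norm y))"
            using \<kappa> \<delta> by (intro mult_left_mono) auto
          with 1 True \<omega> show ?thesis by simp
        next
          case False
          then have "norm ?z \<le> 2 * \<delta>" using norm_triangle_ineq[of "Y s \<omega>" b] \<delta> by simp
          then have "2 * \<kappa> * min 1 (norm ?z) \<le> 2 * \<kappa> * min 1 (2 * \<delta>)"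
            using \<kappa> by (intro mult_left_mono) auto
          with 2 have "cmod (?\<Delta> \<omega>) \<le> 2 * \<kappa> * min 1 (2 * \<delta>)" by simp
          with 1 have "cmod (?\<Delta> \<omega>) \<le> 2 * \<kappa> * min 1 (min (norm y) (2 * \<delta>))"
            by (simp add: min_def split: if_splits)
          with False show ?thesis by simp
        qed
      qed
      also have "\<dots> = ?G y"
        by (simp add: prob_space emeasure_eq_measure integrable_real_indicator)
      finally show ?thesis .
    qed
    have intG: "integrable \<nu> ?G"
      using integrable_truncated[of "2 * \<delta>"] integrable_min \<delta>
      by (intro integrable_mult_right Bochner_Integration.integrable_add integrable_mult_left) auto
    have "q s - ?D = (\<integral>y. ?d y \<partial>\<nu>)"
      unfolding q_eq(1)[OF s0] by (intro Bochner_Integration.integral_diff[symmetric] q_eq(2) s0 intD)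
    then have "cmod (q s - ?D) \<le> (\<integral>y. cmod (?d y) \<partial>\<nu>)"
      using integral_norm_bound[of \<nu> ?d] by (simp only:)
    also have "\<dots> \<le> (\<integral>y. ?G y \<partial>\<nu>)"
      by (intro integral_mono d_le intG integrable_norm Bochner_Integration.integrable_diff[OF q_eq(2)[OF s0] intD])
    also have "\<dots> = 2 * \<kappa> * (truncated_mass (2 * \<delta>) + mass * ?p)"
      using integrable_truncated[of "2 * \<delta>"] integrable_min \<delta>
      by (simp add: truncated_mass_def mass_def)
    also have "\<dots> \<le> ?R"
      using prob[OF s] \<kappa> mass_nonneg by (intro mult_left_mono add_left_mono) auto
    finally show ?thesis .
  qed
  have ind: "integrable lborel (indicator {0..t} :: real \<Rightarrow> real)"
    using t by (intro integrable_real_indicator) auto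
  \<comment> \<open>The remainder is the integral of \<open>q s - ?D\<close> over
    \<open>{0..t}\<close>, so the uniform bound \<open>q_le\<close> acquires a factor
    \<open>t\<close>.\<close>
  have "(\<integral>\<omega>. f (Y t \<omega> + b) \<partial>M) - f b - t *\<^sub>R ?D = 
      (\<integral>s. indicator {0..t} s *\<^sub>R q s \<partial>lborel) - (\<integral>s. indicator {0..t} s *\<^sub>R ?D \<partial>lborel)"
    using t ind by (simp add: q_integral_rep(1) integral_scaleR_left)
  also have "\<dots> = (\<integral>s. indicator {0..t} s *\<^sub>R q s - indicator {0..t} s *\<^sub>R ?D \<partial>lborel)"
    by (intro Bochner_Integration.integral_diff[symmetric] q_integral_rep t integrable_scaleR_left ind)
  finally have "cmod ((\<integral>\<omega>. f (Y t \<omega> + b) \<partial>M) - f b - t *\<^sub>R ?D)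
      \<le> (\<integral>s. cmod (indicator {0..t} s *\<^sub>R q s - indicator {0..t} s *\<^sub>R ?D) \<partial>lborel)"
    using integral_norm_bound[of lborel "\<lambda>s. indicator {0..t} s *\<^sub>R q s - indicator {0..t} s *\<^sub>R ?D"]
    by (simp only:)
  also have "\<dots> \<le> (\<integral>s. indicator {0..t} s * ?R \<partial>lborel)"
  proof (rule integral_mono)
    show "integrable lborel (\<lambda>s. cmod (indicator {0..t} s *\<^sub>R q s - indicator {0..t} s *\<^sub>R ?D))"
      by (intro integrable_norm Bochner_Integration.integrable_diff q_integral_rep t integrable_scaleR_left ind)
    show "integrable lborel (\<lambda>s. indicator {0..t} s * ?R)" by (intro integrable_mult_left ind)
    show "cmod (indicator {0..t} s *\<^sub>R q s - indicator {0..t} s *\<^sub>R ?D) \<le> indicator {0..t} s * ?R" for s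
      using q_le[of s] by (simp add: indicator_def)
  qed
  also have "\<dots> = t * ?R" using t by simp
  finally show ?thesis .
qed

end

section \<open>Gaussian mollification of Lipschitz functions\<close>

lemma lborel_integral_affine:
  fixes h :: "'a::euclidean_space \<Rightarrow> 'b::{banach,second_countable_topology}"
  assumes [measurable]: "h \<in> borel_measurable borel" and "s \<noteq> 0"
  shows "(\<integral>z. h z \<partial>lborel) = \<bar>s\<bar> ^ DIM('a) *\<^sub>R (\<integral>x. h (t + s *\<^sub>R x) \<partial>lborel)"
  by (subst lborel_affine[OF assms(2), of t], subst integral_density) (auto simp: integral_distr)

text \<open>In the convolution of \<open>c\<close> with a scaled Gaussian, the density is replaced
  by its Fourier representation and the integrals are exchanged; what remains is the rescaled
  Fourier transform of \<open>c\<close> against a Gaussian. The mollified \<open>c\<close> thus has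
  the form required by \<open>fourier_test\<close> with \<open>\<tau> = - inverse \<sigma>\<close>,
  and integrability of \<open>c\<close> bounds \<open>w\<close>.\<close>

lemma gauss_smoothing_fourier:
  fixes c :: "'a::euclidean_space \<Rightarrow> real"
  assumes c: "integrable lborel c" and \<sigma>: "0 < \<sigma>"
  defines "w \<equiv> \<lambda>\<xi>. complex_of_real ((1 / sqrt (2 * pi)) ^ DIM('a) / \<sigma> ^ DIM('a)) *
      (\<integral>x. c x *\<^sub>R iexp ((\<xi> /\<^sub>R \<sigma>) \<bullet> x) \<partial>lborel)"
  shows "complex_of_real (\<integral>z. c (y + \<sigma> *\<^sub>R z) \<partial>gauss_measure) =
      (\<integral>\<xi>. w \<xi> * iexp (((- inverse \<sigma>) *\<^sub>R \<xi>) \<bullet> y) \<partial>gauss_measure)"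
    and "w \<in> borel_measurable borel"
    and "cmod (w \<xi>) \<le> (1 / sqrt (2 * pi)) ^ DIM('a) / \<sigma> ^ DIM('a) * (\<integral>x. \<bar>c x\<bar> \<partial>lborel)"
proof -
  let ?K = "(1 / sqrt (2 * pi)) ^ DIM('a)" and ?n = "DIM('a)"
  interpret N: prob_space "gauss_measure :: 'a measure" by (rule prob_space_gauss_measure)
  interpret P: pair_sigma_finite "lborel :: 'a measure" "gauss_measure :: 'a measure" ..
  have [measurable]: "c \<in> borel_measurable borel" using c by auto
  have m: "(\<lambda>z::'a \<times> 'a. iexp (fst z \<bullet> snd z)) \<in> borel_measurable (borel \<Otimes>\<^sub>M borel)"
    unfolding borel_prod by (intro borel_measurable_continuous_onI continuous_intros)
  have im: "(\<lambda>x. iexp (g x \<bullet> h x)) \<in> borel_measurable K"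
    if "g \<in> K \<rightarrow>\<^sub>M borel" "h \<in> K \<rightarrow>\<^sub>M (borel :: 'a measure)" for g h and K :: "('a \<times> 'a) measure"
    using measurable_compose[OF measurable_Pair[OF that] m] by simp
  have ic: "integrable lborel (\<lambda>x. c x *\<^sub>R iexp (v \<bullet> x))" for v
  proof (rule Bochner_Integration.integrable_bound[OF c])
    have "(\<lambda>x. iexp (v \<bullet> x)) \<in> borel_measurable borel"
      by (intro borel_measurable_continuous_onI continuous_intros)
    then show "(\<lambda>x. c x *\<^sub>R iexp (v \<bullet> x)) \<in> borel_measurable lborel" by measurable
  qed simp
  have "(\<lambda>z::'a \<times> 'a. c (snd z) *\<^sub>R iexp ((fst z /\<^sub>R \<sigma>) \<bullet> snd z)) \<in> borel_measurable (borel \<Otimes>\<^sub>M lborel)"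
    by (intro borel_measurable_scaleR im) measurable
  then show "w \<in> borel_measurable borel"
    unfolding w_def by (intro borel_measurable_times borel_measurable_const lborel.borel_measurable_lebesgue_integral)
      (simp add: split_beta')
  show "cmod (w \<xi>) \<le> ?K / \<sigma> ^ ?n * (\<integral>x. \<bar>c x\<bar> \<partial>lborel)" for \<xi>
  proof -
    have "cmod (\<integral>x. c x *\<^sub>R iexp ((\<xi> /\<^sub>R \<sigma>) \<bullet> x) \<partial>lborel) \<le> (\<integral>x. cmod (c x *\<^sub>R iexp ((\<xi> /\<^sub>R \<sigma>) \<bullet> x)) \<partial>lborel)"
      by (rule integral_norm_bound)
    also have "\<dots> = (\<integral>x. \<bar>c x\<bar> \<partial>lborel)" by simp
    finally show ?thesis using \<sigma> unfolding w_def norm_mult norm_of_real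
      by (intro mult_mono) auto
  qed
  have char: "complex_of_real (gauss_density v) = of_real ?K * (\<integral>\<xi>. iexp (v \<bullet> \<xi>) \<partial>gauss_measure)" for v :: 'a
    unfolding char_gauss_measure gauss_density_eq by (simp only: of_real_mult)
  have "(\<integral>z. c (y + \<sigma> *\<^sub>R z) \<partial>gauss_measure) = (\<integral>z. gauss_density z * c (y + \<sigma> *\<^sub>R z) \<partial>lborel)"
    by (subst integral_gauss_measure) auto
  \<comment> \<open>Substitutes \<open>z = (x - y) /\<^sub>R \<sigma>\<close>; the power of
    \<open>inverse \<sigma>\<close> is the Jacobian.\<close>
  also have "\<dots> = \<bar>inverse \<sigma>\<bar> ^ ?n *\<^sub>R (\<integral>x. gauss_density (- y /\<^sub>R \<sigma> + inverse \<sigma> *\<^sub>R x) * c (y + \<sigma> *\<^sub>R (- y /\<^sub>R \<sigma> + inverse \<sigma> *\<^sub>R x)) \<partial>lborel)"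
    by (rule lborel_integral_affine) (use \<sigma> in auto)
  also have "\<dots> = (\<integral>x. c x * gauss_density ((x - y) /\<^sub>R \<sigma>) \<partial>lborel) / \<sigma> ^ ?n"
    using \<sigma> by (simp add: scaleR_add_right scaleR_diff_right power_inverse divide_inverse mult_ac)
  finally have 1: "(\<integral>z. c (y + \<sigma> *\<^sub>R z) \<partial>gauss_measure) = (\<integral>x. c x * gauss_density ((x - y) /\<^sub>R \<sigma>) \<partial>lborel) / \<sigma> ^ ?n" .
  let ?h = "\<lambda>x \<xi>. c x *\<^sub>R iexp (((x - y) /\<^sub>R \<sigma>) \<bullet> \<xi>)"
  have int: "integrable (lborel \<Otimes>\<^sub>M gauss_measure) (case_prod ?h)"
  proof (rule integrable_pair_bound[where g="\<lambda>x. \<bar>c x\<bar>" and h="\<lambda>_. 1"])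
    show "case_prod ?h \<in> borel_measurable (lborel \<Otimes>\<^sub>M gauss_measure)"
      unfolding split_beta' by (intro borel_measurable_scaleR im) measurable
  qed (use c in \<open>auto simp: P.pair_sigma_finite_axioms\<close>)
  have "complex_of_real (\<integral>x. c x * gauss_density ((x - y) /\<^sub>R \<sigma>) \<partial>lborel) =
      (\<integral>x. complex_of_real (c x * gauss_density ((x - y) /\<^sub>R \<sigma>)) \<partial>lborel)"
    by (rule integral_complex_of_real[symmetric])
  also have "\<dots> = (\<integral>x. of_real ?K * (\<integral>\<xi>. ?h x \<xi> \<partial>gauss_measure) \<partial>lborel)"
    unfolding of_real_mult char by (intro Bochner_Integration.integral_cong refl) (simp add: scaleR_conv_of_real)
  also have "\<dots> = of_real ?K * (\<integral>x. \<integral>\<xi>. ?h x \<xi> \<partial>gauss_measure \<partial>lborel)"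
    by (rule integral_mult_right_zero)
  also have "(\<integral>x. \<integral>\<xi>. ?h x \<xi> \<partial>gauss_measure \<partial>lborel) = (\<integral>\<xi>. \<integral>x. ?h x \<xi> \<partial>lborel \<partial>gauss_measure)"
    using P.Fubini_integral[OF int] by simp
  also have "\<dots> = (\<integral>\<xi>. (\<integral>x. c x *\<^sub>R iexp ((\<xi> /\<^sub>R \<sigma>) \<bullet> x) \<partial>lborel) * iexp (((- inverse \<sigma>) *\<^sub>R \<xi>) \<bullet> y) \<partial>gauss_measure)"
  proof (intro Bochner_Integration.integral_cong refl)
    fix \<xi> :: 'a
    have "?h x \<xi> = (c x *\<^sub>R iexp ((\<xi> /\<^sub>R \<sigma>) \<bullet> x)) * iexp (((- inverse \<sigma>) *\<^sub>R \<xi>) \<bullet> y)" for x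
    proof -
      \<comment> \<open>The phase splits into a part in \<open>x\<close>, absorbed by
        \<open>w\<close>, and a part in \<open>y\<close>, whose minus sign explains the scale
        \<open>- inverse \<sigma>\<close>.\<close>
      have "((x - y) /\<^sub>R \<sigma>) \<bullet> \<xi> = (\<xi> /\<^sub>R \<sigma>) \<bullet> x + ((- inverse \<sigma>) *\<^sub>R \<xi>) \<bullet> y"
        by (simp add: inner_diff_left inner_commute algebra_simps)
      then show ?thesis by (simp only: of_real_add distrib_left exp_add mult_scaleR_left)
    qed
    then show "(\<integral>x. ?h x \<xi> \<partial>lborel) = (\<integral>x. c x *\<^sub>R iexp ((\<xi> /\<^sub>R \<sigma>) \<bullet> x) \<partial>lborel) * iexp (((- inverse \<sigma>) *\<^sub>R \<xi>) \<bullet> y)"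
      by (simp only: integral_mult_left_zero)
  qed
  finally have "complex_of_real (\<integral>x. c x * gauss_density ((x - y) /\<^sub>R \<sigma>) \<partial>lborel) / of_real (\<sigma> ^ ?n) =
    of_real (?K / \<sigma> ^ ?n) * (\<integral>\<xi>. (\<integral>x. c x *\<^sub>R iexp ((\<xi> /\<^sub>R \<sigma>) \<bullet> x) \<partial>lborel) * iexp (((- inverse \<sigma>) *\<^sub>R \<xi>) \<bullet> y) \<partial>gauss_measure)"
    by simp
  also have "\<dots> = (\<integral>\<xi>. w \<xi> * iexp (((- inverse \<sigma>) *\<^sub>R \<xi>) \<bullet> y) \<partial>gauss_measure)"
    unfolding w_def by (simp only: mult.assoc integral_mult_right_zero)
  finally show "complex_of_real (\<integral>z. c (y + \<sigma> *\<^sub>R z) \<partial>gauss_measure) =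
      (\<integral>\<xi>. w \<xi> * iexp (((- inverse \<sigma>) *\<^sub>R \<xi>) \<bullet> y) \<partial>gauss_measure)"
    unfolding 1 by (simp only: of_real_divide)
qed

context pure_jump_family
begin

text \<open>Averaging over translates preserves \<open>\<kappa>\<close>, so
  \<open>f_expansion\<close> gives the same bound for every mollification. Continuity of
  \<open>c\<close> yields pointwise convergence, and dominated convergence passes to the limit under
  both \<open>M\<close> and \<open>\<nu>\<close>.\<close>

lemma lipschitz_expansion:
  fixes c :: "'a \<Rightarrow> real"
  assumes c: "integrable lborel c" and lip: "\<And>x y. \<bar>c x - c y\<bar> \<le> \<kappa> * min 1 (norm (x - y))"
    and t: "0 \<le> t" and \<delta>: "norm b \<le> \<delta>" "0 < \<delta>"
    and prob: "\<And>s. s \<in> {0..t} \<Longrightarrow> prob {\<omega>\<in>space M. \<delta> < norm (Y s \<omega>)} \<le> \<eta>"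
  shows "\<bar>(\<integral>\<omega>. c (Y t \<omega> + b) \<partial>M) - c b - t * (\<integral>y. c y - c 0 \<partial>\<nu>)\<bar>
    \<le> t * (2 * \<kappa> * (truncated_mass (2 * \<delta>) + mass * \<eta>))"
proof -
  interpret N: prob_space "gauss_measure :: 'a measure" by (rule prob_space_gauss_measure)
  define K where "K = \<bar>c 0\<bar> + \<kappa>"
  define cs where "cs k y = (\<integral>z. c (y + inverse (real (Suc k)) *\<^sub>R z) \<partial>gauss_measure)" for k y
  note [measurable] = Y_measurable[OF t]
  have \<kappa>: "0 \<le> \<kappa>" by (rule truncated_lipschitz(1)[of c]) (use lip in simp)
  have [measurable]: "c \<in> borel_measurable borel" using c by auto
  have c_le: "\<bar>c x\<bar> \<le> K" for x
  proof -
    have "\<kappa> * min 1 (norm (x - 0)) \<le> \<kappa> * 1" using \<kappa> by (intro mult_left_mono) auto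
    then show ?thesis using lip[of x 0] by (simp add: K_def)
  qed
  have ci: "integrable gauss_measure (\<lambda>z. c (y + r *\<^sub>R z))" for y r
    by (rule N.integrable_const_bound[where B=K]) (auto simp: c_le)
  have cs_le: "\<bar>cs k y\<bar> \<le> K" for k y
  proof -
    have "\<bar>cs k y\<bar> \<le> (\<integral>z. \<bar>c (y + inverse (real (Suc k)) *\<^sub>R z)\<bar> \<partial>gauss_measure)"
      unfolding cs_def by (rule integral_abs_bound)
    also have "\<dots> \<le> (\<integral>z. K \<partial>(gauss_measure :: 'a measure))"
      by (intro integral_mono integrable_abs ci) (auto simp: c_le)
    finally show ?thesis using N.prob_space by simp
  qed
  have cs_lip: "\<bar>cs k x - cs k y\<bar> \<le> \<kappa> * min 1 (norm (x - y))" for k x y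
  proof -
    have "cs k x - cs k y = (\<integral>z. c (x + inverse (real (Suc k)) *\<^sub>R z) - c (y + inverse (real (Suc k)) *\<^sub>R z) \<partial>gauss_measure)"
      unfolding cs_def by (intro Bochner_Integration.integral_diff[symmetric] ci)
    also have "\<bar>\<dots>\<bar> \<le> (\<integral>z. \<bar>c (x + inverse (real (Suc k)) *\<^sub>R z) - c (y + inverse (real (Suc k)) *\<^sub>R z)\<bar> \<partial>gauss_measure)"
      by (rule integral_abs_bound)
    also have "\<dots> \<le> (\<integral>z. \<kappa> * min 1 (norm (x - y)) \<partial>(gauss_measure :: 'a measure))"
    proof (intro integral_mono integrable_abs Bochner_Integration.integrable_diff ci)
      show "\<bar>c (x + inverse (real (Suc k)) *\<^sub>R z) - c (y + inverse (real (Suc k)) *\<^sub>R z)\<bar> \<le> \<kappa> * min 1 (norm (x - y))" for z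
        using lip[of "x + inverse (real (Suc k)) *\<^sub>R z" "y + inverse (real (Suc k)) *\<^sub>R z"] by simp
    qed simp
    finally show ?thesis using N.prob_space by simp
  qed
  have cont: "isCont c x" for x
    using truncated_lipschitz(2)[of c \<kappa>] lip by (simp add: continuous_on_eq_continuous_at)
  have cs_lim: "(\<lambda>k. cs k y) \<longlonglongrightarrow> c y" for y
  proof -
    have "(\<lambda>k. cs k y) \<longlonglongrightarrow> (\<integral>z. c y \<partial>(gauss_measure :: 'a measure))"
      unfolding cs_def
    proof (rule integral_dominated_convergence[where w="\<lambda>_. K"])
      show "AE z in gauss_measure. (\<lambda>k. c (y + inverse (real (Suc k)) *\<^sub>R z)) \<longlonglongrightarrow> c y"
      proof (rule AE_I2)
        fix z
        have "(\<lambda>k. y + inverse (real (Suc k)) *\<^sub>R z) \<longlonglongrightarrow> y + 0 *\<^sub>R z"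
          by (intro tendsto_intros LIMSEQ_inverse_real_of_nat)
        then show "(\<lambda>k. c (y + inverse (real (Suc k)) *\<^sub>R z)) \<longlonglongrightarrow> c y"
          using isCont_tendsto_compose[OF cont[of y]] by simp
      qed
    qed (auto simp: c_le)
    then show ?thesis using N.prob_space by simp
  qed
  have meas_cs[measurable]: "cs k \<in> borel_measurable borel" for k
    unfolding cs_def by (rule N.borel_measurable_lebesgue_integral) (simp add: split_beta')
  have bound: "\<bar>(\<integral>\<omega>. cs k (Y t \<omega> + b) \<partial>M) - cs k b - t * (\<integral>y. cs k y - cs k 0 \<partial>\<nu>)\<bar>
    \<le> t * (2 * \<kappa> * (truncated_mass (2 * \<delta>) + mass * \<eta>))" for k
  proof -
    define \<sigma> where "\<sigma> = inverse (real (Suc k))"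
    have \<sigma>: "0 < \<sigma>" by (simp add: \<sigma>_def)
    define w where "w \<xi> = complex_of_real ((1 / sqrt (2 * pi)) ^ DIM('a) / \<sigma> ^ DIM('a)) *
      (\<integral>x. c x *\<^sub>R iexp ((\<xi> /\<^sub>R \<sigma>) \<bullet> x) \<partial>lborel)" for \<xi>
    note smoothing = gauss_smoothing_fourier[OF c \<sigma>, folded w_def]
    \<comment> \<open>The bound on \<open>w\<close> supplied here contains
      \<open>\<sigma> ^ DIM('a)\<close> in the denominator and degenerates as \<open>k\<close>
      grows; the estimate of \<open>f_expansion\<close> is nevertheless uniform, as it sees only
      \<open>\<kappa>\<close>.\<close>
    interpret F: fourier_test \<nu> M Y w "(1 / sqrt (2 * pi)) ^ DIM('a) / \<sigma> ^ DIM('a) * (\<integral>x. \<bar>c x\<bar> \<partial>lborel)" "- inverse \<sigma>" b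
      by standard (rule smoothing)+
    have f: "F.f y = complex_of_real (cs k y)" for y
      unfolding F.f_def cs_def using smoothing(1)[of y] by (simp only: \<sigma>_def)
    have "cmod (F.f x - F.f y) \<le> \<kappa> * min 1 (norm (x - y))" for x y
      using cs_lip[of k x y] unfolding f by (simp only: norm_of_real flip: of_real_diff)
    from F.f_expansion[OF this t \<delta> prob]
    have "cmod ((\<integral>\<omega>. complex_of_real (cs k (Y t \<omega> + b)) \<partial>M) - complex_of_real (cs k b) - t *\<^sub>R (\<integral>y. complex_of_real (cs k y - cs k 0) \<partial>\<nu>))
      \<le> t * (2 * \<kappa> * (truncated_mass (2 * \<delta>) + mass * \<eta>))"
      unfolding f of_real_diff by blast
    then show ?thesis
      unfolding integral_complex_of_real scaleR_conv_of_real of_real_diff[symmetric] of_real_mult[symmetric] norm_of_real .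
  qed
  have "(\<lambda>k. \<integral>\<omega>. cs k (Y t \<omega> + b) \<partial>M) \<longlonglongrightarrow> (\<integral>\<omega>. c (Y t \<omega> + b) \<partial>M)"
    by (rule integral_dominated_convergence[where w="\<lambda>_. K"]) (auto simp: cs_lim cs_le)
  \<comment> \<open>Since \<open>\<nu>\<close> may be infinite, a constant majorant would not do;
    the Lipschitz bound on the increments from 0 provides one.\<close>
  moreover have "(\<lambda>k. \<integral>y. cs k y - cs k 0 \<partial>\<nu>) \<longlonglongrightarrow> (\<integral>y. c y - c 0 \<partial>\<nu>)"
  proof (rule integral_dominated_convergence[where w="\<lambda>y. \<kappa> * min 1 (norm y)"])
    show "integrable \<nu> (\<lambda>y. \<kappa> * min 1 (norm y))" using integrable_min by simp
    show "AE y in \<nu>. norm (cs k y - cs k 0) \<le> \<kappa> * min 1 (norm y)" for k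
      using cs_lip[of k _ 0] by simp
  qed (auto intro!: tendsto_diff cs_lim)
  ultimately have "(\<lambda>k. \<bar>(\<integral>\<omega>. cs k (Y t \<omega> + b) \<partial>M) - cs k b - t * (\<integral>y. cs k y - cs k 0 \<partial>\<nu>)\<bar>)
    \<longlonglongrightarrow> \<bar>(\<integral>\<omega>. c (Y t \<omega> + b) \<partial>M) - c b - t * (\<integral>y. c y - c 0 \<partial>\<nu>)\<bar>"
    by (intro tendsto_intros cs_lim)
  then show ?thesis by (rule LIMSEQ_le_const2) (use bound in auto)
qed

end

context finite_variation_levy_measure
begin

text \<open>Dominated convergence along \<open>r = 1 / (k + 1)\<close> with majorant
  \<open>min 1 (norm y)\<close>; \<open>\<delta>\<close> is half of such an
  \<open>r\<close>.\<close>

lemma truncated_mass_small: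
  assumes "0 < e" obtains \<delta> where "0 < \<delta>" "truncated_mass (2 * \<delta>) < e"
proof -
  have "(\<lambda>k. truncated_mass (inverse (real (Suc k)))) \<longlonglongrightarrow> (\<integral>y. 0 \<partial>\<nu>)"
    unfolding truncated_mass_def
  proof (rule integral_dominated_convergence[where w="\<lambda>y. min 1 (norm y)"])
    show "AE y in \<nu>. (\<lambda>k. min 1 (min (norm y) (inverse (real (Suc k))))) \<longlonglongrightarrow> 0"
    proof (rule AE_I2)
      fix y :: 'a
      have "(\<lambda>k. min 1 (min (norm y) (inverse (real (Suc k))))) \<longlonglongrightarrow> min 1 (min (norm y) 0)"
        by (intro tendsto_min tendsto_const LIMSEQ_inverse_real_of_nat)
      then show "(\<lambda>k. min 1 (min (norm y) (inverse (real (Suc k))))) \<longlonglongrightarrow> 0" by simp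
    qed
  qed (auto intro: integrable_min)
  then have "\<forall>\<^sub>F k in sequentially. truncated_mass (inverse (real (Suc k))) < e"
    using assms by (intro order_tendstoD(2)) auto
  then obtain k where "truncated_mass (inverse (real (Suc k))) < e"
    by (auto simp: eventually_sequentially)
  then show thesis by (intro that[of "inverse (real (Suc k)) / 2"]) auto
qed

end

text \<open>\<open>lipschitz_expansion\<close> with the moving shift
  \<open>b = - t *\<^sub>R g\<close>: convergence in probability makes \<open>\<eta>\<close> small,
  and for small \<open>t\<close> the shift is within \<open>\<delta>\<close>.\<close>

lemma (in pure_jump_family) small_time_limit:
  fixes c :: "'a \<Rightarrow> real"
  assumes c: "integrable lborel c" and lip: "\<And>x y. \<bar>c x - c y\<bar> \<le> \<kappa> * min 1 (norm (x - y))"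
    and Y0: "AE \<omega> in M. Y 0 \<omega> = 0"
    and prob: "\<And>\<delta>. 0 < \<delta> \<Longrightarrow> ((\<lambda>s. prob {\<omega>\<in>space M. \<delta> < norm (Y s \<omega>)}) \<longlongrightarrow> 0) (at_right 0)"
  shows "((\<lambda>t. ((\<integral>\<omega>. c (Y t \<omega> - t *\<^sub>R g) \<partial>M) - c (- t *\<^sub>R g)) / t) \<longlongrightarrow> (\<integral>y. c y - c 0 \<partial>\<nu>)) (at_right 0)"
proof (rule tendstoI)
  fix e :: real assume e: "0 < e"
  have \<kappa>: "0 \<le> \<kappa>" by (rule truncated_lipschitz(1)[of c]) (use lip in simp)
  \<comment> \<open>Both error terms are kept to at most \<open>e / (4 * (\<kappa> + 1))\<close>, so
    that \<open>2 * \<kappa>\<close> times their sum is below \<open>e\<close>. Adding 1 to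
    \<open>\<kappa>\<close> and to \<open>mass\<close> avoids a zero denominator.\<close>
  obtain \<delta> where \<delta>: "0 < \<delta>" "truncated_mass (2 * \<delta>) < e / (4 * (\<kappa> + 1))"
    using truncated_mass_small[of "e / (4 * (\<kappa> + 1))"] e \<kappa> by auto
  define \<eta> where "\<eta> = e / (4 * (\<kappa> + 1) * (mass + 1))"
  have \<eta>: "0 < \<eta>" using e \<kappa> mass_nonneg by (simp add: \<eta>_def)
  have "\<forall>\<^sub>F s in at_right 0. prob {\<omega>\<in>space M. \<delta> < norm (Y s \<omega>)} < \<eta>"
    using prob[OF \<delta>(1)] \<eta> by (rule order_tendstoD)
  then obtain t0 where t0: "0 < t0" "\<And>s. 0 < s \<Longrightarrow> s < t0 \<Longrightarrow> prob {\<omega>\<in>space M. \<delta> < norm (Y s \<omega>)} < \<eta>"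
    unfolding eventually_at_right_field by auto
  \<comment> \<open>The expansion asks for all times in \<open>{0..t}\<close>, while a right limit
    at 0 says nothing about time 0 itself.\<close>
  have p0: "prob {\<omega>\<in>space M. \<delta> < norm (Y 0 \<omega>)} = 0"
    using Y0 \<delta>(1) by (intro prob_eq_0_AE) auto
  have small: "2 * \<kappa> * (truncated_mass (2 * \<delta>) + mass * \<eta>) < e"
  proof -
    have "mass * \<eta> \<le> (mass + 1) * \<eta>" using \<eta> by simp
    also have "\<dots> = e / (4 * (\<kappa> + 1))" using mass_nonneg by (simp add: \<eta>_def)
    finally have "mass * \<eta> \<le> e / (4 * (\<kappa> + 1))" .
    moreover have "e / (4 * (\<kappa> + 1)) + e / (4 * (\<kappa> + 1)) = e / (2 * (\<kappa> + 1))"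
      using \<kappa> by (simp add: divide_simps)
    ultimately have "truncated_mass (2 * \<delta>) + mass * \<eta> < e / (2 * (\<kappa> + 1))"
      using add_less_le_mono[OF \<delta>(2)] by metis
    then have "2 * \<kappa> * (truncated_mass (2 * \<delta>) + mass * \<eta>) \<le> 2 * \<kappa> * (e / (2 * (\<kappa> + 1)))"
      using \<kappa> by (intro mult_left_mono) auto
    also have "\<dots> < e" using \<kappa> e by (simp add: field_simps)
    finally show ?thesis .
  qed
  \<comment> \<open>The second bound keeps \<open>norm (t *\<^sub>R g)\<close> within
    \<open>\<delta>\<close>; its denominator is positive also for \<open>g = 0\<close>.\<close>
  define t1 where "t1 = min t0 (\<delta> / (norm g + 1))"
  have "0 < t1" using t0(1) \<delta>(1) by (simp add: t1_def add_nonneg_pos)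
  moreover have "dist (((\<integral>\<omega>. c (Y t \<omega> - t *\<^sub>R g) \<partial>M) - c (- t *\<^sub>R g)) / t) (\<integral>y. c y - c 0 \<partial>\<nu>) < e"
    if t: "0 < t" "t < t1" for t
  proof -
    have "0 < norm g + 1" by (simp add: add_nonneg_pos)
    moreover have "t < \<delta> / (norm g + 1)" using t by (simp add: t1_def)
    ultimately have "t * (norm g + 1) < \<delta>" by (simp only: pos_less_divide_eq)
    then have "t * norm g \<le> \<delta>" using t by (simp add: distrib_left)
    then have b: "norm (- t *\<^sub>R g) \<le> \<delta>" using t by simp
    have "prob {\<omega>\<in>space M. \<delta> < norm (Y s \<omega>)} \<le> \<eta>" if "s \<in> {0..t}" for s
      using that t0(2)[of s] t p0 \<eta> by (cases "s = 0") (auto simp: t1_def intro: less_imp_le)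
    then have "\<bar>(\<integral>\<omega>. c (Y t \<omega> + - t *\<^sub>R g) \<partial>M) - c (- t *\<^sub>R g) - t * (\<integral>y. c y - c 0 \<partial>\<nu>)\<bar>
      \<le> t * (2 * \<kappa> * (truncated_mass (2 * \<delta>) + mass * \<eta>))"
      using t by (intro lipschitz_expansion[OF c lip _ b \<delta>(1)]) auto
    also have "\<dots> < t * e" using small t by (intro mult_strict_left_mono) auto
    finally have "\<bar>(\<integral>\<omega>. c (Y t \<omega> - t *\<^sub>R g) \<partial>M) - c (- t *\<^sub>R g) - t * (\<integral>y. c y - c 0 \<partial>\<nu>)\<bar> / t < e"
      using t by (simp add: divide_less_eq mult.commute)
    also have "\<bar>(\<integral>\<omega>. c (Y t \<omega> - t *\<^sub>R g) \<partial>M) - c (- t *\<^sub>R g) - t * (\<integral>y. c y - c 0 \<partial>\<nu>)\<bar> / t =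
      \<bar>((\<integral>\<omega>. c (Y t \<omega> - t *\<^sub>R g) \<partial>M) - c (- t *\<^sub>R g)) / t - (\<integral>y. c y - c 0 \<partial>\<nu>)\<bar>"
    proof -
      have "((\<integral>\<omega>. c (Y t \<omega> - t *\<^sub>R g) \<partial>M) - c (- t *\<^sub>R g)) / t - (\<integral>y. c y - c 0 \<partial>\<nu>) =
        ((\<integral>\<omega>. c (Y t \<omega> - t *\<^sub>R g) \<partial>M) - c (- t *\<^sub>R g) - t * (\<integral>y. c y - c 0 \<partial>\<nu>)) / t"
        using t by (simp add: diff_divide_distrib)
      then show ?thesis using t by (simp only: abs_divide abs_of_pos)
    qed
    finally show ?thesis by (simp add: dist_real_def)
  qed
  ultimately show "\<forall>\<^sub>F t in at_right 0. dist (((\<integral>\<omega>. c (Y t \<omega> - t *\<^sub>R g) \<partial>M) - c (- t *\<^sub>R g)) / t) (\<integral>y. c y - c 0 \<partial>\<nu>) < e"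
    unfolding eventually_at_right_field by (intro exI[of _ t1]) auto
qed

section \<open>Integrability of the jumps from finite variation of the paths\<close>

text \<open>Passes from the truncated norm to \<open>exp (- x)\<close>, which turns sums of
  independent increments into products.\<close>

lemma min_one_le_exp: "0 \<le> x \<Longrightarrow> min 1 x \<le> 2 * (1 - exp (- x))" for x :: real
proof -
  assume x: "0 \<le> x"
  have "exp (- x) \<le> 1 / (1 + x)"
    using exp_ge_add_one_self[of x] x by (simp add: exp_minus divide_inverse le_imp_inverse_le)
  also have "1 / (1 + x) \<le> 1 - min 1 x / 2"
    using x by (cases "x \<le> 1") (auto simp: min_def field_simps mult_left_le)
  finally show ?thesis by simp
qed

text \<open>The variation sums along \<open>n\<close> steps of length \<open>1 / n\<close> satisfy
  \<open>E exp (- S n) = a n ^ n\<close>. Finite variation bounds them pathwise in \<open>n\<close>,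
  so \<open>a n ^ n\<close> stays above some positive \<open>p\<close>, and taking logarithms gives
  \<open>n * (1 - a n) \<le> - ln p\<close>.\<close>

lemma (in levy_process) variation_bound:
  assumes "finite_variation_process M X"
  obtains B where "\<And>n::nat. 0 < n \<Longrightarrow> real n * (\<integral>\<omega>. min 1 (norm (X (1 / n) \<omega>)) \<partial>M) \<le> B"
proof -
  \<comment> \<open>The grid runs from 1/2 to 3/2, away from 0, because path variation is controlled
    on open intervals \<open>{0<..<t}\<close>; the interval \<open>{0<..<2}\<close> contains every
    such grid.\<close>
  define s :: "nat \<Rightarrow> nat \<Rightarrow> real" where "s n i = 1 / 2 + real i / real n" for n i
  define D where "D n i \<omega> = X (s n (Suc i)) \<omega> - X (s n i) \<omega>" for n i \<omega>
  define S where "S n \<omega> = (\<Sum>i<n. norm (D n i \<omega>))" for n \<omega>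
  define a where "a n = (\<integral>\<omega>. exp (- norm (X (1 / real n) \<omega>)) \<partial>M)" for n :: nat
  have s_nonneg: "0 \<le> s n i" for n i by (simp add: s_def)
  have D_meas[measurable]: "D n i \<in> borel_measurable M" for n i
    unfolding D_def using random_variables s_nonneg by (intro borel_measurable_diff) auto
  have S_meas[measurable]: "S n \<in> borel_measurable M" for n unfolding S_def by measurable
  have X_meas[measurable]: "X (1 / real n) \<in> borel_measurable M" for n
    by (rule random_variables) simp
  have D_law: "(\<integral>\<omega>. exp (- norm (D n i \<omega>)) \<partial>M) = a n" if "0 < n" for n i
  proof -
    have X0[measurable]: "X 0 \<in> borel_measurable M" by (rule random_variables) simp
    have s_Suc: "s n (Suc i) = s n i + 1 / real n" by (simp add: s_def add_divide_distrib)
    have "(\<integral>\<omega>. exp (- norm (D n i \<omega>)) \<partial>M) = (\<integral>x. exp (- norm x) \<partial>distr M borel (D n i))"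
      by (subst integral_distr) auto
    also have "distr M borel (D n i) = distr M borel (\<lambda>\<omega>. X (1 / real n) \<omega> - X 0 \<omega>)"
      using stationary_increments[OF s_nonneg, of "1 / real n" n i] by (simp add: D_def[abs_def] s_Suc)
    also have "(\<integral>x. exp (- norm x) \<partial>\<dots>) = (\<integral>\<omega>. exp (- norm (X (1 / real n) \<omega> - X 0 \<omega>)) \<partial>M)"
      by (subst integral_distr) auto
    also have "\<dots> = a n"
      unfolding a_def by (rule integral_cong_AE) (use starts_at_0 in auto)
    finally show ?thesis .
  qed
  have E_S: "(\<integral>\<omega>. exp (- S n \<omega>) \<partial>M) = a n ^ n" if n: "0 < n" for n
  proof -
    have "indep_vars (\<lambda>_. borel) (D n) {..<n}"
      unfolding D_def[abs_def] by (rule independent_increments) (use n in \<open>auto simp: s_def divide_strict_right_mono\<close>)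
    then have "indep_vars (\<lambda>_. borel) (\<lambda>i \<omega>. exp (- norm (D n i \<omega>))) {..<n}"
      by (rule indep_vars_compose2[where Y="\<lambda>_ x. exp (- norm x)"]) auto
    moreover have "integrable M (\<lambda>\<omega>. exp (- norm (D n i \<omega>)))" for i
      by (rule integrable_const_bound[where B=1]) auto
    ultimately
    have "(\<integral>\<omega>. (\<Prod>i<n. exp (- norm (D n i \<omega>))) \<partial>M) = (\<Prod>i<n. \<integral>\<omega>. exp (- norm (D n i \<omega>)) \<partial>M)"
      by (intro indep_vars_lebesgue_integral) auto
    then show ?thesis by (simp add: S_def exp_sum[symmetric] sum_negf D_law[OF n])
  qed
  \<comment> \<open>A lower bound common to all \<open>n\<close>: an infimum of countably many
    variables is measurable, and it is positive on every path whose sums \<open>S n\<close> are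
    bounded in \<open>n\<close>.\<close>
  define g where "g \<omega> = (INF n. ennreal (exp (- S n \<omega>)))" for \<omega>
  have g_meas[measurable]: "g \<in> borel_measurable M" unfolding g_def by measurable
  have g_pos: "AE \<omega> in M. 0 < g \<omega>"
    using assms unfolding finite_variation_process_def
  proof eventually_elim
    case (elim \<omega>)
    then have "bounded_variation_on {0<..<2} (\<lambda>s. X s \<omega>)" by auto
    then obtain B where B: "\<And>n s. (\<forall>i\<le>n. s i \<in> {0<..<2}) \<Longrightarrow> (\<forall>i<n. s i \<le> s (Suc i)) \<Longrightarrow>
        (\<Sum>i<n. norm (X (s (Suc i)) \<omega> - X (s i) \<omega>)) \<le> B"
      unfolding bounded_variation_on_def by blast
    have "S n \<omega> \<le> B" for n
      unfolding S_def D_def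
    proof (rule B; intro allI impI)
      fix i assume "i \<le> n"
      then have "real i / real n \<le> 1" by (cases "n = 0") auto
      moreover have "0 \<le> real i / real n" by simp
      ultimately show "s n i \<in> {0<..<2}" unfolding s_def greaterThanLessThan_iff by linarith
    qed (auto simp: s_def divide_right_mono)
    then have "ennreal (exp (- B)) \<le> g \<omega>"
      unfolding g_def by (intro INF_greatest ennreal_leI) simp
    then show ?case by (rule less_le_trans[rotated]) simp
  qed
  define P where "P = (\<integral>\<^sup>+\<omega>. g \<omega> \<partial>M)"
  have P_le: "P \<le> ennreal (a n ^ n)" if "0 < n" for n
  proof -
    have "P \<le> (\<integral>\<^sup>+\<omega>. ennreal (exp (- S n \<omega>)) \<partial>M)"
      unfolding P_def g_def by (intro nn_integral_mono INF_lower) auto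
    also have "\<dots> = ennreal (a n ^ n)"
      using E_S[OF that] by (subst nn_integral_eq_integral)
        (auto intro!: integrable_const_bound[where B=1] simp: S_def sum_nonneg)
    finally show ?thesis .
  qed
  have "P \<noteq> 0"
  proof
    assume "P = 0"
    then have "AE \<omega> in M. g \<omega> = 0" unfolding P_def by (subst (asm) nn_integral_0_iff_AE) auto
    with g_pos have "AE \<omega> in M. False" by eventually_elim simp
    then show False by simp
  qed
  define p where "p = enn2real P"
  have "P < top" using P_le[of 1] by (auto intro: le_less_trans)
  then have p: "0 < p" "P = ennreal p"
    using \<open>P \<noteq> 0\<close> by (auto simp: p_def enn2real_positive_iff zero_less_iff_neq_zero)
  have "real n * (\<integral>\<omega>. min 1 (norm (X (1 / n) \<omega>)) \<partial>M) \<le> 2 * - ln p" if n: "0 < n" for n :: nat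
  proof -
    have a0: "0 \<le> a n" unfolding a_def by simp
    have pa: "p \<le> a n ^ n"
      using P_le[OF n] a0 unfolding p(2) by simp
    have "a n \<noteq> 0" using pa p n by (auto simp: power_0_left)
    with a0 have apos: "0 < a n" by simp
    have "ln p \<le> ln (a n ^ n)" using pa p apos by simp
    also have "\<dots> = real n * ln (a n)" using apos by (simp add: ln_realpow)
    also have "\<dots> \<le> real n * (a n - 1)" using ln_le_minus_one[OF apos] by (intro mult_left_mono) auto
    finally have 1: "real n * (1 - a n) \<le> - ln p" by (simp add: algebra_simps)
    have int: "integrable M (\<lambda>\<omega>. exp (- norm (X (1 / real n) \<omega>)))"
      by (rule integrable_const_bound[where B=1]) auto
    have "(\<integral>\<omega>. min 1 (norm (X (1 / n) \<omega>)) \<partial>M) \<le> (\<integral>\<omega>. 2 * (1 - exp (- norm (X (1 / n) \<omega>))) \<partial>M)"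
    proof (rule integral_mono)
      show "integrable M (\<lambda>\<omega>. min 1 (norm (X (1 / n) \<omega>)))"
        by (rule integrable_const_bound[where B=1]) auto
      show "integrable M (\<lambda>\<omega>. 2 * (1 - exp (- norm (X (1 / n) \<omega>))))" using int by simp
    qed (rule min_one_le_exp, simp)
    also have "\<dots> = 2 * (1 - a n)" using int by (simp add: a_def prob_space)
    finally have "real n * (\<integral>\<omega>. min 1 (norm (X (1 / n) \<omega>)) \<partial>M) \<le> real n * (2 * (1 - a n))"
      by (rule mult_left_mono) simp
    also have "\<dots> = 2 * (real n * (1 - a n))" by simp
    also have "\<dots> \<le> 2 * - ln p" using 1 by (intro mult_left_mono) auto
    finally show ?thesis .
  qed
  then show thesis by (rule that)
qed

section \<open>Dyadic cosine sums\<close>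

definition dyadic_osc :: "nat \<Rightarrow> real \<Rightarrow> real" where
  "dyadic_osc N u = (\<Sum>k<N. (1 - cos (2 ^ k * u)) / 2 ^ k)"

text \<open>Splitting off the term \<open>k = 0\<close> and shifting the index shows the
  self-similarity under \<open>u \<mapsto> 2 * u\<close> on which the upper bounds rest.\<close>

lemma dyadic_osc_Suc: "dyadic_osc (Suc N) u = (1 - cos u) + dyadic_osc N (2 * u) / 2"
  unfolding dyadic_osc_def
  by (subst sum.lessThan_Suc_shift) (simp add: sum_divide_distrib mult_ac)

lemma dyadic_osc_mono: "dyadic_osc N u \<le> dyadic_osc (Suc N) u"
  by (simp add: dyadic_osc_def)

text \<open>The recursion halves the old bound and adds at most 2, and 4 is the fixed point of
  \<open>a \<mapsto> 2 + a / 2\<close>.\<close>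

lemma dyadic_osc_le_4: "dyadic_osc N u \<le> 4"
proof (induction N arbitrary: u)
  case (Suc N)
  have "1 - cos u \<le> 2" using cos_ge_minus_one[of u] by linarith
  with Suc[of "2 * u"] show ?case unfolding dyadic_osc_Suc by linarith
qed (simp add: dyadic_osc_def)

lemma one_minus_cos_le: "1 - cos u \<le> u\<^sup>2 / 2" for u :: real
proof -
  have "1 - cos u = 2 * (sin (u / 2))\<^sup>2" using cos_double_sin[of "u / 2"] by simp
  also have "(sin (u / 2))\<^sup>2 \<le> (u / 2)\<^sup>2"
    by (rule abs_le_square_iff[THEN iffD1, OF abs_sin_x_le_abs_x])
  finally show ?thesis by (simp add: power2_eq_square)
qed

text \<open>The correction \<open>- u\<^sup>2 / 2\<close> is what makes the recursion \<open>dyadic_osc_Suc\<close> close under induction.\<close>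

lemma dyadic_osc_le_abs: "\<bar>u\<bar> \<le> 1 \<Longrightarrow> dyadic_osc N u \<le> 9 * \<bar>u\<bar> - u\<^sup>2 / 2"
proof (induction N arbitrary: u)
  case 0
  then have "\<bar>u\<bar> * \<bar>u\<bar> \<le> \<bar>u\<bar> * 1" by (intro mult_left_mono) auto
  then show ?case by (simp add: dyadic_osc_def power2_eq_square)
next
  case (Suc N)
  show ?case
  proof (cases "\<bar>u\<bar> \<le> 1 / 2")
    case True
    \<comment> \<open>The recursion reproduces the bound exactly: \<open>u\<^sup>2 / 2 + (18 *
      \<bar>u\<bar> - 2 * u\<^sup>2) / 2 = 9 * \<bar>u\<bar> - u\<^sup>2 / 2\<close>.\<close>
    then have "dyadic_osc N (2 * u) \<le> 9 * \<bar>2 * u\<bar> - (2 * u)\<^sup>2 / 2" by (intro Suc.IH) auto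
    with one_minus_cos_le[of u] show ?thesis
      by (simp add: dyadic_osc_Suc abs_mult power2_eq_square)
  next
    case False
    \<comment> \<open>For \<open>1 / 2 < \<bar>u\<bar> \<le> 1\<close> the right side is at least
      \<open>17 / 2 * \<bar>u\<bar>\<close>, which exceeds the crude bound 4; the constant 9 leaves
      room for this.\<close>
    have "\<bar>u\<bar> * \<bar>u\<bar> \<le> 1 * \<bar>u\<bar>" using Suc.prems by (intro mult_right_mono) auto
    with False have "4 \<le> 9 * \<bar>u\<bar> - u\<^sup>2 / 2" by (simp add: power2_eq_square)
    then show ?thesis using dyadic_osc_le_4[of "Suc N" u] by linarith
  qed
qed

lemma dyadic_osc_le: "dyadic_osc N u \<le> 9 * min 1 \<bar>u\<bar>"
proof (cases "\<bar>u\<bar> \<le> 1")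
  case True
  then have "dyadic_osc N u \<le> 9 * \<bar>u\<bar>"
    using dyadic_osc_le_abs[of u N] zero_le_power2[of u] by linarith
  with True show ?thesis by simp
next
  case False
  with dyadic_osc_le_4[of N u] show ?thesis by simp
qed

lemma dyadic_osc_nonneg: "0 \<le> dyadic_osc N u"
  unfolding dyadic_osc_def by (intro sum_nonneg) simp

text \<open>One term suffices. For the least \<open>k\<close> with
  \<open>1 < 2 ^ k * \<bar>u\<bar>\<close> this product lies in (1, 2], where the cosine is at most
  \<open>cos 1\<close>, and the weight \<open>1 / 2 ^ k\<close> is at least
  \<open>\<bar>u\<bar> / 2\<close>.\<close>

lemma dyadic_osc_ge:
  assumes "\<bar>u\<bar> \<le> 1"
  shows "\<exists>N. (1 - cos 1) / 2 * \<bar>u\<bar> \<le> dyadic_osc N u"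
proof (cases "u = 0")
  case False
  define k where "k = (LEAST k. 1 < 2 ^ k * \<bar>u\<bar>)"
  obtain k0 :: nat where "1 / \<bar>u\<bar> < 2 ^ k0" using real_arch_pow[of 2] by auto
  then have "\<exists>k. 1 < 2 ^ k * \<bar>u\<bar>" using False by (auto simp: field_simps)
  then have k: "1 < 2 ^ k * \<bar>u\<bar>" unfolding k_def by (rule LeastI_ex)
  have k2: "2 ^ k * \<bar>u\<bar> \<le> 2"
  proof (cases k)
    case 0 then show ?thesis using assms by simp
  next
    case (Suc j)
    then have "\<not> 1 < 2 ^ j * \<bar>u\<bar>" using not_less_Least[of j "\<lambda>k. 1 < 2 ^ k * \<bar>u\<bar>"] by (simp add: k_def)
    then show ?thesis using Suc by simp
  qed
  have "cos (2 ^ k * \<bar>u\<bar>) \<le> cos 1" using k k2 pi_gt3 by (intro cos_monotone_0_pi_le) auto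
  moreover have "cos (2 ^ k * \<bar>u\<bar>) = cos (2 ^ k * u)" by (cases "0 \<le> u") auto
  ultimately have "(1 - cos 1) / 2 ^ k \<le> (1 - cos (2 ^ k * u)) / 2 ^ k" by (simp add: divide_right_mono)
  also have "\<dots> \<le> dyadic_osc (Suc k) u"
    unfolding dyadic_osc_def by (rule member_le_sum) auto
  finally have 1: "(1 - cos 1) / 2 ^ k \<le> dyadic_osc (Suc k) u" .
  have "\<bar>u\<bar> / 2 \<le> 1 / 2 ^ k" using k2 by (simp add: field_simps)
  then have "(1 - cos 1) * (\<bar>u\<bar> / 2) \<le> (1 - cos 1) * (1 / 2 ^ k)" by (intro mult_left_mono) auto
  also have "\<dots> \<le> dyadic_osc (Suc k) u" using 1 by simp
  finally show ?thesis by (intro exI[of _ "Suc k"]) simp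
qed (auto simp: dyadic_osc_def)

section \<open>The real part of the exponent and its growth\<close>

lemma levy_measure_integrable_square:
  assumes "levy_measure \<nu>" shows "integrable \<nu> (\<lambda>y. min 1 ((norm y)\<^sup>2))"
proof (rule integrableI_nonneg)
  have [measurable_cong]: "sets \<nu> = sets borel" using assms by (simp add: levy_measure_def)
  show "(\<lambda>y. min 1 ((norm y)\<^sup>2)) \<in> borel_measurable \<nu>" by measurable
qed (use assms in \<open>auto simp: levy_measure_def\<close>)

lemma levy_integrand_le:
  fixes x y :: "'a::real_inner"
  shows "cmod (iexp (x \<bullet> y) - 1 - \<i> * of_real (x \<bullet> y) * indicator {y. norm y \<le> 1} y)
    \<le> (2 + (norm x)\<^sup>2) * min 1 ((norm y)\<^sup>2)"
proof (cases "norm y \<le> 1")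
  case True
  have "cmod (iexp (x \<bullet> y) - 1 - \<i> * of_real (x \<bullet> y)) \<le> (x \<bullet> y)\<^sup>2 / 2"
    using iexp_approx1[of "x \<bullet> y" 1] by (simp add: numeral_2_eq_2 diff_diff_eq)
  also have "\<dots> \<le> (norm x * norm y)\<^sup>2 / 2"
    using Cauchy_Schwarz_ineq2[of x y] by (simp add: abs_le_square_iff[symmetric] abs_mult)
  also have "\<dots> \<le> (2 + (norm x)\<^sup>2) * (norm y)\<^sup>2"
    by (simp add: power_mult_distrib distrib_right)
  finally show ?thesis using True by (simp add: power_le_one)
next
  case False
  have "cmod (iexp (x \<bullet> y) - 1) \<le> 2" using norm_triangle_ineq4[of "iexp (x \<bullet> y)" 1] by simp
  also have "\<dots> \<le> (2 + (norm x)\<^sup>2) * 1" by simp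
  finally show ?thesis using False by (simp add: one_le_power)
qed

text \<open>Drift and compensator are purely imaginary, so only the Gaussian form and the cosine
  part of the jumps survive in the real part.\<close>

lemma
  assumes "levy_measure \<nu>"
  shows integrable_one_minus_cos: "integrable \<nu> (\<lambda>y. 1 - cos (x \<bullet> y))"
    and Re_levy_exponent: "Re (levy_exponent A \<gamma> \<nu> x) = x \<bullet> (A *v x) + (\<integral>y. 1 - cos (x \<bullet> y) \<partial>\<nu>)"
proof -
  let ?f = "\<lambda>y. iexp (x \<bullet> y) - 1 - \<i> * of_real (x \<bullet> y) * indicator {y. norm y \<le> 1} y"
  have sets[measurable_cong]: "sets \<nu> = sets borel" using assms by (simp add: levy_measure_def)
  have [measurable]: "(\<lambda>y. iexp (x \<bullet> y)) \<in> borel_measurable borel"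
    by (intro borel_measurable_continuous_onI continuous_intros)
  have int: "integrable \<nu> ?f"
  proof (rule Bochner_Integration.integrable_bound)
    show "integrable \<nu> (\<lambda>y. (2 + (norm x)\<^sup>2) * min 1 ((norm y)\<^sup>2))"
      using levy_measure_integrable_square[OF assms] by simp
    show "AE y in \<nu>. norm (?f y) \<le> norm ((2 + (norm x)\<^sup>2) * min 1 ((norm y)\<^sup>2))"
      by (intro AE_I2 order_trans[OF levy_integrand_le]) simp
  qed measurable
  have Re: "Re (?f y) = - (1 - cos (x \<bullet> y))" for y by (simp add: Re_exp indicator_def)
  from Bochner_Integration.integrable_minus[OF integrable_Re[OF int]]
  show "integrable \<nu> (\<lambda>y. 1 - cos (x \<bullet> y))"
    unfolding Re minus_minus .
  have "Re (\<integral>y. ?f y \<partial>\<nu>) = - (\<integral>y. 1 - cos (x \<bullet> y) \<partial>\<nu>)"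
    unfolding integral_Re[OF int, symmetric] Re by (rule integral_minus)
  then show "Re (levy_exponent A \<gamma> \<nu> x) = x \<bullet> (A *v x) + (\<integral>y. 1 - cos (x \<bullet> y) \<partial>\<nu>)"
    by (simp add: levy_exponent_def)
qed

text \<open>The derivative of \<open>exp (- (w * z))\<close> at \<open>w = 0\<close>, read along
  \<open>w = 1 / n\<close>.\<close>

lemma exp_rate_limit: "(\<lambda>n. of_nat n * (1 - exp (- (of_real (1 / real n) * z)))) \<longlonglongrightarrow> (z :: complex)"
proof -
  have "((\<lambda>w. exp (- (w * z))) has_field_derivative - z) (at 0)"
    by (auto intro!: derivative_eq_intros)
  then have "((\<lambda>w. (exp (- (w * z)) - 1) / w) \<longlongrightarrow> - z) (at 0)" by (simp add: DERIV_def)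
  moreover have "filterlim (\<lambda>n. complex_of_real (1 / real n)) (at 0) sequentially"
    unfolding filterlim_at
  proof
    show "\<forall>\<^sub>F n in sequentially. complex_of_real (1 / real n) \<in> UNIV \<and> complex_of_real (1 / real n) \<noteq> 0"
      using eventually_gt_at_top[of 0] by eventually_elim auto
    show "(\<lambda>n. complex_of_real (1 / real n)) \<longlonglongrightarrow> 0"
    proof -
      have "(\<lambda>n. complex_of_real (1 / real n)) \<longlonglongrightarrow> complex_of_real 0"
        by (intro tendsto_of_real lim_1_over_n)
      then show ?thesis by simp
    qed
  qed
  ultimately have "(\<lambda>n. (exp (- (of_real (1 / real n) * z)) - 1) / of_real (1 / real n)) \<longlonglongrightarrow> - z"
    by (rule filterlim_compose)
  moreover have "of_nat n * (1 - E) = - ((E - 1) / complex_of_real (1 / real n))" for n E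
    by (simp add: algebra_simps)
  ultimately show ?thesis
    using tendsto_minus by fastforce
qed

lemma Re_of_nat_mult: "Re (of_nat n * z) = real n * Re z"
  by simp

text \<open>The real part of the exponent at \<open>\<zeta>\<close> is the limit of
  \<open>n * E (1 - cos (X (1 / n) \<bullet> \<zeta>))\<close>. Over the dyadic frequencies, with
  weights \<open>1 / 2 ^ k\<close>, these add up to
  \<open>n * E (dyadic_osc N (X (1 / n) \<bullet> \<xi>))\<close>, which
  \<open>dyadic_osc_le\<close> bounds uniformly in \<open>N\<close>.\<close>

lemma (in levy_process) dyadic_exponent_bound:
  assumes triplet: "has_levy_triplet M X A \<gamma> \<nu>"
    and B: "\<And>n::nat. 0 < n \<Longrightarrow> real n * (\<integral>\<omega>. min 1 (norm (X (1 / n) \<omega>)) \<partial>M) \<le> B"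
    and \<xi>: "norm \<xi> \<le> 1"
  shows "(\<Sum>k<N. Re (levy_exponent A \<gamma> \<nu> (2 ^ k *\<^sub>R \<xi>)) / 2 ^ k) \<le> 9 * B"
proof -
  have X_meas[measurable]: "X (1 / real n) \<in> borel_measurable M" for n
    by (rule random_variables) simp
  have char: "(\<integral>\<omega>. iexp (X (1 / real n) \<omega> \<bullet> \<zeta>) \<partial>M) = exp (- (of_real (1 / real n) * levy_exponent A \<gamma> \<nu> \<zeta>))" for n \<zeta>
    using triplet unfolding has_levy_triplet_def by auto
  have int: "integrable M (\<lambda>\<omega>. iexp (X (1 / real n) \<omega> \<bullet> \<zeta>))" for n \<zeta>
  proof (rule integrable_const_bound[where B=1])
    have "(\<lambda>x. iexp (x \<bullet> \<zeta>)) \<in> borel_measurable borel"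
      by (intro borel_measurable_continuous_onI continuous_intros)
    then show "(\<lambda>\<omega>. iexp (X (1 / real n) \<omega> \<bullet> \<zeta>)) \<in> borel_measurable M" by measurable
  qed simp
  have cos_eq: "Re (1 - exp (- (of_real (1 / real n) * levy_exponent A \<gamma> \<nu> \<zeta>))) = (\<integral>\<omega>. 1 - cos (X (1 / real n) \<omega> \<bullet> \<zeta>) \<partial>M)" for n \<zeta>
  proof -
    have "Re (exp (- (of_real (1 / real n) * levy_exponent A \<gamma> \<nu> \<zeta>))) = (\<integral>\<omega>. Re (iexp (X (1 / real n) \<omega> \<bullet> \<zeta>)) \<partial>M)"
      unfolding char[symmetric] by (rule integral_Re[OF int, symmetric])
    moreover have "integrable M (\<lambda>\<omega>. Re (iexp (X (1 / real n) \<omega> \<bullet> \<zeta>)))" by (rule integrable_Re[OF int])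
    ultimately show ?thesis by (simp add: Re_exp prob_space)
  qed
  have "(\<lambda>n. \<Sum>k<N. Re (of_nat n * (1 - exp (- (of_real (1 / real n) * levy_exponent A \<gamma> \<nu> (2 ^ k *\<^sub>R \<xi>))))) / 2 ^ k)
    \<longlonglongrightarrow> (\<Sum>k<N. Re (levy_exponent A \<gamma> \<nu> (2 ^ k *\<^sub>R \<xi>)) / 2 ^ k)"
    by (intro tendsto_sum tendsto_divide tendsto_Re exp_rate_limit tendsto_const) simp
  moreover have "(\<Sum>k<N. Re (of_nat n * (1 - exp (- (of_real (1 / real n) * levy_exponent A \<gamma> \<nu> (2 ^ k *\<^sub>R \<xi>))))) / 2 ^ k) \<le> 9 * B"
    if n: "0 < n" for n
  proof -
    have i: "integrable M (\<lambda>\<omega>. (1 - cos (2 ^ k * (X (1 / real n) \<omega> \<bullet> \<xi>))) / 2 ^ k)" for k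
      by (intro integrable_divide integrable_const_bound[where B=2])
         (auto simp: abs_le_iff intro!: AE_I2 order_trans[OF cos_le_one])
    have "(\<Sum>k<N. Re (of_nat n * (1 - exp (- (of_real (1 / real n) * levy_exponent A \<gamma> \<nu> (2 ^ k *\<^sub>R \<xi>))))) / 2 ^ k)
      = (\<Sum>k<N. real n * (\<integral>\<omega>. (1 - cos (2 ^ k * (X (1 / real n) \<omega> \<bullet> \<xi>))) / 2 ^ k \<partial>M))"
    proof (intro sum.cong refl)
      fix k
      have "Re (of_nat n * (1 - exp (- (of_real (1 / real n) * levy_exponent A \<gamma> \<nu> (2 ^ k *\<^sub>R \<xi>)))))
        = real n * Re (1 - exp (- (of_real (1 / real n) * levy_exponent A \<gamma> \<nu> (2 ^ k *\<^sub>R \<xi>))))"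
        by (rule Re_of_nat_mult)
      then show "Re (of_nat n * (1 - exp (- (of_real (1 / real n) * levy_exponent A \<gamma> \<nu> (2 ^ k *\<^sub>R \<xi>))))) / 2 ^ k
        = real n * (\<integral>\<omega>. (1 - cos (2 ^ k * (X (1 / real n) \<omega> \<bullet> \<xi>))) / 2 ^ k \<partial>M)"
        unfolding cos_eq by simp
    qed
    also have "\<dots> = real n * (\<integral>\<omega>. dyadic_osc N (X (1 / real n) \<omega> \<bullet> \<xi>) \<partial>M)"
      unfolding dyadic_osc_def sum_distrib_left[symmetric] by (subst Bochner_Integration.integral_sum) (auto intro: i)
    also have "\<dots> \<le> real n * (\<integral>\<omega>. 9 * min 1 (norm (X (1 / real n) \<omega>)) \<partial>M)"
    proof (intro mult_left_mono integral_mono)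
      show "integrable M (\<lambda>\<omega>. dyadic_osc N (X (1 / real n) \<omega> \<bullet> \<xi>))"
        unfolding dyadic_osc_def by (intro Bochner_Integration.integrable_sum i)
      show "integrable M (\<lambda>\<omega>. 9 * min 1 (norm (X (1 / real n) \<omega>)))"
        by (intro integrable_mult_right integrable_const_bound[where B=1]) auto
      fix \<omega>
      have "\<bar>X (1 / real n) \<omega> \<bullet> \<xi>\<bar> \<le> norm (X (1 / real n) \<omega>) * norm \<xi>" by (rule Cauchy_Schwarz_ineq2)
      also have "\<dots> \<le> norm (X (1 / real n) \<omega>)" using \<xi> by (simp add: mult_left_le)
      finally show "dyadic_osc N (X (1 / real n) \<omega> \<bullet> \<xi>) \<le> 9 * min 1 (norm (X (1 / real n) \<omega>))"
        using dyadic_osc_le[of N "X (1 / real n) \<omega> \<bullet> \<xi>"] by (simp add: min_def split: if_splits)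
    qed simp
    also have "\<dots> = 9 * (real n * (\<integral>\<omega>. min 1 (norm (X (1 / real n) \<omega>)) \<partial>M))" by simp
    also have "\<dots> \<le> 9 * B" using B[OF n] by simp
    finally show ?thesis .
  qed
  ultimately show ?thesis
    by (intro LIMSEQ_le_const2) (auto intro!: exI[of _ 1])
qed

text \<open>Both claims are read off the bound that is uniform in \<open>N\<close>. The Gaussian
  form is quadratic, so at frequency \<open>2 ^ k\<close> its weighted value is \<open>2 ^ k\<close>
  times the original one and stays bounded only if it is 0. The jump part dominates the first moment
  of each coordinate of the small jumps.\<close>

lemma (in levy_process) finite_variation_triplet:
  assumes triplet: "has_levy_triplet M X A \<gamma> \<nu>" and fv: "finite_variation_process M X"
  shows "\<xi> \<bullet> (A *v \<xi>) = 0" and "integrable \<nu> (\<lambda>y. min 1 (norm y))"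
proof -
  obtain B where B: "\<And>n::nat. 0 < n \<Longrightarrow> real n * (\<integral>\<omega>. min 1 (norm (X (1 / n) \<omega>)) \<partial>M) \<le> B"
    using variation_bound[OF fv] by metis
  note bound = dyadic_exponent_bound[OF triplet B]
  have lm: "levy_measure \<nu>" and A: "\<And>x. 0 \<le> x \<bullet> (A *v x)" using triplet by (auto simp: has_levy_triplet_def)
  have sets[measurable_cong]: "sets \<nu> = sets borel" using lm by (simp add: levy_measure_def)
  have int_nonneg: "0 \<le> (\<integral>y. 1 - cos (x \<bullet> y) \<partial>\<nu>)" for x by (intro integral_nonneg_AE) simp
  have Re_ge: "x \<bullet> (A *v x) \<le> Re (levy_exponent A \<gamma> \<nu> x)" "(\<integral>y. 1 - cos (x \<bullet> y) \<partial>\<nu>) \<le> Re (levy_exponent A \<gamma> \<nu> x)"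
    "0 \<le> Re (levy_exponent A \<gamma> \<nu> x)" for x
    unfolding Re_levy_exponent[OF lm] using int_nonneg[of x] A[of x] by auto
  have unit: "x \<bullet> (A *v x) = 0" if x: "norm x \<le> 1" for x
  proof -
    have "x \<bullet> (A *v x) \<le> 9 * B * inverse (2 ^ k)" for k :: nat
    proof -
      have "Re (levy_exponent A \<gamma> \<nu> (2 ^ k *\<^sub>R x)) / 2 ^ k \<le> (\<Sum>j<Suc k. Re (levy_exponent A \<gamma> \<nu> (2 ^ j *\<^sub>R x)) / 2 ^ j)"
        using Re_ge(3) by (intro member_le_sum[where f="\<lambda>j. Re (levy_exponent A \<gamma> \<nu> (2 ^ j *\<^sub>R x)) / 2 ^ j"]) auto
      also have "\<dots> \<le> 9 * B" by (rule bound[OF _ x])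
      finally have "Re (levy_exponent A \<gamma> \<nu> (2 ^ k *\<^sub>R x)) / 2 ^ k \<le> 9 * B" .
      moreover have "(2 ^ k *\<^sub>R x) \<bullet> (A *v (2 ^ k *\<^sub>R x)) / 2 ^ k \<le> Re (levy_exponent A \<gamma> \<nu> (2 ^ k *\<^sub>R x)) / 2 ^ k"
        using Re_ge(1) by (rule divide_right_mono) simp
      moreover have "(2 ^ k *\<^sub>R x) \<bullet> (A *v (2 ^ k *\<^sub>R x)) / 2 ^ k = 2 ^ k * (x \<bullet> (A *v x))"
        by (simp add: matrix_vector_mult_scaleR)
      ultimately have "2 ^ k * (x \<bullet> (A *v x)) \<le> 9 * B" by linarith
      then show ?thesis by (simp add: field_simps)
    qed
    moreover have "(\<lambda>k. 9 * B * inverse (2 ^ k)) \<longlonglongrightarrow> 9 * B * 0"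
      by (intro tendsto_mult tendsto_const LIMSEQ_inverse_realpow_zero) simp
    ultimately have "x \<bullet> (A *v x) \<le> 9 * B * 0" by (intro LIMSEQ_le_const[where X="\<lambda>k. 9 * B * inverse (2 ^ k)"]) auto
    with A[of x] show ?thesis by simp
  qed
  show "\<xi> \<bullet> (A *v \<xi>) = 0"
  proof -
    \<comment> \<open>Rescales into the unit ball, where \<open>unit\<close> applies; adding 1
      covers \<open>\<xi> = 0\<close>.\<close>
    have "norm (\<xi> /\<^sub>R (norm \<xi> + 1)) \<le> 1" by (simp add: inverse_eq_divide divide_le_eq_1 add_nonneg_pos)
    from unit[OF this] show ?thesis
      using norm_ge_zero[of \<xi>] by (simp add: matrix_vector_mult_scaleR add_nonneg_eq_0_iff)
  qed
  let ?c = "(1 - cos 1) / 2 :: real"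
  have c_pos: "0 < ?c" using cos_monotone_0_pi[of 0 1] pi_gt3 by simp
  have osc: "(\<integral>\<^sup>+y. ennreal (?c * \<bar>b \<bullet> y\<bar> * indicator {y. norm y \<le> 1} y) \<partial>\<nu>) \<le> ennreal (9 * B)" if b: "norm b \<le> 1" for b
  proof -
    \<comment> \<open>The index provided by \<open>dyadic_osc_ge\<close> depends on
      \<open>y\<close>, hence the supremum over \<open>N\<close>; the sums increase in
      \<open>N\<close>, so monotone convergence moves it outside.\<close>
    have "(\<integral>\<^sup>+y. ennreal (?c * \<bar>b \<bullet> y\<bar> * indicator {y. norm y \<le> 1} y) \<partial>\<nu>) \<le> (\<integral>\<^sup>+y. (SUP N. ennreal (dyadic_osc N (b \<bullet> y))) \<partial>\<nu>)"
    proof (rule nn_integral_mono)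
      fix y
      show "ennreal (?c * \<bar>b \<bullet> y\<bar> * indicator {y. norm y \<le> 1} y) \<le> (SUP N. ennreal (dyadic_osc N (b \<bullet> y)))"
      proof (cases "norm y \<le> 1")
        case True
        have "\<bar>b \<bullet> y\<bar> \<le> norm b * norm y" by (rule Cauchy_Schwarz_ineq2)
        also have "\<dots> \<le> 1" using True b by (simp add: mult_le_one)
        finally obtain N where "?c * \<bar>b \<bullet> y\<bar> \<le> dyadic_osc N (b \<bullet> y)" using dyadic_osc_ge by blast
        with True show ?thesis by (intro SUP_upper2[of N]) (auto intro: ennreal_leI)
      qed simp
    qed
    also have "\<dots> = (SUP N. \<integral>\<^sup>+y. ennreal (dyadic_osc N (b \<bullet> y)) \<partial>\<nu>)"
    proof (rule nn_integral_monotone_convergence_SUP)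
      show "incseq (\<lambda>N y. ennreal (dyadic_osc N (b \<bullet> y)))"
        by (intro incseq_SucI le_funI ennreal_leI dyadic_osc_mono)
      show "(\<lambda>y. ennreal (dyadic_osc N (b \<bullet> y))) \<in> borel_measurable \<nu>" for N
        unfolding dyadic_osc_def by measurable
    qed
    also have "\<dots> \<le> ennreal (9 * B)"
    proof (rule SUP_least)
      fix N
      have eq: "dyadic_osc N (b \<bullet> y) = (\<Sum>k<N. (1 - cos ((2 ^ k *\<^sub>R b) \<bullet> y)) / 2 ^ k)" for y by (simp add: dyadic_osc_def)
      have i: "integrable \<nu> (\<lambda>y. dyadic_osc N (b \<bullet> y))"
        unfolding eq by (intro Bochner_Integration.integrable_sum integrable_divide integrable_one_minus_cos[OF lm])
      have "(\<integral>y. dyadic_osc N (b \<bullet> y) \<partial>\<nu>) = (\<Sum>k<N. (\<integral>y. 1 - cos ((2 ^ k *\<^sub>R b) \<bullet> y) \<partial>\<nu>) / 2 ^ k)"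
        unfolding eq
        by (subst Bochner_Integration.integral_sum)
           (auto intro!: integrable_divide integrable_one_minus_cos[OF lm] simp del: inner_scaleR_left)
      also have "\<dots> \<le> (\<Sum>k<N. Re (levy_exponent A \<gamma> \<nu> (2 ^ k *\<^sub>R b)) / 2 ^ k)"
        by (intro sum_mono divide_right_mono Re_ge) simp
      also have "\<dots> \<le> 9 * B" by (rule bound[OF _ b])
      finally show "(\<integral>\<^sup>+y. ennreal (dyadic_osc N (b \<bullet> y)) \<partial>\<nu>) \<le> ennreal (9 * B)"
        by (subst nn_integral_eq_integral[OF i]) (auto simp: dyadic_osc_nonneg intro: ennreal_leI)
    qed
    finally show ?thesis .
  qed
  have coord: "integrable \<nu> (\<lambda>y. \<bar>b \<bullet> y\<bar> * indicator {y. norm y \<le> 1} y)" if b: "norm b \<le> 1" for b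
  proof -
    have "integrable \<nu> (\<lambda>y. ?c * \<bar>b \<bullet> y\<bar> * indicator {y. norm y \<le> 1} y)"
      using osc[OF b] c_pos
      by (intro integrableI_nonneg) (auto intro: le_less_trans simp: zero_le_mult_iff)
    then have "integrable \<nu> (\<lambda>y. ?c * (\<bar>b \<bullet> y\<bar> * indicator {y. norm y \<le> 1} y))" by (simp only: mult.assoc)
    from integrable_mult_right[OF this, of "inverse ?c"] show ?thesis
      using c_pos by (simp only: mult.assoc[symmetric] left_inverse[OF less_imp_neq[OF c_pos, symmetric]] mult_1_left)
  qed
  \<comment> \<open>Inside the unit ball the sum of the absolute coordinates dominates
    \<open>norm y\<close>; outside it the second summand is 1.\<close>
  have "integrable \<nu> (\<lambda>y. (\<Sum>b\<in>Basis. \<bar>b \<bullet> y\<bar> * indicator {y. norm y \<le> 1} y) + min 1 ((norm y)\<^sup>2))"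
    by (intro Bochner_Integration.integrable_add Bochner_Integration.integrable_sum coord levy_measure_integrable_square lm) simp
  then show "integrable \<nu> (\<lambda>y. min 1 (norm y))"
  proof (rule Bochner_Integration.integrable_bound)
    show "AE y in \<nu>. norm (min 1 (norm y)) \<le> norm ((\<Sum>b\<in>Basis. \<bar>b \<bullet> y\<bar> * indicator {y. norm y \<le> 1} y) + min 1 ((norm y)\<^sup>2))"
    proof (rule AE_I2)
      fix y
      let ?S = "(\<Sum>b\<in>Basis. \<bar>b \<bullet> y\<bar> * indicator {y. norm y \<le> 1} y) + min 1 ((norm y)\<^sup>2)"
      have "min 1 (norm y) \<le> ?S"
      proof (cases "norm y \<le> 1")
        case True
        then show ?thesis using norm_le_l1[of y] by (simp add: inner_commute add_increasing2)
      next
        case False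
        then have "1 \<le> (norm y)\<^sup>2" by (simp add: one_le_power)
        with False show ?thesis by simp
    qed
      then show "norm (min 1 (norm y)) \<le> norm ?S" by simp
    qed
  qed measurable
qed

section \<open>Heat loss\<close>

context
  fixes \<Omega> :: "(real ^ 'n) set"
  assumes \<Omega>[measurable]: "\<Omega> \<in> sets borel" and fin: "emeasure lborel \<Omega> < \<infinity>"
begin

text \<open>Every directional variation is at most the perimeter, so
  \<open>covariogram_directional_le\<close> with \<open>V = P\<close> gives a linear bound at 0, and
  \<open>covariogram_diff_le\<close> transports it to all pairs. Beyond distance 1 the bound
  \<open>covariogram \<Omega> 0\<close> takes over.\<close>

lemma finite_perimeter_covariogram:
  assumes per: "perimeter \<Omega> < \<infinity>"
  obtains \<kappa> where "\<And>x y. \<bar>covariogram \<Omega> x - covariogram \<Omega> y\<bar> \<le> \<kappa> * min 1 (norm (x - y))"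
    and "\<And>u. norm u = 1 \<Longrightarrow> \<exists>V. directional_variation u \<Omega> = ereal V"
proof -
  \<comment> \<open>The zero test function makes both suprema nonnegative, so that finiteness turns
    them into real numbers.\<close>
  have zero: "C1_compact_support (\<lambda>_. 0 :: real)" "C1_compact_support (\<lambda>_. 0 :: real ^ 'n)"
    unfolding C1_compact_support_def by (auto intro!: exI[of _ "\<lambda>_. 0"] simp: support_on_def zero_blinfun.rep_eq)
  have dv0: "0 \<le> directional_variation u \<Omega>" for u
    unfolding directional_variation_def
    by (rule SUP_upper2[of "\<lambda>_. 0"]) (use zero in \<open>auto simp: gradient_def vec_eq_iff inner_vec_def\<close>)
  obtain u0 :: "real ^ 'n" where "norm u0 = 1" using vector_choose_size[of 1] by auto
  then have "0 \<le> perimeter \<Omega>"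
    using dv0[of u0] directional_variation_le_perimeter[of u0 \<Omega>] by simp
  with per obtain P where P: "perimeter \<Omega> = ereal P" "0 \<le> P" by (cases "perimeter \<Omega>") auto
  have V: "\<exists>V. directional_variation u \<Omega> = ereal V" if "norm u = 1" for u
    using dv0[of u] directional_variation_le_perimeter[OF that, of \<Omega>] P
    by (cases "directional_variation u \<Omega>") auto
  have lin: "covariogram \<Omega> 0 - covariogram \<Omega> y \<le> P / 2 * norm y" for y
  proof (cases "y = 0")
    case False
    define u where "u = y /\<^sub>R norm y"
    have u: "norm u = 1" "y = norm y *\<^sub>R u" using False by (auto simp: u_def)
    have "2 * (covariogram \<Omega> 0 - covariogram \<Omega> (norm y *\<^sub>R u)) \<le> norm y * P"
    proof (rule covariogram_directional_le[OF \<Omega> fin])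
      fix \<phi> :: "real ^ 'n \<Rightarrow> real" assume \<phi>: "C1_compact_support \<phi>" "\<And>x. \<bar>\<phi> x\<bar> \<le> 1"
      have "ereal (\<integral>x. indicator \<Omega> x * (gradient \<phi> x \<bullet> u) \<partial>lborel) \<le> directional_variation u \<Omega>"
        unfolding directional_variation_eq[OF \<Omega> fin] by (rule SUP_upper) (use \<phi> in auto)
      also have "\<dots> \<le> ereal P" using directional_variation_le_perimeter[OF u(1), of \<Omega>] P by simp
      finally show "(\<integral>x. indicator \<Omega> x * (gradient \<phi> x \<bullet> u) \<partial>lborel) \<le> P" by simp
    qed simp
    then show ?thesis unfolding u(2)[symmetric] by (simp add: algebra_simps)
  qed simp
  have "\<bar>covariogram \<Omega> x - covariogram \<Omega> y\<bar> \<le> (covariogram \<Omega> 0 + P / 2) * min 1 (norm (x - y))" for x y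
  proof -
    have c0: "0 \<le> covariogram \<Omega> z" for z by (rule covariogram_bounds[OF \<Omega> fin])
    have le: "\<bar>covariogram \<Omega> x - covariogram \<Omega> y\<bar> \<le> covariogram \<Omega> 0 - covariogram \<Omega> (x - y)"
      by (rule covariogram_diff_le[OF \<Omega> fin])
    show ?thesis
    proof (cases "norm (x - y) \<le> 1")
      case True
      have "0 \<le> covariogram \<Omega> 0 * norm (x - y)" using c0 by simp
      with le lin[of "x - y"] True show ?thesis by (simp add: distrib_right)
    next
      case False
      with le c0[of "x - y"] P(2) show ?thesis by simp
    qed
  qed
  from that[OF this V] show thesis .
qed

text \<open>By Tonelli the total integral is the square of the measure of \<open>\<Omega>\<close>.
  The Fourier representation of the mollifications relies on this.\<close>

lemma integrable_covariogram:
  assumes [measurable]: "covariogram \<Omega> \<in> borel_measurable borel"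
  shows "integrable lborel (covariogram \<Omega>)"
proof (rule integrableI_nonneg)
  have c: "ennreal (covariogram \<Omega> y) = (\<integral>\<^sup>+x. indicator \<Omega> x * indicator \<Omega> (x + y) \<partial>lborel)" for y
  proof -
    have "ennreal (covariogram \<Omega> y) = emeasure lborel {x\<in>\<Omega>. x + y \<in> \<Omega>}"
      unfolding covariogram_def using finite_translates(3)[OF \<Omega> fin]
      by (intro emeasure_eq_ennreal_measure[symmetric]) auto
    also have "\<dots> = (\<integral>\<^sup>+x. indicator {x\<in>\<Omega>. x + y \<in> \<Omega>} x \<partial>lborel)" by simp
    also have "\<dots> = (\<integral>\<^sup>+x. indicator \<Omega> x * indicator \<Omega> (x + y) \<partial>lborel)"
      by (intro nn_integral_cong) (auto simp: indicator_def)
    finally show ?thesis .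
  qed
  have tr: "(\<integral>\<^sup>+y. indicator \<Omega> (x + y) \<partial>lborel) = emeasure lborel \<Omega>" for x
  proof -
    have "(\<integral>\<^sup>+y. indicator \<Omega> (x + y) \<partial>lborel) = (\<integral>\<^sup>+y. indicator {y. y + x \<in> \<Omega>} y \<partial>lborel)"
      by (intro nn_integral_cong) (auto simp: indicator_def add.commute)
    also have "\<dots> = emeasure lborel \<Omega>" by (simp add: measure_lborel_translate)
    finally show ?thesis .
  qed
  have "(\<integral>\<^sup>+y. ennreal (covariogram \<Omega> y) \<partial>lborel) = (\<integral>\<^sup>+y. \<integral>\<^sup>+x. indicator \<Omega> x * indicator \<Omega> (x + y) \<partial>lborel \<partial>lborel)"
    by (simp add: c)
  also have "\<dots> = (\<integral>\<^sup>+x. \<integral>\<^sup>+y. indicator \<Omega> x * indicator \<Omega> (x + y) \<partial>lborel \<partial>lborel)"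
    by (rule lborel_pair.Fubini'[of "\<lambda>x y. indicator \<Omega> x * indicator \<Omega> (x + y)"]) measurable
  also have "\<dots> = emeasure lborel \<Omega> * emeasure lborel \<Omega>"
    by (simp add: nn_integral_cmult tr nn_integral_multc)
  also have "\<dots> < \<infinity>" using fin by (simp add: ennreal_mult_less_top)
  finally show "(\<integral>\<^sup>+y. ennreal (covariogram \<Omega> y) \<partial>lborel) < \<infinity>" .
qed (auto simp: covariogram_bounds[OF \<Omega> fin])

lemma heat_loss_eq:
  assumes "prob_space M" and [measurable]: "X t \<in> borel_measurable M"
  shows "heat_loss M X \<Omega> t = (\<integral>\<omega>. covariogram \<Omega> 0 - covariogram \<Omega> (X t \<omega>) \<partial>M)"
proof -
  interpret prob_space M by fact
  interpret pair_sigma_finite "lborel :: (real ^ 'n) measure" M ..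
  let ?f = "\<lambda>x \<omega>. indicator \<Omega> x * indicator (- \<Omega>) (x + X t \<omega>) :: real"
  have int: "integrable (lborel \<Otimes>\<^sub>M M) (case_prod ?f)"
  proof (rule integrable_pair_bound[where g="indicator \<Omega>" and h="\<lambda>_. 1"])
    show "integrable lborel (indicator \<Omega> :: _ \<Rightarrow> real)" using fin by (intro integrable_real_indicator) auto
  qed (auto simp: indicator_def pair_sigma_finite_axioms)
  have inner: "(\<integral>\<omega>. ?f x \<omega> \<partial>M) = indicator \<Omega> x * \<P>(\<omega> in M. x + X t \<omega> \<in> - \<Omega>)" for x
  proof -
    have "(\<integral>\<omega>. indicator (- \<Omega>) (x + X t \<omega>) \<partial>M) = (\<integral>\<omega>. indicator {\<omega>\<in>space M. x + X t \<omega> \<in> - \<Omega>} \<omega> \<partial>M)"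
      by (intro Bochner_Integration.integral_cong) (auto simp: indicator_def)
    also have "\<dots> = \<P>(\<omega> in M. x + X t \<omega> \<in> - \<Omega>)"
      by (subst Bochner_Integration.integral_indicator) (auto intro!: arg_cong[where f=prob])
    finally show ?thesis by simp
  qed
  have "integrable lborel (\<lambda>x. indicator \<Omega> x * \<P>(\<omega> in M. x + X t \<omega> \<in> - \<Omega>))"
    using integrable_fst[OF int] by (simp only: inner split_conv)
  then have [measurable]: "(\<lambda>x. indicator \<Omega> x * \<P>(\<omega> in M. x + X t \<omega> \<in> - \<Omega>)) \<in> borel_measurable lborel" by auto
  have "heat_loss M X \<Omega> t = (\<integral>x. indicator \<Omega> x * \<P>(\<omega> in M. x + X t \<omega> \<in> - \<Omega>) \<partial>lebesgue)"
    unfolding heat_loss_def set_lebesgue_integral_def by simp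
  also have "\<dots> = (\<integral>x. \<integral>\<omega>. ?f x \<omega> \<partial>M \<partial>lborel)"
    unfolding inner by (rule integral_completion) measurable
  also have "\<dots> = (\<integral>\<omega>. \<integral>x. ?f x \<omega> \<partial>lborel \<partial>M)"
    using Fubini_integral[OF int] by simp
  also have "\<dots> = (\<integral>\<omega>. covariogram \<Omega> 0 - covariogram \<Omega> (X t \<omega>) \<partial>M)"
  proof (intro Bochner_Integration.integral_cong refl)
    fix \<omega>
    have "(\<integral>x. ?f x \<omega> \<partial>lborel) = (\<integral>x. indicator {x\<in>\<Omega>. x + X t \<omega> \<notin> \<Omega>} x \<partial>lborel)"
      by (intro Bochner_Integration.integral_cong) (auto simp: indicator_def)
    also have "\<dots> = measure lborel {x\<in>\<Omega>. x + X t \<omega> \<notin> \<Omega>}" by simp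
    finally show "(\<integral>x. ?f x \<omega> \<partial>lborel) = covariogram \<Omega> 0 - covariogram \<Omega> (X t \<omega>)"
      by (simp only: measure_leaving[OF \<Omega> fin])
  qed
  finally show ?thesis .
qed

lemma levy_perimeter_eq:
  assumes "finite_variation_levy_measure \<nu>"
    and int: "integrable \<nu> (\<lambda>y. covariogram \<Omega> 0 - covariogram \<Omega> y)"
  shows "levy_perimeter \<nu> \<Omega> = ennreal (\<integral>y. covariogram \<Omega> 0 - covariogram \<Omega> y \<partial>\<nu>)"
proof -
  interpret finite_variation_levy_measure \<nu> by fact
  \<comment> \<open>Exchanging the integrals takes a sigma-finite \<open>\<nu>\<close>, which the
    locale derives from its assumptions.\<close>
  interpret pair_sigma_finite "lborel :: (real ^ 'n) measure" \<nu> ..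
  let ?f = "\<lambda>x y. indicator \<Omega> x * indicator (- \<Omega>) (x + y) :: ennreal"
  have inner: "emeasure \<nu> ((\<lambda>z. z - x) ` (- \<Omega>)) * indicator \<Omega> x = (\<integral>\<^sup>+y. ?f x y \<partial>\<nu>)" for x
  proof -
    have "(\<lambda>z. z - x) ` (- \<Omega>) = {y. x + y \<in> - \<Omega>}"
      by (auto simp: image_iff intro!: bexI[of _ "x + _"])
    then have "emeasure \<nu> ((\<lambda>z. z - x) ` (- \<Omega>)) = (\<integral>\<^sup>+y. indicator {y. x + y \<in> - \<Omega>} y \<partial>\<nu>)" by simp
    also have "\<dots> = (\<integral>\<^sup>+y. indicator (- \<Omega>) (x + y) \<partial>\<nu>)"
      by (intro nn_integral_cong) (auto simp: indicator_def)
    finally show ?thesis by (simp add: nn_integral_cmult mult.commute)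
  qed
  have "levy_perimeter \<nu> \<Omega> = (\<integral>\<^sup>+x. \<integral>\<^sup>+y. ?f x y \<partial>\<nu> \<partial>lebesgue)"
    unfolding levy_perimeter_def inner ..
  also have "\<dots> = (\<integral>\<^sup>+x. \<integral>\<^sup>+y. ?f x y \<partial>\<nu> \<partial>lborel)"
    by (rule nn_integral_completion) measurable
  also have "\<dots> = (\<integral>\<^sup>+y. \<integral>\<^sup>+x. ?f x y \<partial>lborel \<partial>\<nu>)"
    by (rule Fubini'[symmetric]) measurable
  also have "\<dots> = (\<integral>\<^sup>+y. ennreal (covariogram \<Omega> 0 - covariogram \<Omega> y) \<partial>\<nu>)"
  proof (intro nn_integral_cong)
    fix y
    have "(\<integral>\<^sup>+x. ?f x y \<partial>lborel) = (\<integral>\<^sup>+x. indicator {x\<in>\<Omega>. x + y \<notin> \<Omega>} x \<partial>lborel)"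
      by (intro nn_integral_cong) (auto simp: indicator_def)
    also have "\<dots> = emeasure lborel {x\<in>\<Omega>. x + y \<notin> \<Omega>}" by simp
    also have "\<dots> = ennreal (measure lborel {x\<in>\<Omega>. x + y \<notin> \<Omega>})"
      using finite_translates(3)[OF \<Omega> fin, where P="\<lambda>x. x + y \<notin> \<Omega>"] by (intro emeasure_eq_ennreal_measure) auto
    finally show "(\<integral>\<^sup>+x. ?f x y \<partial>lborel) = ennreal (covariogram \<Omega> 0 - covariogram \<Omega> y)"
      by (simp only: measure_leaving[OF \<Omega> fin])
  qed
  also have "\<dots> = ennreal (\<integral>y. covariogram \<Omega> 0 - covariogram \<Omega> y \<partial>\<nu>)"
    by (rule nn_integral_eq_integral[OF int]) (auto simp: covariogram_bounds[OF \<Omega> fin])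
  finally show ?thesis .
qed

end

text \<open>The small jumps have a first moment, so the compensator can be integrated on its own and
  joins \<open>\<gamma>\<close> in \<open>levy_drift\<close>. As the exponent enters the
  characteristic function with a minus sign, the linear term is a drift of
  \<open>- levy_drift \<gamma> \<nu>\<close> per unit time.\<close>

lemma levy_exponent_drift:
  assumes lm: "levy_measure \<nu>" and fv: "finite_variation_levy_measure \<nu>" and A: "x \<bullet> (A *v x) = 0"
  shows "levy_exponent A \<gamma> \<nu> x = \<i> * of_real (x \<bullet> levy_drift \<gamma> \<nu>) + finite_variation_levy_measure.psi \<nu> x"
proof -
  interpret finite_variation_levy_measure \<nu> by fact
  let ?i = "indicator {y. norm y \<le> 1} :: real ^ 'n \<Rightarrow> real"
  have drift: "integrable \<nu> (\<lambda>y. ?i y *\<^sub>R y)"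
  proof (rule Bochner_Integration.integrable_bound[OF integrable_min])
    show "AE y in \<nu>. norm (?i y *\<^sub>R y) \<le> norm (min 1 (norm y))" by (auto simp: indicator_def)
  qed measurable
  then have drift_x: "integrable \<nu> (\<lambda>y. x \<bullet> (?i y *\<^sub>R y))" by (rule integrable_inner_right)
  have "(\<integral>y. iexp (x \<bullet> y) - 1 - \<i> * of_real (x \<bullet> y) * indicator {y. norm y \<le> 1} y \<partial>\<nu>)
    = (\<integral>y. - (1 - iexp (x \<bullet> y)) - \<i> * of_real (x \<bullet> (?i y *\<^sub>R y)) \<partial>\<nu>)"
    by (intro Bochner_Integration.integral_cong refl) (simp add: indicator_def)
  also have "\<dots> = (\<integral>y. - (1 - iexp (x \<bullet> y)) \<partial>\<nu>) - (\<integral>y. \<i> * of_real (x \<bullet> (?i y *\<^sub>R y)) \<partial>\<nu>)"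
    by (intro Bochner_Integration.integral_diff Bochner_Integration.integrable_minus integrable_psi
        integrable_mult_right integrable_of_real drift_x)
  also have "\<dots> = - psi x - \<i> * of_real (x \<bullet> (\<integral>y. ?i y *\<^sub>R y \<partial>\<nu>))"
    unfolding psi_def integral_minus integral_mult_right_zero integral_complex_of_real
    by (simp only: integral_inner_right[OF drift])
  finally have I: "(\<integral>y. iexp (x \<bullet> y) - 1 - \<i> * of_real (x \<bullet> y) * indicator {y. norm y \<le> 1} y \<partial>\<nu>)
    = - psi x - \<i> * of_real (x \<bullet> (\<integral>y. ?i y *\<^sub>R y \<partial>\<nu>))" .
  show ?thesis
    unfolding levy_exponent_def I A levy_drift_def set_lebesgue_integral_def
    by (simp add: inner_diff_right right_diff_distrib)
qed

text \<open>Right-continuity at 0 gives almost sure convergence of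
  \<open>X s + s *\<^sub>R g\<close> to 0 along every sequence of positive times tending to 0, and
  dominated convergence turns this into convergence in probability.\<close>

lemma (in levy_process) tendsto_in_probability_0:
  assumes "0 < \<delta>"
  shows "((\<lambda>s. prob {\<omega>\<in>space M. \<delta> < norm (X s \<omega> + s *\<^sub>R g)}) \<longlongrightarrow> 0) (at_right 0)"
proof (rule tendsto_at_right_sequentially[of 0 1])
  fix S :: "nat \<Rightarrow> real" assume S: "\<And>n. 0 < S n" "S \<longlonglongrightarrow> 0"
  have [measurable]: "X (S n) \<in> borel_measurable M" for n
    using S(1)[of n] by (intro random_variables) simp
  let ?E = "\<lambda>n. {\<omega>\<in>space M. \<delta> < norm (X (S n) \<omega> + S n *\<^sub>R g)}"
  have "(\<lambda>n. \<integral>\<omega>. indicator (?E n) \<omega> \<partial>M) \<longlonglongrightarrow> (\<integral>\<omega>. (0 :: real) \<partial>M)"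
  proof (rule integral_dominated_convergence[where w="\<lambda>_. 1"])
    show "AE \<omega> in M. (\<lambda>n. indicator (?E n) \<omega> :: real) \<longlonglongrightarrow> 0"
      using cadlag_paths starts_at_0
    proof eventually_elim
      case (elim \<omega>)
      then have "((\<lambda>t. X t \<omega>) \<longlongrightarrow> 0) (at_right 0)"
        unfolding cadlag_def by (metis order_refl)
      moreover have "filterlim S (at_right 0) sequentially"
        using S less_imp_neq[OF S(1)] by (auto simp: filterlim_at intro!: always_eventually)
      ultimately have "(\<lambda>n. X (S n) \<omega>) \<longlonglongrightarrow> 0" by (rule filterlim_compose)
      then have "(\<lambda>n. X (S n) \<omega> + S n *\<^sub>R g) \<longlonglongrightarrow> 0 + 0 *\<^sub>R g"
        by (intro tendsto_intros S(2))
      then have "(\<lambda>n. norm (X (S n) \<omega> + S n *\<^sub>R g)) \<longlonglongrightarrow> 0"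
        by (simp add: tendsto_norm_zero)
      then have "\<forall>\<^sub>F n in sequentially. norm (X (S n) \<omega> + S n *\<^sub>R g) < \<delta>"
        using assms by (rule order_tendstoD)
      then have "\<forall>\<^sub>F n in sequentially. indicator (?E n) \<omega> = (0 :: real)"
        by eventually_elim auto
      then show ?case by (rule tendsto_eventually)
    qed
  qed auto
  then show "(\<lambda>n. prob (?E n)) \<longlonglongrightarrow> 0" by (simp add: Int_absorb1)
qed simp

theorem theorem3:
  fixes M :: "'w measure"
    and X :: "real \<Rightarrow> 'w \<Rightarrow> real ^ 'n"
    and A :: "real ^ 'n ^ 'n"
    and \<gamma> \<gamma>\<^sub>0 :: "real ^ 'n"
    and \<nu> :: "(real ^ 'n) measure"
    and \<Omega> :: "(real ^ 'n) set"
  assumes "levy_process M X"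
    and "has_levy_triplet M X A \<gamma> \<nu>"
    and "finite_variation_process M X"
    and "\<gamma>\<^sub>0 = levy_drift \<gamma> \<nu>"
    and "open \<Omega>"
    and "emeasure lebesgue \<Omega> < \<infinity>"
    and "perimeter \<Omega> < \<infinity>"
  shows "((\<lambda>t. ereal (inverse t * heat_loss M X \<Omega> t)) \<longlongrightarrow>
            enn2ereal (levy_perimeter \<nu> \<Omega>) +
            (if \<gamma>\<^sub>0 = 0 then 0
             else ereal (norm \<gamma>\<^sub>0 / 2) * directional_variation (\<gamma>\<^sub>0 /\<^sub>R norm \<gamma>\<^sub>0) \<Omega>))
         (at_right 0)"
proof -
  interpret levy_process M X by fact
  note triplet = assms(2)
  let ?c = "covariogram \<Omega>"
  have \<Omega>: "\<Omega> \<in> sets borel" using assms(5) by simp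
  have fin: "emeasure lborel \<Omega> < \<infinity>"
    using assms(6) \<Omega> by (simp add: emeasure_completion)
  obtain \<kappa> where lip: "\<And>x y. \<bar>?c x - ?c y\<bar> \<le> \<kappa> * min 1 (norm (x - y))"
    and V: "\<And>u. norm u = 1 \<Longrightarrow> \<exists>V. directional_variation u \<Omega> = ereal V"
    using finite_perimeter_covariogram[OF \<Omega> fin assms(7)] by metis
  have lm: "levy_measure \<nu>" using triplet by (simp add: has_levy_triplet_def)
  have fv: "finite_variation_levy_measure \<nu>"
    using lm finite_variation_triplet(2)[OF triplet assms(3)]
    by unfold_locales (auto simp: levy_measure_def)
  interpret \<nu>: finite_variation_levy_measure \<nu> by fact
  have c_meas[measurable]: "?c \<in> borel_measurable borel"
  proof (rule borel_measurable_continuous_onI)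
    show "continuous_on UNIV ?c"
      by (rule truncated_lipschitz(2)) (use lip in simp)
  qed
  have exponent: "levy_exponent A \<gamma> \<nu> \<xi> = \<i> * of_real (\<xi> \<bullet> \<gamma>\<^sub>0) + \<nu>.psi \<xi>" for \<xi>
    unfolding assms(4) by (intro levy_exponent_drift lm fv finite_variation_triplet(1)[OF triplet assms(3)])
  \<comment> \<open>The process carries the drift \<open>- \<gamma>\<^sub>0\<close>, so adding
    \<open>s *\<^sub>R \<gamma>\<^sub>0\<close> leaves the pure jump exponent
    \<open>psi\<close>.\<close>
  define Y where "Y s \<omega> = X s \<omega> + s *\<^sub>R \<gamma>\<^sub>0" for s \<omega>
  interpret pure_jump_family \<nu> M Y
  proof
    fix s :: real assume s: "0 \<le> s"
    show "Y s \<in> borel_measurable M"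
      unfolding Y_def using random_variables[OF s] by measurable
    fix \<xi>
    have "(\<integral>\<omega>. iexp (\<xi> \<bullet> Y s \<omega>) \<partial>M) = (\<integral>\<omega>. iexp (s * (\<xi> \<bullet> \<gamma>\<^sub>0)) * iexp (X s \<omega> \<bullet> \<xi>) \<partial>M)"
      by (intro Bochner_Integration.integral_cong refl)
         (simp add: Y_def inner_add_right exp_add[symmetric] distrib_left inner_commute add.commute)
    also have "\<dots> = iexp (s * (\<xi> \<bullet> \<gamma>\<^sub>0)) * (\<integral>\<omega>. iexp (X s \<omega> \<bullet> \<xi>) \<partial>M)"
      by (rule integral_mult_right_zero)
    also have "(\<integral>\<omega>. iexp (X s \<omega> \<bullet> \<xi>) \<partial>M) = exp (- (of_real s * levy_exponent A \<gamma> \<nu> \<xi>))"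
      using triplet s unfolding has_levy_triplet_def by auto
    also have "iexp (s * (\<xi> \<bullet> \<gamma>\<^sub>0)) * \<dots> = exp (- (of_real s * \<nu>.psi \<xi>))"
      unfolding exponent exp_add[symmetric] by (rule arg_cong[where f=exp]) (simp add: algebra_simps)
    finally show "(\<integral>\<omega>. iexp (\<xi> \<bullet> Y s \<omega>) \<partial>M) = exp (- (of_real s * \<nu>.psi \<xi>))" .
  qed
  have "AE \<omega> in M. Y 0 \<omega> = 0" using starts_at_0 by (simp add: Y_def)
  \<comment> \<open>With \<open>g = \<gamma>\<^sub>0\<close> the argument
    \<open>Y t \<omega> - t *\<^sub>R g\<close> is \<open>X t \<omega>\<close> again.\<close>
  from small_time_limit[OF integrable_covariogram[OF \<Omega> fin c_meas] lip this, of \<gamma>\<^sub>0]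
  have jump: "((\<lambda>t. ((\<integral>\<omega>. ?c (X t \<omega>) \<partial>M) - ?c (- t *\<^sub>R \<gamma>\<^sub>0)) / t) \<longlongrightarrow> (\<integral>y. ?c y - ?c 0 \<partial>\<nu>)) (at_right 0)"
    using tendsto_in_probability_0[of _ \<gamma>\<^sub>0] by (simp add: Y_def)
  have int_c: "integrable \<nu> (\<lambda>y. ?c 0 - ?c y)"
  proof (rule Bochner_Integration.integrable_bound)
    show "integrable \<nu> (\<lambda>y. \<kappa> * min 1 (norm y))" using \<nu>.integrable_min by simp
    show "AE y in \<nu>. norm (?c 0 - ?c y) \<le> norm (\<kappa> * min 1 (norm y))"
      using lip[of 0] by (auto intro!: AE_I2 order_trans[OF _ abs_ge_self])
  qed measurable
  have per: "enn2ereal (levy_perimeter \<nu> \<Omega>) = ereal (\<integral>y. ?c 0 - ?c y \<partial>\<nu>)"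
    unfolding levy_perimeter_eq[OF \<Omega> fin fv int_c]
    by (intro enn2ereal_ennreal integral_nonneg_AE) (simp add: covariogram_bounds[OF \<Omega> fin])
  \<comment> \<open>Finiteness of the directional variation makes the drift limit a real
    \<open>L\<close>, so the extended-real sum in the goal is an ordinary one.\<close>
  obtain L where L: "((\<lambda>t. (?c 0 - ?c (- t *\<^sub>R \<gamma>\<^sub>0)) / t) \<longlongrightarrow> L) (at_right 0)"
    and L_eq: "ereal L = (if \<gamma>\<^sub>0 = 0 then 0 else ereal (norm \<gamma>\<^sub>0 / 2) * directional_variation (\<gamma>\<^sub>0 /\<^sub>R norm \<gamma>\<^sub>0) \<Omega>)"
  proof (cases "\<gamma>\<^sub>0 = 0")
    case True
    then show thesis by (intro that[of 0]) auto
  next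
    case False
    let ?u = "\<gamma>\<^sub>0 /\<^sub>R norm \<gamma>\<^sub>0"
    obtain v where v: "directional_variation ?u \<Omega> = ereal v" using V[of ?u] False by auto
    \<comment> \<open>The substitution \<open>r = norm \<gamma>\<^sub>0 * t\<close> turns the limit
      in the unit direction into one in \<open>t\<close> and produces the factor
      \<open>norm \<gamma>\<^sub>0\<close>.\<close>
    have "filterlim (\<lambda>t. norm \<gamma>\<^sub>0 * t) (at_right 0) (at_right 0)"
      using False by (intro filterlim_times_pos[OF filterlim_ident]) auto
    from filterlim_compose[OF covariogram_directional_limit[OF \<Omega> fin v] this]
    have "((\<lambda>t. norm \<gamma>\<^sub>0 * ((?c 0 - ?c ((norm \<gamma>\<^sub>0 * t) *\<^sub>R ?u)) / (norm \<gamma>\<^sub>0 * t))) \<longlongrightarrow> norm \<gamma>\<^sub>0 * (v / 2)) (at_right 0)"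
      by (intro tendsto_mult tendsto_const)
    also have "(\<lambda>t. norm \<gamma>\<^sub>0 * ((?c 0 - ?c ((norm \<gamma>\<^sub>0 * t) *\<^sub>R ?u)) / (norm \<gamma>\<^sub>0 * t))) = (\<lambda>t. (?c 0 - ?c (- t *\<^sub>R \<gamma>\<^sub>0)) / t)"
    proof
      fix t
      \<comment> \<open>The drift points along \<open>- \<gamma>\<^sub>0\<close>; evenness of the
        covariogram replaces it by \<open>\<gamma>\<^sub>0\<close>.\<close>
      have "?c (- t *\<^sub>R \<gamma>\<^sub>0) = ?c (t *\<^sub>R \<gamma>\<^sub>0)"
        using covariogram_minus[OF \<Omega> fin, of "t *\<^sub>R \<gamma>\<^sub>0"] by simp
      moreover have "(norm \<gamma>\<^sub>0 * t) *\<^sub>R ?u = t *\<^sub>R \<gamma>\<^sub>0" using False by simp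
      ultimately show "norm \<gamma>\<^sub>0 * ((?c 0 - ?c ((norm \<gamma>\<^sub>0 * t) *\<^sub>R ?u)) / (norm \<gamma>\<^sub>0 * t)) = (?c 0 - ?c (- t *\<^sub>R \<gamma>\<^sub>0)) / t"
        using False by (simp only: times_divide_eq_right mult_divide_mult_cancel_left_if norm_eq_zero if_False)
    qed
    finally show thesis using False v by (intro that) auto
  qed
  \<comment> \<open>The term \<open>?c (- t *\<^sub>R \<gamma>\<^sub>0)\<close> cancels in this
    difference, which leaves the heat loss divided by \<open>t\<close>.\<close>
  have "((\<lambda>t. (?c 0 - ?c (- t *\<^sub>R \<gamma>\<^sub>0)) / t - ((\<integral>\<omega>. ?c (X t \<omega>) \<partial>M) - ?c (- t *\<^sub>R \<gamma>\<^sub>0)) / t)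
      \<longlongrightarrow> L - (\<integral>y. ?c y - ?c 0 \<partial>\<nu>)) (at_right 0)"
    by (intro tendsto_diff L jump)
  also have "L - (\<integral>y. ?c y - ?c 0 \<partial>\<nu>) = (\<integral>y. ?c 0 - ?c y \<partial>\<nu>) + L"
    using integral_minus[of \<nu> "\<lambda>y. ?c y - ?c 0"] by simp
  finally have "((\<lambda>t. inverse t * heat_loss M X \<Omega> t) \<longlongrightarrow> (\<integral>y. ?c 0 - ?c y \<partial>\<nu>) + L) (at_right 0)"
  proof (rule Lim_transform_eventually)
    show "\<forall>\<^sub>F t in at_right 0. (?c 0 - ?c (- t *\<^sub>R \<gamma>\<^sub>0)) / t - ((\<integral>\<omega>. ?c (X t \<omega>) \<partial>M) - ?c (- t *\<^sub>R \<gamma>\<^sub>0)) / t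
      = inverse t * heat_loss M X \<Omega> t"
      unfolding eventually_at_right_field
    proof (intro exI[of _ 1] conjI allI impI)
      fix t :: real assume t: "0 < t"
      have [measurable]: "X t \<in> borel_measurable M" using t by (intro random_variables) simp
      have "integrable M (\<lambda>\<omega>. ?c (X t \<omega>))"
        using covariogram_bounds[OF \<Omega> fin] by (intro integrable_const_bound[where B="?c 0"]) auto
      then have H: "heat_loss M X \<Omega> t = ?c 0 - (\<integral>\<omega>. ?c (X t \<omega>) \<partial>M)"
        by (subst heat_loss_eq[OF \<Omega> fin prob_space_axioms]) (auto simp: prob_space)
      show "(?c 0 - ?c (- t *\<^sub>R \<gamma>\<^sub>0)) / t - ((\<integral>\<omega>. ?c (X t \<omega>) \<partial>M) - ?c (- t *\<^sub>R \<gamma>\<^sub>0)) / t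
        = inverse t * heat_loss M X \<Omega> t"
        unfolding H by (simp add: divide_inverse algebra_simps)
    qed simp
  qed
  then show ?thesis
    unfolding per L_eq[symmetric] by (simp add: plus_ereal.simps)
qed

end
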